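(* Let $q\ge 1$ and $1\le p\le q$ be integers, and let $f$ be an exponential polynomial of order $q$ in the normalized form $f(z)=H_0(z)e^{w_0z^q}+H_1(z)e^{w_1z^q}+\cdots+H_m(z)e^{w_mz^q}$, where the coefficients $H_j$ are exponential polynomials of order $\rho(H_j)\le q-p$. Let $\varepsilon>0$. Then the number $n(r,1/f)$ of zeros of $f$ in $|z|<r$, counted with multiplicity, satisfies $$n(r,1/f)=q\,C(\operatorname{co}(W_f))\frac{r^q}{2\pi}+O\left(r^{q-p}\log^{3+\varepsilon}r\right)\quad (r\to\infty).$$
   Context: An exponential polynomial is an entire function $P_0e^{Q_0}+\cdots+P_ne^{Q_n}$ with polynomials $P_j,Q_j$; the $Q_j$ are taken pairwise different with $Q_j(0)=0$, and the order is $\max_j\deg Q_j$. Ordinary polynomials are exponential polynomials of order $0$. Every exponential polynomial of order $q\ge1$ can be written in the normalized form $f(z)=\sum_{j=0}^m H_j(z)e^{w_jz^q}$, where $w_0=0$, the leading coefficients $w_0,\ldots,w_m\in\mathbb{C}$ are pairwise distinct (so $w_j\ne0$ for $j\ge1$), $H_1,\ldots,H_m\not\equiv0$, possibly $H_0\equiv 0$, and the $H_j$ are exponential polynomials of order $\le q-p$ for some integer $1\le p\le q$ (if $p=q$ the $H_j$ are ordinary polynomials). $W_f=\{0,\overline{w}_1,\ldots,\overline{w}_m\}$ if $H_0\not\equiv0$, and $W_f=\{\overline{w}_1,\ldots,\overline{w}_m\}$ if $H_0\equiv0$. $\operatorname{co}(W_f)$ is the convex hull and $C(\operatorname{co}(W_f))$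 is its circumference (perimeter); if the hull is a segment this is twice its length, and if it is a point this is $0$. *)

theory Defs
  imports
    "HOL-Complex_Analysis.Complex_Analysis"
    "HOL-Library.Landau_Symbols"
    "HOL-Computational_Algebra.Polynomial"
begin

(* The coefficients are required to be nonzero so that the degrees of the exponents determine the
   order.  The empty sum (n = 0) represents the zero function, which has order 0, like every
   polynomial; this is the reason for inserting 0 into the set of degrees. *)
definition exp_poly_of_order :: "(complex \<Rightarrow> complex) \<Rightarrow> nat \<Rightarrow> bool" where
  "exp_poly_of_order f k \<longleftrightarrow>
     (\<exists>n (P :: nat \<Rightarrow> complex poly) (Q :: nat \<Rightarrow> complex poly).
        inj_on Q {..<n} \<and>
        (\<forall>j<n. P j \<noteq> 0 \<and> poly (Q j) 0 = 0) \<and>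
        f = (\<lambda>z. \<Sum>j<n. poly (P j) z * exp (poly (Q j) z)) \<and>
        k = Max (insert 0 ((\<lambda>j. degree (Q j)) ` {..<n})))"

(* n(r, 1/f).  For an entire f that is not identically zero the index set is finite and zorder f z
   is the multiplicity of the zero z. *)
definition zero_count :: "(complex \<Rightarrow> complex) \<Rightarrow> real \<Rightarrow> real" where
  "zero_count f r = (\<Sum>z | norm z < r \<and> f z = 0. of_int (zorder f z))"

definition conj_exponents ::
    "nat \<Rightarrow> (nat \<Rightarrow> complex \<Rightarrow> complex) \<Rightarrow> (nat \<Rightarrow> complex) \<Rightarrow> complex set" where
  "conj_exponents m H w =
     (if H 0 = (\<lambda>_. 0) then {} else {0}) \<union> (\<lambda>j. cnj (w j)) ` {1..m}"

(* Perimeter of a convex polygon.  An edge is a line segment, so its diameter is its length.  In the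
   degenerate cases the perimeter is twice the length of a segment, and 0 for a point. *)
definition circumference :: "complex set \<Rightarrow> real" where
  "circumference S =
     (if aff_dim S = 2 then (\<Sum>F | F edge_of S. diameter F) else 2 * diameter S)"

end

theory Submission
  imports Defs
begin

text \<open>
  Let \<open>J\<close> be the set of indices with \<open>H\<^sub>j \<noteq> 0\<close> and \<open>s = q - p\<close>. If \<open>f\<close> has no zero on the circle
  \<open>|z| = \<rho>\<close>, then \<open>2\<pi> n(\<rho>)\<close> is the increment of a continuous argument of \<open>f\<close> around this circle.
  Call an angle good if \<open>Re ((w\<^sub>j - w\<^sub>k) e\<^bsup>iq\<theta>\<^esup>)\<close> has modulus at least \<open>\<kappa>\<close> for all \<open>j \<noteq> k\<close>. On an arc of
  good angles a single term \<open>H\<^sub>j exp (w\<^sub>j z\<^sup>q)\<close> dominates, and the argument of \<open>f\<close> changes by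
  \<open>q \<rho>\<^sup>q \<integral> max\<^sub>j Re (w\<^sub>j e\<^bsup>iq\<theta>\<^esup>) d\<theta>\<close> up to the change of the argument of \<open>H\<^sub>j\<close>, which is at most a multiple
  of \<open>r\<^sup>s ln r\<close>. There is a bounded number of further arcs, each of length \<open>O(\<kappa>)\<close>. Such an arc lies in a disc
  of radius \<open>O(\<kappa>\<rho>)\<close> around a point with good angle, where \<open>f\<close> is not small, so Landau's factorization of
  \<open>f exp (- w\<^sub>j z\<^sup>q)\<close> in this disc bounds the change of the argument by \<open>O(\<kappa> \<rho>\<^sup>q)\<close>.

  Domination needs \<open>H\<^sub>j\<close> to be bounded below by \<open>exp (- O(r\<^sup>s ln\<^sup>2 r))\<close> on the circle. This holds when the circle
  has distance at least a power of \<open>1 / r\<close> from the zeros of all \<open>H\<^sub>j\<close>, and every interval of length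
  \<open>r\<^bsup>1 - p\<^esup>\<close> contains such a radius \<open>\<rho>\<close>. With \<open>\<kappa> r\<^sup>q\<close> comparable to \<open>r\<^sup>s ln\<^sup>2 r\<close> this gives an error
  \<open>O(r\<^sup>s ln\<^sup>2 r)\<close>, and monotonicity of \<open>n\<close> carries the estimate over to all radii. Finally, the integral of
  the support function of \<open>co(W\<^sub>f)\<close> is its perimeter (Cauchy): a generic line that meets a convex polygon
  crosses exactly two edges, so the projections of the edges onto a line cover the projection of the
  polygon twice.
\<close>

section \<open>Factorization of entire functions in discs\<close>


text \<open>Borel-Caratheodory inequality: an upper bound for the real part alone controls the
  modulus. The Schwarz lemma gives modulus at most 1/2 for the transformed function at half the
  radius, whence \<open>norm (h z) \<le> (2 * M + norm (h z)) / 2\<close>.\<close>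

lemma borel_caratheodory_zero:
  fixes h :: "complex \<Rightarrow> complex"
  assumes hol: "h holomorphic_on ball c r" and "0 < r" and "0 < M" and "h c = 0"
    and Re_le: "\<And>z. z \<in> ball c r \<Longrightarrow> Re (h z) \<le> M"
    and z: "norm (z - c) \<le> r / 2"
  shows "norm (h z) \<le> 2 * M"
proof -
  \<comment> \<open>\<open>u \<mapsto> u / (2 M - u)\<close> maps the half plane \<open>Re u \<le> M\<close> into the unit disc and fixes \<open>0\<close>\<close>
  define \<phi> where "\<phi> = (\<lambda>x. h (c + of_real r * x) / (of_real (2 * M) - h (c + of_real r * x)))"
  have in_ball: "c + of_real r * x \<in> ball c r" if "norm x < 1" for x
    using that \<open>0 < r\<close> by (simp add: dist_norm norm_mult)
  have nz: "of_real (2 * M) - h (c + of_real r * x) \<noteq> 0" if "norm x < 1" for x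
  proof -
    have "Re (h (c + of_real r * x)) \<le> M" using Re_le in_ball[OF that] by blast
    then have "Re (of_real (2 * M) - h (c + of_real r * x)) \<noteq> 0" using \<open>0 < M\<close> by simp
    then show ?thesis by (metis zero_complex.sel(1))
  qed
  have "(\<lambda>x. h (c + of_real r * x)) holomorphic_on ball 0 1"
    by (intro holomorphic_on_compose_gen[of "\<lambda>x. c + of_real r * x" "ball 0 1" h "ball c r", unfolded o_def]
        holomorphic_intros hol) (use in_ball in auto)
  then have "\<phi> holomorphic_on ball 0 1"
    unfolding \<phi>_def using nz by (intro holomorphic_intros) auto
  moreover have "\<phi> 0 = 0" using \<open>h c = 0\<close> by (simp add: \<phi>_def)
  moreover have "norm (\<phi> x) \<le> 1" if "norm x < 1" for x
  proof -
    let ?u = "h (c + of_real r * x)"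
    have "Re ?u \<le> M" using Re_le in_ball[OF that] by blast
    \<comment> \<open>The product is exactly the difference of the squared moduli of
      \<open>2 * M - ?u\<close> and \<open>?u\<close>.\<close>
    then have "0 \<le> 4 * M * (M - Re ?u)" using \<open>0 < M\<close> by simp
    then have "(norm ?u)^2 \<le> (norm (of_real (2 * M) - ?u))^2"
      unfolding cmod_power2 by (simp add: power2_eq_square algebra_simps)
    then have "norm ?u \<le> norm (of_real (2 * M) - ?u)" by (rule power2_le_imp_le) simp
    then show ?thesis using nz[OF that] by (simp add: \<phi>_def norm_divide divide_le_eq)
  qed
  \<comment> \<open>The Schwarz lemma wants the strict bound. Modulus 1 at an interior point would
    make \<phi> constant by the maximum principle, against \<open>\<phi> 0 = 0\<close>.\<close>
  moreover have "norm (\<phi> x) < 1" if "norm x < 1" for x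
  proof (rule ccontr)
    assume "\<not> norm (\<phi> x) < 1"
    then have x1: "norm (\<phi> x) \<ge> 1" by simp
    have "\<phi> constant_on ball 0 1"
    proof (rule maximum_modulus_principle[OF calculation(1), of "ball 0 1" x])
      show "norm (\<phi> y) \<le> norm (\<phi> x)" if "y \<in> ball 0 1" for y
        using that x1 calculation(3)[of y] by simp
    qed (use that in auto)
    then have "\<phi> x = \<phi> 0" using that by (auto simp: constant_on_def)
    then show False using x1 calculation(2) by simp
  qed
  ultimately have schw: "norm (\<phi> x) \<le> norm x" if "norm x < 1" for x
    using Schwarz_Lemma(1)[of \<phi> x] that by blast
  define x where "x = (z - c) / of_real r"
  have nx: "norm x \<le> 1 / 2" using z \<open>0 < r\<close> by (simp add: x_def norm_divide divide_le_eq)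
  have zx: "c + of_real r * x = z" using \<open>0 < r\<close> by (simp add: x_def)
  have "norm (\<phi> x) \<le> 1 / 2" using schw[of x] nx by simp
  then have "norm (h z) \<le> norm (of_real (2 * M) - h z) / 2"
    using nz[of x] nx unfolding \<phi>_def zx by (simp add: norm_divide divide_le_eq)
  also have "\<dots> \<le> (2 * M + norm (h z)) / 2"
    using norm_triangle_ineq4[of "of_real (2 * M)" "h z"] \<open>0 < M\<close> by simp
  finally show ?thesis by simp
qed

text \<open>For an entire function that is not identically zero all orders are nonnegative, so
  \<open>nat\<close> changes nothing.\<close>

definition zero_poly :: "(complex \<Rightarrow> complex) \<Rightarrow> complex set \<Rightarrow> complex \<Rightarrow> complex" where
  "zero_poly g Z z = (\<Prod>a\<in>Z. (z - a) ^ nat (zorder g a))"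

lemma zorder_zero_poly:
  assumes "finite Z" "a \<in> Z" "zorder g a \<ge> 0"
  shows "zorder (zero_poly g Z) a = zorder g a"
proof (rule zorder_eqI[of UNIV _ "zero_poly g (Z - {a})"])
  show "zero_poly g (Z - {a}) holomorphic_on UNIV"
    unfolding zero_poly_def[abs_def] by (intro holomorphic_intros)
  show "zero_poly g (Z - {a}) a \<noteq> 0"
    using assms by (auto simp: zero_poly_def)
  show "zero_poly g Z z = zero_poly g (Z - {a}) z * (z - a) powi zorder g a" for z
    using assms by (simp add: zero_poly_def prod.remove power_int_def mult.commute)
qed auto

lemma entire_finite_zeros:
  assumes "g holomorphic_on UNIV" "g z0 \<noteq> (0::complex)" "bounded B"
  shows "finite {z\<in>B. g z = 0}"
proof -
  obtain r where "B \<subseteq> cball 0 r" using assms(3) by (auto simp: bounded_iff subset_iff)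
  have "finite {z \<in> cball 0 r. g z = 0}"
  proof (cases "\<exists>z\<in>cball 0 r. g z = 0")
    case True
    then have "\<not> g constant_on UNIV" using assms(2) by (metis UNIV_I constant_on_def)
    then show ?thesis
      by (intro holomorphic_compact_finite_zeros[OF assms(1)]) (auto simp: connected_UNIV)
  next
    case False
    then have "{z \<in> cball 0 r. g z = 0} = {}" by blast
    then show ?thesis by (metis finite.emptyI)
  qed
  then show ?thesis by (rule rev_finite_subset) (use \<open>B \<subseteq> cball 0 r\<close> in auto)
qed

lemma entire_zorder:
  assumes "g holomorphic_on UNIV" "g z0 \<noteq> (0::complex)"
  shows "zorder g a \<ge> 0" "g a = 0 \<Longrightarrow> zorder g a > 0"
proof -
  have "if g a = 0 then zorder g a > 0 else zorder g a = 0"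
    by (rule conjunct1[OF zorder_exist_zero[OF assms(1) open_UNIV connected_UNIV]]) (use assms(2) in auto)
  then show "zorder g a \<ge> 0" "g a = 0 \<Longrightarrow> zorder g a > 0" by (auto split: if_splits)
qed

text \<open>All zeros in the ball are divided out first, which leaves a zero-free quotient, and
  those outside \<open>Z\<close> are multiplied back. \<open>Z\<close> is kept general because
  Landau's factorization removes only the zeros near the centre, whereas the argument principle
  removes all.\<close>

lemma entire_factor_zeros:
  assumes hol: "g holomorphic_on UNIV" and nz: "g z0 \<noteq> (0::complex)" and ZB: "Z \<subseteq> ball c R"
    and Z: "\<And>z. z \<in> Z \<Longrightarrow> g z = 0"
  obtains G where "G holomorphic_on ball c R"
    "\<And>z. z \<in> ball c R \<Longrightarrow> g z = zero_poly g Z z * G z"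
    "\<And>z. z \<in> ball c R \<Longrightarrow> G z = 0 \<longleftrightarrow> g z = 0 \<and> z \<notin> Z"
proof -
  define Y where "Y = {z \<in> ball c R. g z = 0}"
  have finY: "finite Y" unfolding Y_def by (rule entire_finite_zeros[OF hol nz]) simp
  have ZY: "Z \<subseteq> Y" using ZB Z by (auto simp: Y_def)
  have ord: "zorder g a > 0" if "g a = 0" for a using entire_zorder(2)[OF hol nz that] .
  have zp0: "zero_poly g X z = 0 \<longleftrightarrow> z \<in> X" if "X \<subseteq> Y" for X z
  proof -
    have "finite X" using that finY finite_subset by blast
    then show ?thesis using that ord by (force simp: zero_poly_def Y_def)
  qed
  have holp: "zero_poly g X holomorphic_on A" for X A
    unfolding zero_poly_def[abs_def] by (intro holomorphic_intros)
  have ordY: "zorder (zero_poly g Y) z = zorder g z" if z: "z \<in> ball c R" for z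
  proof (cases "z \<in> Y")
    case True
    then show ?thesis using zorder_zero_poly[OF finY True] entire_zorder(1)[OF hol nz] by simp
  next
    case False
    have an: "f analytic_on {z}" if "f holomorphic_on UNIV" for f
      using that analytic_on_open[of UNIV f] analytic_on_subset by blast
    have "zorder (zero_poly g Y) z = 0" using False zp0[of Y z] an[OF holp] by (intro zorder_eq_0I) auto
    moreover have "zorder g z = 0" using False z an[OF hol] by (intro zorder_eq_0I) (auto simp: Y_def)
    ultimately show ?thesis by simp
  qed
  obtain h where h: "h holomorphic_on ball c R" "\<And>z. z \<in> ball c R \<Longrightarrow> h z \<noteq> 0"
      "\<And>z. z \<in> ball c R \<Longrightarrow> g z = h z * zero_poly g Y z"
  proof (rule holomorphic_zorder_factorization[of g "ball c R" "zero_poly g Y"])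
    show "g holomorphic_on ball c R" using hol by (rule holomorphic_on_subset) simp
    show "zero_poly g Y z = 0 \<longleftrightarrow> g z = 0" if "z \<in> ball c R" for z
      using zp0[of Y z] that by (simp add: Y_def)
  qed (use holp ordY in auto)
  show ?thesis
  proof (rule that[of "\<lambda>z. h z * zero_poly g (Y - Z) z"])
    show "(\<lambda>z. h z * zero_poly g (Y - Z) z) holomorphic_on ball c R"
      by (intro holomorphic_intros h holp)
    have "zero_poly g Y z = zero_poly g Z z * zero_poly g (Y - Z) z" for z
      using prod.subset_diff[OF ZY finY] by (simp add: zero_poly_def mult.commute)
    then show "g z = zero_poly g Z z * (h z * zero_poly g (Y - Z) z)" if "z \<in> ball c R" for z
      using h(3)[OF that] by simp
    show "h z * zero_poly g (Y - Z) z = 0 \<longleftrightarrow> g z = 0 \<and> z \<notin> Z" if "z \<in> ball c R" for z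
      using h(2)[OF that] zp0[of "Y - Z" z] that by (auto simp: Y_def)
  qed
qed

text \<open>Growth relative to the value at the centre controls both the number of zeros and the
  oscillation of the logarithm of the rest. Division by the zeros near the centre gains a factor 2
  per zero on the outer circle, so the maximum principle forces \<open>2 ^ N \<le> exp M\<close>;
  the quotient has no zeros in the inner disc, and the Borel-Caratheodory inequality applies to its
  logarithm.\<close>

lemma landau_factorization:
  fixes g :: "complex \<Rightarrow> complex"
  defines "Z \<equiv> \<lambda>z0 R. {z \<in> cball z0 (R / 3). g z = 0}"
  assumes hol: "g holomorphic_on UNIV" and nz: "g z0 \<noteq> 0" and "0 < R" and "0 < M"
    and bound: "\<And>z. norm (z - z0) \<le> R \<Longrightarrow> norm (g z) \<le> exp M * norm (g z0)"
  obtains h where "finite (Z z0 R)" "real (\<Sum>a\<in>Z z0 R. nat (zorder g a)) \<le> 2 * M"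
    "continuous_on (ball z0 (R / 3)) h"
    "\<And>z. z \<in> ball z0 (R / 3) \<Longrightarrow> g z = zero_poly g (Z z0 R) z * exp (h z)"
    "\<And>z. norm (z - z0) \<le> R / 6 \<Longrightarrow> norm (h z - h z0) \<le> 2 * M"
proof -
  define Y where "Y = Z z0 R"
  define N where "N = (\<Sum>a\<in>Y. nat (zorder g a))"
  have Yball: "Y \<subseteq> ball z0 (2 * R)" using \<open>0 < R\<close> by (auto simp: Y_def Z_def)
  have finY: "finite Y" unfolding Y_def Z_def by (rule entire_finite_zeros[OF hol nz]) simp
  have gY: "g z = 0" if "z \<in> Y" for z using that by (simp add: Y_def Z_def)
  obtain G where G: "G holomorphic_on ball z0 (2 * R)"
    "\<And>z. z \<in> ball z0 (2 * R) \<Longrightarrow> g z = zero_poly g Y z * G z"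
    "\<And>z. z \<in> ball z0 (2 * R) \<Longrightarrow> G z = 0 \<longleftrightarrow> g z = 0 \<and> z \<notin> Y"
    using entire_factor_zeros[OF hol nz Yball gY] by blast
  have z0b: "z0 \<in> ball z0 (2 * R)" using \<open>0 < R\<close> by simp
  have Gz0: "G z0 \<noteq> 0" using G(3)[OF z0b] nz by simp
  have zp0: "zero_poly g Y z0 \<noteq> 0" using G(2)[OF z0b] nz by auto
  have frontier_le: "2 ^ N * norm (G z) \<le> exp M * norm (G z0)" if z: "norm (z - z0) = R" for z
  proof -
    have zb: "z \<in> ball z0 (2 * R)" using z \<open>0 < R\<close> by (simp add: dist_norm norm_minus_commute)
    \<comment> \<open>a zero within \<open>R / 3\<close> of the centre is at least twice as far from the boundary circle\<close>
    have "2 ^ N * norm (zero_poly g Y z0) = (\<Prod>a\<in>Y. (2 * norm (z0 - a)) ^ nat (zorder g a))"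
      by (simp add: N_def zero_poly_def power_mult_distrib prod.distrib power_sum prod_norm[symmetric] norm_power)
    also have "\<dots> \<le> (\<Prod>a\<in>Y. norm (z - a) ^ nat (zorder g a))"
    proof (intro prod_mono conjI power_mono)
      fix a assume "a \<in> Y"
      then have "norm (z0 - a) \<le> R / 3" by (simp add: Y_def Z_def dist_norm)
      moreover have "R \<le> norm (z - a) + norm (z0 - a)"
        using z norm_triangle_ineq4[of "z - a" "z0 - a"] by simp
      ultimately show "2 * norm (z0 - a) \<le> norm (z - a)" by simp
    qed auto
    also have "\<dots> = norm (zero_poly g Y z)"
      by (simp add: zero_poly_def prod_norm[symmetric] norm_power)
    finally have "2 ^ N * norm (zero_poly g Y z0) * norm (G z) \<le> norm (g z)"
      using G(2)[OF zb] by (simp add: norm_mult mult_right_mono)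
    also have "\<dots> \<le> exp M * norm (zero_poly g Y z0) * norm (G z0)"
      using bound[of z] z G(2)[OF z0b] by (simp add: norm_mult mult.assoc)
    finally show ?thesis using zp0 by (simp add: mult_ac)
  qed
  have all_le: "2 ^ N * norm (G z) \<le> exp M * norm (G z0)" if "norm (z - z0) \<le> R" for z
  proof -
    have "norm (G z) \<le> exp M * norm (G z0) / 2 ^ N"
    proof (rule maximum_modulus_frontier[of G "cball z0 R"])
      show "G holomorphic_on interior (cball z0 R)" "continuous_on (closure (cball z0 R)) G"
        using \<open>0 < R\<close> by (auto intro!: holomorphic_on_subset[OF G(1)] 
           continuous_on_subset[OF holomorphic_on_imp_continuous_on[OF G(1)]])
      fix w assume "w \<in> frontier (cball z0 R)"
      then show "norm (G w) \<le> exp M * norm (G z0) / 2 ^ N"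
        using frontier_le[of w] by (simp add: dist_norm norm_minus_commute field_simps)
    qed (use that in \<open>auto simp: dist_norm norm_minus_commute\<close>)
    then show ?thesis by (simp add: field_simps)
  qed
  have N_le: "real N \<le> 2 * M"
  proof -
    have "2 ^ N \<le> exp M" using all_le[of z0] \<open>0 < R\<close> Gz0 by simp
    then have "ln (2 ^ N) \<le> ln (exp M)" by (subst ln_le_cancel_iff) auto
    then have "real N * ln 2 \<le> M" by (simp add: ln_realpow)
    moreover have "real N * (1 / 2) \<le> real N * ln 2"
      by (intro mult_left_mono) (use ln2_ge_two_thirds in auto)
    ultimately show ?thesis by simp
  qed
  have sub: "ball z0 (R / 3) \<subseteq> ball z0 (2 * R)" using \<open>0 < R\<close> by auto
  obtain h where h: "h holomorphic_on ball z0 (R / 3)"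
    and Gh: "\<And>z. z \<in> ball z0 (R / 3) \<Longrightarrow> G z = exp (h z)"
  proof (rule contractible_imp_holomorphic_log[of G "ball z0 (R / 3)"])
    show "G z \<noteq> 0" if "z \<in> ball z0 (R / 3)" for z
      using G(3)[of z] that sub by (auto simp: Y_def Z_def)
  qed (use G(1) sub in \<open>auto intro: holomorphic_on_subset convex_imp_contractible\<close>)
  show ?thesis
  proof (rule that)
    show "continuous_on (ball z0 (R / 3)) h" using h by (rule holomorphic_on_imp_continuous_on)
    show "g z = zero_poly g (Z z0 R) z * exp (h z)" if "z \<in> ball z0 (R / 3)" for z
      using G(2)[of z] Gh[OF that] that sub by (auto simp: Y_def)
    show "norm (h z - h z0) \<le> 2 * M" if z: "norm (z - z0) \<le> R / 6" for z
    proof (rule borel_caratheodory_zero[of "\<lambda>z. h z - h z0" z0 "R / 3"])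
      show "Re (h w - h z0) \<le> M" if w: "w \<in> ball z0 (R / 3)" for w
      proof -
        have "norm (G w) \<le> 2 ^ N * norm (G w)" using mult_right_mono[of 1 "2 ^ N" "norm (G w)"] by simp
        also have "\<dots> \<le> exp M * norm (G z0)"
          using w \<open>0 < R\<close> by (intro all_le) (simp add: dist_norm norm_minus_commute)
        finally have "exp (Re (h w)) \<le> exp (M + Re (h z0))"
          using Gh[of z0] Gh[OF w] \<open>0 < R\<close> by (simp add: exp_add)
        then show ?thesis by simp
      qed
    qed (use z h \<open>0 < R\<close> \<open>0 < M\<close> in \<open>auto intro!: holomorphic_intros\<close>)
  qed (use finY N_le in \<open>simp_all add: Y_def N_def\<close>)
qed

section \<open>Variation of the argument along circular arcs\<close>

text \<open>Two continuous logarithms of one function differ by multiples of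
  \<open>2 * pi * \<i>\<close>, a discrete set, hence by a constant on an interval. Thus the change
  of the argument does not depend on the branch.\<close>

lemma continuous_log_unique:
  fixes L1 L2 :: "real \<Rightarrow> complex"
  assumes "continuous_on {\<alpha>..\<beta>} L1" "continuous_on {\<alpha>..\<beta>} L2" "\<alpha> \<le> \<beta>"
    and eq: "\<And>x. x \<in> {\<alpha>..\<beta>} \<Longrightarrow> exp (L1 x) = exp (L2 x)"
  shows "L1 \<beta> - L1 \<alpha> = L2 \<beta> - L2 \<alpha>"
proof -
  have "(\<lambda>x. L1 x - L2 x) constant_on {\<alpha>..\<beta>}"
  proof (rule continuous_discrete_range_constant)
    fix x assume x: "x \<in> {\<alpha>..\<beta>}"
    have "2 * pi \<le> norm (L1 y - L2 y - (L1 x - L2 x))"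
      if y: "y \<in> {\<alpha>..\<beta>}" "L1 y - L2 y \<noteq> L1 x - L2 x" for y
    proof -
      obtain m n where "L1 y = L2 y + of_int (2 * m) * pi * \<i>" "L1 x = L2 x + of_int (2 * n) * pi * \<i>"
        using eq[OF x] eq[OF y(1)] by (auto simp: exp_eq)
      then have d: "L1 y - L2 y - (L1 x - L2 x) = of_int (m - n) * of_real (2 * pi) * \<i>"
        by (simp add: algebra_simps)
      then have "norm (L1 y - L2 y - (L1 x - L2 x)) = \<bar>real_of_int (m - n)\<bar> * (2 * pi)"
        by (simp add: norm_mult del: of_int_diff)
      moreover have "m \<noteq> n" using d y(2) by auto
      then have "1 \<le> \<bar>m - n\<bar>" by simp
      then have "1 \<le> \<bar>real_of_int (m - n)\<bar>" by linarith
      ultimately show ?thesis using mult_right_mono[of 1 "\<bar>real_of_int (m - n)\<bar>" "2 * pi"] by simp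
    qed
    then show "\<exists>e>0. \<forall>y. y \<in> {\<alpha>..\<beta>} \<and> L1 y - L2 y \<noteq> L1 x - L2 x \<longrightarrow>
        e \<le> norm (L1 y - L2 y - (L1 x - L2 x))"
      by (intro exI[of _ "2 * pi"]) auto
  qed (use assms in \<open>auto intro!: continuous_intros\<close>)
  then have "L1 \<beta> - L2 \<beta> = L1 \<alpha> - L2 \<alpha>"
    using \<open>\<alpha> \<le> \<beta>\<close> by (auto simp: constant_on_def)
  then show ?thesis by (simp add: algebra_simps)
qed

text \<open>The term of larger modulus, \<open>of_real \<rho> * cis \<theta>\<close> or
  \<open>- a\<close>, is pulled out and leaves \<open>1 - u\<close> with \<open>norm u < 1\<close>,
  whose principal logarithm is continuous. The bound \<open>4 * pi\<close> allows for a rotation by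
  \<open>2 * pi\<close> and for \<open>pi\<close> from that logarithm at each end.\<close>

lemma arg_variation_linear:
  fixes a :: complex
  assumes "0 < \<rho>" "norm a \<noteq> \<rho>"
  shows "\<exists>L. continuous_on UNIV L \<and> (\<forall>\<theta>. exp (L \<theta>) = of_real \<rho> * cis \<theta> - a) \<and>
     (\<forall>\<alpha> \<beta>. \<alpha> \<le> \<beta> \<longrightarrow> \<beta> \<le> \<alpha> + 2 * pi \<longrightarrow> \<bar>Im (L \<beta> - L \<alpha>)\<bar> \<le> 4 * pi) \<and>
     Im (L (2 * pi) - L 0) = (if norm a < \<rho> then 2 * pi else 0)"
proof -
  have Im_Ln: "\<bar>Im (Ln z)\<bar> \<le> pi" if "z \<noteq> 0" for z
    using mpi_less_Im_Ln[OF that] Im_Ln_le_pi[OF that] by simp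
  have small: "1 - u \<notin> \<real>\<^sub>\<le>\<^sub>0 \<and> 1 - u \<noteq> 0" if "norm u < 1" for u :: complex
  proof -
    have "Re u < 1" using that complex_Re_le_cmod[of u] by simp
    then show ?thesis by (auto simp: complex_nonpos_Reals_iff)
  qed
  show ?thesis
  proof (cases "norm a < \<rho>")
    case True
    define u where "u = (\<lambda>\<theta>. a / (of_real \<rho> * cis \<theta>))"
    have u: "norm (u \<theta>) < 1" for \<theta> using True \<open>0 < \<rho>\<close> by (simp add: u_def norm_divide norm_mult)
    define L where "L = (\<lambda>\<theta>. of_real (ln \<rho>) + \<i> * of_real \<theta> + Ln (1 - u \<theta>))"
    have "continuous_on UNIV L"
      unfolding L_def using small[OF u] \<open>0 < \<rho>\<close>
      by (intro continuous_intros) (auto simp: u_def intro!: continuous_intros)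
    moreover have "exp (L \<theta>) = of_real \<rho> * cis \<theta> - a" for \<theta>
    proof -
      have "exp (L \<theta>) = of_real \<rho> * cis \<theta> * (1 - u \<theta>)"
        using small[OF u] \<open>0 < \<rho>\<close> by (simp add: L_def exp_add cis_conv_exp exp_of_real)
      then show ?thesis using \<open>0 < \<rho>\<close> by (simp add: u_def algebra_simps)
    qed
    moreover have "\<bar>Im (L \<beta> - L \<alpha>)\<bar> \<le> 4 * pi" if "\<alpha> \<le> \<beta>" "\<beta> \<le> \<alpha> + 2 * pi" for \<alpha> \<beta>
      using that Im_Ln[of "1 - u \<alpha>"] Im_Ln[of "1 - u \<beta>"] small[OF u] by (simp add: L_def abs_le_iff)
    moreover have "Im (L (2 * pi) - L 0) = 2 * pi"
      by (simp add: L_def u_def)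
    ultimately show ?thesis using True by (intro exI[of _ L]) auto
  next
    case False
    then have a: "\<rho> < norm a" "a \<noteq> 0" using assms by auto
    define u where "u = (\<lambda>\<theta>. of_real \<rho> * cis \<theta> / a)"
    have u: "norm (u \<theta>) < 1" for \<theta> using a \<open>0 < \<rho>\<close> by (simp add: u_def norm_divide norm_mult)
    define L where "L = (\<lambda>\<theta>. Ln (- a) + Ln (1 - u \<theta>))"
    have "continuous_on UNIV L"
      unfolding L_def using small[OF u] a
      by (intro continuous_intros) (auto simp: u_def intro!: continuous_intros)
    moreover have "exp (L \<theta>) = of_real \<rho> * cis \<theta> - a" for \<theta>
    proof -
      have "exp (L \<theta>) = - a * (1 - u \<theta>)"
        using small[OF u] a by (simp add: L_def exp_add)
      then show ?thesis using a by (simp add: u_def algebra_simps)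
    qed
    moreover have "\<bar>Im (L \<beta> - L \<alpha>)\<bar> \<le> 4 * pi" if "\<alpha> \<le> \<beta>" "\<beta> \<le> \<alpha> + 2 * pi" for \<alpha> \<beta>
      using that Im_Ln[of "1 - u \<alpha>"] Im_Ln[of "1 - u \<beta>"] small[OF u] by (simp add: L_def abs_le_iff)
    moreover have "Im (L (2 * pi) - L 0) = 0"
      by (simp add: L_def u_def)
    ultimately show ?thesis using False by (intro exI[of _ L]) auto
  qed
qed


text \<open>Sums the logarithms of the linear factors with multiplicity. The bound on arcs serves
  Landau's factorization, the full turn serves the argument principle.\<close>

lemma zero_poly_log:
  assumes "finite Z" "0 < \<rho>" "\<And>a. a \<in> Z \<Longrightarrow> norm a \<noteq> \<rho>"
  obtains L where "continuous_on UNIV L" "\<And>\<theta>. exp (L \<theta>) = zero_poly g Z (of_real \<rho> * cis \<theta>)"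
    "\<And>\<alpha> \<beta>. \<alpha> \<le> \<beta> \<Longrightarrow> \<beta> \<le> \<alpha> + 2 * pi \<Longrightarrow>
       \<bar>Im (L \<beta> - L \<alpha>)\<bar> \<le> 4 * pi * real (\<Sum>a\<in>Z. nat (zorder g a))"
    "Im (L (2 * pi) - L 0) = 2 * pi * real (\<Sum>a | a \<in> Z \<and> norm a < \<rho>. nat (zorder g a))"
proof -
  define P where "P = (\<lambda>a L. continuous_on UNIV L \<and> (\<forall>\<theta>. exp (L \<theta>) = of_real \<rho> * cis \<theta> - a) \<and>
     (\<forall>\<alpha> \<beta>. \<alpha> \<le> \<beta> \<longrightarrow> \<beta> \<le> \<alpha> + 2 * pi \<longrightarrow> \<bar>Im (L \<beta> - L \<alpha>)\<bar> \<le> 4 * pi) \<and>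
     Im (L (2 * pi) - L 0) = (if norm a < \<rho> then 2 * pi else 0))"
  have "\<forall>a\<in>Z. \<exists>L. P a L"
    using arg_variation_linear[OF assms(2) assms(3)] unfolding P_def by (intro ballI)
  then obtain \<Lambda> where \<Lambda>P: "\<And>a. a \<in> Z \<Longrightarrow> P a (\<Lambda> a)" using bchoice[of Z P] by blast
  have \<Lambda>: "continuous_on UNIV (\<Lambda> a)" "\<And>\<theta>. exp (\<Lambda> a \<theta>) = of_real \<rho> * cis \<theta> - a"
    "\<And>\<alpha> \<beta>. \<alpha> \<le> \<beta> \<Longrightarrow> \<beta> \<le> \<alpha> + 2 * pi \<Longrightarrow> \<bar>Im (\<Lambda> a \<beta> - \<Lambda> a \<alpha>)\<bar> \<le> 4 * pi"
    "Im (\<Lambda> a (2 * pi) - \<Lambda> a 0) = (if norm a < \<rho> then 2 * pi else 0)" if "a \<in> Z" for a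
    using \<Lambda>P[OF that] unfolding P_def by simp_all
  define L where "L = (\<lambda>\<theta>. \<Sum>a\<in>Z. of_nat (nat (zorder g a)) * \<Lambda> a \<theta>)"
  have Im_diff: "Im (L \<beta> - L \<alpha>) = (\<Sum>a\<in>Z. real (nat (zorder g a)) * Im (\<Lambda> a \<beta> - \<Lambda> a \<alpha>))" for \<alpha> \<beta>
    unfolding L_def sum_subtractf[symmetric] right_diff_distrib[symmetric] Im_sum by simp
  show ?thesis
  proof (rule that[of L])
    show "continuous_on UNIV L" unfolding L_def by (intro continuous_intros \<Lambda>(1))
    show "exp (L \<theta>) = zero_poly g Z (of_real \<rho> * cis \<theta>)" for \<theta>
      unfolding L_def exp_sum[OF assms(1)] zero_poly_def
      by (intro prod.cong) (simp_all add: exp_of_nat_mult \<Lambda>(2))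
    show "\<bar>Im (L \<beta> - L \<alpha>)\<bar> \<le> 4 * pi * real (\<Sum>a\<in>Z. nat (zorder g a))"
      if "\<alpha> \<le> \<beta>" "\<beta> \<le> \<alpha> + 2 * pi" for \<alpha> \<beta>
    proof -
      have "\<bar>Im (L \<beta> - L \<alpha>)\<bar> \<le> (\<Sum>a\<in>Z. real (nat (zorder g a)) * \<bar>Im (\<Lambda> a \<beta> - \<Lambda> a \<alpha>)\<bar>)"
        unfolding Im_diff by (rule order_trans[OF sum_abs], rule sum_mono, simp only: abs_mult abs_of_nat order_refl)
      also have "\<dots> \<le> (\<Sum>a\<in>Z. real (nat (zorder g a)) * (4 * pi))"
        using \<Lambda>(3)[OF _ that] by (intro sum_mono mult_left_mono) auto
      finally show ?thesis by (simp add: sum_distrib_left mult_ac del: of_nat_nat)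
    qed
    have "Im (L (2 * pi) - L 0) = (\<Sum>a\<in>Z. if norm a < \<rho> then real (nat (zorder g a)) * (2 * pi) else 0)"
      unfolding Im_diff by (intro sum.cong) (simp_all add: \<Lambda>(4) del: of_nat_nat minus_complex.simps)
    also have "\<dots> = (\<Sum>a | a \<in> Z \<and> norm a < \<rho>. real (nat (zorder g a)) * (2 * pi))"
      using assms(1) by (simp add: sum.inter_filter del: of_nat_nat)
    finally show "Im (L (2 * pi) - L 0) = 2 * pi * real (\<Sum>a | a \<in> Z \<and> norm a < \<rho>. nat (zorder g a))"
      by (simp add: sum_distrib_left mult_ac del: of_nat_nat)
  qed
qed

lemma continuous_on_circle_compose:
  assumes "continuous_on B h" "\<And>\<theta>. \<theta> \<in> A \<Longrightarrow> of_real \<rho> * cis \<theta> \<in> B"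
  shows "continuous_on A (\<lambda>\<theta>. h (of_real \<rho> * cis \<theta>))"
  by (rule continuous_on_compose2[OF assms(1)]) (use assms(2) in \<open>auto intro!: continuous_intros\<close>)

text \<open>In Landau's factorization at most \<open>2 * M\<close> zeros contribute at most
  \<open>4 * pi\<close> each, and the logarithm of the other factor moves by at most
  \<open>4 * M\<close> along the arc; \<open>8 * pi + 4 < 32\<close>.\<close>

lemma arg_variation_le:
  fixes g :: "complex \<Rightarrow> complex"
  assumes hol: "g holomorphic_on UNIV" and nz: "g z0 \<noteq> 0" and "0 < R" and "0 < M"
    and bound: "\<And>z. norm (z - z0) \<le> R \<Longrightarrow> norm (g z) \<le> exp M * norm (g z0)"
    and "0 < \<rho>" and circ: "\<And>z. norm z = \<rho> \<Longrightarrow> norm (z - z0) \<le> R / 3 \<Longrightarrow> g z \<noteq> 0"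
    and "\<alpha> \<le> \<beta>" "\<beta> \<le> \<alpha> + 2 * pi"
    and arc: "\<And>\<theta>. \<theta> \<in> {\<alpha>..\<beta>} \<Longrightarrow> norm (of_real \<rho> * cis \<theta> - z0) \<le> R / 6"
    and "continuous_on {\<alpha>..\<beta>} L" "\<And>\<theta>. \<theta> \<in> {\<alpha>..\<beta>} \<Longrightarrow> exp (L \<theta>) = g (of_real \<rho> * cis \<theta>)"
  shows "\<bar>Im (L \<beta> - L \<alpha>)\<bar> \<le> 32 * M"
proof -
  define Z where "Z = {z \<in> cball z0 (R / 3). g z = 0}"
  define N where "N = real (\<Sum>a\<in>Z. nat (zorder g a))"
  obtain h where h: "finite Z" "N \<le> 2 * M" "continuous_on (ball z0 (R / 3)) h"
    "\<And>z. z \<in> ball z0 (R / 3) \<Longrightarrow> g z = zero_poly g Z z * exp (h z)"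
    "\<And>z. norm (z - z0) \<le> R / 6 \<Longrightarrow> norm (h z - h z0) \<le> 2 * M"
    using landau_factorization[OF hol nz \<open>0 < R\<close> \<open>0 < M\<close> bound] unfolding Z_def N_def by blast
  have "norm a \<noteq> \<rho>" if "a \<in> Z" for a
    using that circ[of a] by (auto simp: Z_def dist_norm norm_minus_commute)
  then obtain \<Lambda> where \<Lambda>: "continuous_on UNIV \<Lambda>" "\<And>\<theta>. exp (\<Lambda> \<theta>) = zero_poly g Z (of_real \<rho> * cis \<theta>)"
    "\<bar>Im (\<Lambda> \<beta> - \<Lambda> \<alpha>)\<bar> \<le> 4 * pi * N"
    using zero_poly_log[OF h(1) \<open>0 < \<rho>\<close>, of g] assms(8,9) unfolding N_def by metis
  define w where "w = (\<lambda>\<theta>. of_real \<rho> * cis \<theta>)"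
  have wb: "w \<theta> \<in> ball z0 (R / 3)" if "\<theta> \<in> {\<alpha>..\<beta>}" for \<theta>
    using arc[OF that] \<open>0 < R\<close> by (simp add: w_def dist_norm norm_minus_commute)
  have "L \<beta> - L \<alpha> = (\<Lambda> \<beta> + h (w \<beta>)) - (\<Lambda> \<alpha> + h (w \<alpha>))"
  proof (rule continuous_log_unique)
    show "continuous_on {\<alpha>..\<beta>} (\<lambda>\<theta>. \<Lambda> \<theta> + h (w \<theta>))"
      unfolding w_def
      by (intro continuous_intros continuous_on_subset[OF \<Lambda>(1)] continuous_on_circle_compose[OF h(3)])
         (use wb in \<open>auto simp: w_def\<close>)
    show "exp (L \<theta>) = exp (\<Lambda> \<theta> + h (w \<theta>))" if "\<theta> \<in> {\<alpha>..\<beta>}" for \<theta>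
      using assms(12)[OF that] h(4)[OF wb[OF that]] \<Lambda>(2)[of \<theta>] by (simp add: exp_add w_def)
  qed (use assms in auto)
  then have "Im (L \<beta> - L \<alpha>) = Im (\<Lambda> \<beta> - \<Lambda> \<alpha>) + (Im (h (w \<beta>) - h z0) - Im (h (w \<alpha>) - h z0))"
    by simp
  moreover have "\<bar>Im (h (w \<theta>) - h z0)\<bar> \<le> 2 * M" if "\<theta> \<in> {\<alpha>..\<beta>}" for \<theta>
    using h(5)[of "w \<theta>"] arc[OF that] abs_Im_le_cmod[of "h (w \<theta>) - h z0"] unfolding w_def by linarith
  then have "\<bar>Im (h (w \<alpha>) - h z0)\<bar> \<le> 2 * M" "\<bar>Im (h (w \<beta>) - h z0)\<bar> \<le> 2 * M"
    using \<open>\<alpha> \<le> \<beta>\<close> by auto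
  moreover have "4 * pi * N \<le> (4 * 3.2) * (2 * M)"
    using h(2) \<open>0 < M\<close> pi_approx by (intro mult_mono) (auto simp: N_def simp del: of_nat_sum)
  ultimately show ?thesis using \<Lambda>(3) \<open>0 < M\<close> unfolding abs_le_iff by linarith
qed

text \<open>Minimum modulus estimate. From \<open>z0\<close> to \<open>z\<close>, each of at most
  \<open>2 * M\<close> zeros costs at most a factor \<open>d / R\<close>, since it lies within
  \<open>R\<close> of \<open>z0\<close> and at distance at least \<open>d\<close> from
  \<open>z\<close>; the zero-free factor costs at most \<open>exp (- 2 * M)\<close>.\<close>

lemma entire_lower_bound:
  fixes g :: "complex \<Rightarrow> complex"
  assumes hol: "g holomorphic_on UNIV" and nz: "g z0 \<noteq> 0" and "0 < R" and "0 < M"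
    and bound: "\<And>z. norm (z - z0) \<le> R \<Longrightarrow> norm (g z) \<le> exp M * norm (g z0)"
    and z: "norm (z - z0) \<le> R / 6" and "0 < d" "d \<le> R"
    and far: "\<And>a. norm (a - z0) \<le> R / 3 \<Longrightarrow> g a = 0 \<Longrightarrow> d \<le> norm (z - a)"
  shows "norm (g z0) * exp (- 2 * M * (1 + ln (R / d))) \<le> norm (g z)"
proof -
  define Z where "Z = {z \<in> cball z0 (R / 3). g z = 0}"
  define N where "N = (\<Sum>a\<in>Z. nat (zorder g a))"
  obtain h where h: "finite Z" "N \<le> 2 * M" "continuous_on (ball z0 (R / 3)) h"
    "\<And>z. z \<in> ball z0 (R / 3) \<Longrightarrow> g z = zero_poly g Z z * exp (h z)"
    "\<And>z. norm (z - z0) \<le> R / 6 \<Longrightarrow> norm (h z - h z0) \<le> 2 * M"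
    using landau_factorization[OF hol nz \<open>0 < R\<close> \<open>0 < M\<close> bound] unfolding Z_def N_def by blast
  have "(d / R) ^ N * norm (zero_poly g Z z0) = (\<Prod>a\<in>Z. (d / R * norm (z0 - a)) ^ nat (zorder g a))"
    by (simp add: N_def zero_poly_def power_mult_distrib prod.distrib power_sum prod_norm[symmetric] norm_power
        power_divide prod_dividef)
  also have "\<dots> \<le> (\<Prod>a\<in>Z. norm (z - a) ^ nat (zorder g a))"
  proof (intro prod_mono conjI power_mono)
    fix a assume a: "a \<in> Z"
    then have "norm (z0 - a) \<le> R" using \<open>0 < R\<close> by (auto simp: Z_def dist_norm)
    then have "d / R * norm (z0 - a) \<le> d / R * R" using \<open>0 < d\<close> \<open>0 < R\<close> by (intro mult_left_mono) auto
    also have "\<dots> \<le> norm (z - a)"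
      using a far[of a] \<open>0 < R\<close> by (auto simp: Z_def dist_norm norm_minus_commute)
    finally show "d / R * norm (z0 - a) \<le> norm (z - a)" .
  qed (use \<open>0 < d\<close> \<open>0 < R\<close> in auto)
  also have "\<dots> = norm (zero_poly g Z z)"
    by (simp add: zero_poly_def prod_norm[symmetric] norm_power)
  finally have 1: "(d / R) ^ N * norm (zero_poly g Z z0) \<le> norm (zero_poly g Z z)" .
  have lnR: "0 \<le> ln (R / d)" using \<open>0 < d\<close> \<open>d \<le> R\<close> by simp
  have "exp (- 2 * M * ln (R / d)) \<le> exp (- real N * ln (R / d))"
    using h(2) lnR by (simp add: mult_right_mono)
  also have "\<dots> = (d / R) ^ N"
  proof -
    have "ln (d / R) = - ln (R / d)" using \<open>0 < d\<close> \<open>0 < R\<close> by (simp add: ln_div)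
    then have "- real N * ln (R / d) = real N * ln (d / R)" by simp
    then show ?thesis using \<open>0 < d\<close> \<open>0 < R\<close> by (metis divide_pos_pos exp_ln exp_of_nat_mult)
  qed
  finally have 2: "exp (- 2 * M * ln (R / d)) \<le> (d / R) ^ N" .
  have "\<bar>Re (h z - h z0)\<bar> \<le> 2 * M"
    using h(5)[OF z] abs_Re_le_cmod[of "h z - h z0"] by linarith
  then have 3: "exp (Re (h z0) - 2 * M) \<le> exp (Re (h z))" by simp
  have "norm (g z0) * exp (- 2 * M * (1 + ln (R / d))) 
      = (exp (- 2 * M * ln (R / d)) * norm (zero_poly g Z z0)) * exp (Re (h z0) - 2 * M)"
  proof -
    have "exp (- 2 * M * (1 + ln (R / d))) = exp (- 2 * M * ln (R / d)) * exp (- 2 * M)"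
      by (simp only: mult_exp_exp) (simp add: algebra_simps)
    moreover have "exp (Re (h z0) - 2 * M) = exp (Re (h z0)) * exp (- 2 * M)"
      by (simp only: mult_exp_exp) simp
    moreover have "norm (g z0) = norm (zero_poly g Z z0) * exp (Re (h z0))"
      using h(4)[of z0] \<open>0 < R\<close> by (simp add: norm_mult)
    ultimately show ?thesis by (simp only: mult_ac)
  qed
  also have "\<dots> \<le> norm (zero_poly g Z z) * exp (Re (h z))"
    using 1 3 mult_right_mono[OF 2, of "norm (zero_poly g Z z0)"] by (intro mult_mono) auto
  also have "\<dots> = norm (g z)"
    using h(4)[of z] z \<open>0 < R\<close> by (simp add: norm_mult dist_norm norm_minus_commute)
  finally show ?thesis .
qed

text \<open>Argument principle for a continuous logarithm: after division by the zeros in a larger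
  disc the rest is \<open>exp h\<close> there, and \<open>h\<close> returns to its initial value
  along the circle.\<close>

lemma arg_variation_circle:
  fixes f :: "complex \<Rightarrow> complex"
  assumes hol: "f holomorphic_on UNIV" and nz: "f z0 \<noteq> 0" and "0 < \<rho>"
    and circ: "\<And>z. norm z = \<rho> \<Longrightarrow> f z \<noteq> 0"
    and L: "continuous_on {0..2 * pi} L" "\<And>\<theta>. \<theta> \<in> {0..2 * pi} \<Longrightarrow> exp (L \<theta>) = f (of_real \<rho> * cis \<theta>)"
  shows "Im (L (2 * pi) - L 0) = 2 * pi * zero_count f \<rho>"
proof -
  define Z where "Z = {z \<in> ball 0 (2 * \<rho>). f z = 0}"
  have finZ: "finite Z" unfolding Z_def by (rule entire_finite_zeros[OF hol nz]) simp
  have fZ: "f z = 0" if "z \<in> Z" for z using that by (auto simp: Z_def)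
  have ZB: "Z \<subseteq> ball 0 (2 * \<rho>)" by (auto simp: Z_def)
  obtain G where G: "G holomorphic_on ball 0 (2 * \<rho>)"
    "\<And>z. z \<in> ball 0 (2 * \<rho>) \<Longrightarrow> f z = zero_poly f Z z * G z"
    "\<And>z. z \<in> ball 0 (2 * \<rho>) \<Longrightarrow> G z = 0 \<longleftrightarrow> f z = 0 \<and> z \<notin> Z"
    using entire_factor_zeros[OF hol nz ZB fZ] by blast
  obtain h where h: "h holomorphic_on ball 0 (2 * \<rho>)"
    and Gh: "\<And>z. z \<in> ball 0 (2 * \<rho>) \<Longrightarrow> G z = exp (h z)"
  proof (rule contractible_imp_holomorphic_log[OF G(1)])
    show "G z \<noteq> 0" if "z \<in> ball 0 (2 * \<rho>)" for z
      using G(3)[OF that] that by (auto simp: Z_def)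
  qed (auto intro: convex_imp_contractible)
  have aZ: "norm a \<noteq> \<rho>" if "a \<in> Z" for a using that circ[of a] by (auto simp: Z_def)
  obtain \<Lambda> where \<Lambda>: "continuous_on UNIV \<Lambda>" "\<And>\<theta>. exp (\<Lambda> \<theta>) = zero_poly f Z (of_real \<rho> * cis \<theta>)"
    "Im (\<Lambda> (2 * pi) - \<Lambda> 0) = 2 * pi * real (\<Sum>a | a \<in> Z \<and> norm a < \<rho>. nat (zorder f a))"
  proof (rule zero_poly_log[OF finZ \<open>0 < \<rho>\<close> aZ, of f])
    fix \<Lambda> assume "continuous_on UNIV \<Lambda>" "\<And>\<theta>. exp (\<Lambda> \<theta>) = zero_poly f Z (of_real \<rho> * cis \<theta>)"
      "Im (\<Lambda> (2 * pi) - \<Lambda> 0) = 2 * pi * real (\<Sum>a | a \<in> Z \<and> norm a < \<rho>. nat (zorder f a))"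
    then show thesis by (rule that)
  qed
  define w where "w = (\<lambda>\<theta>. of_real \<rho> * cis \<theta>)"
  have wb: "w \<theta> \<in> ball 0 (2 * \<rho>)" for \<theta> using \<open>0 < \<rho>\<close> by (simp add: w_def norm_mult)
  have "L (2 * pi) - L 0 = (\<Lambda> (2 * pi) + h (w (2 * pi))) - (\<Lambda> 0 + h (w 0))"
  proof (rule continuous_log_unique)
    show "continuous_on {0..2 * pi} (\<lambda>\<theta>. \<Lambda> \<theta> + h (w \<theta>))"
      unfolding w_def
      by (intro continuous_intros continuous_on_subset[OF \<Lambda>(1)]
          continuous_on_circle_compose[OF holomorphic_on_imp_continuous_on[OF h]])
         (use wb in \<open>auto simp: w_def\<close>)
    show "exp (L \<theta>) = exp (\<Lambda> \<theta> + h (w \<theta>))" if "\<theta> \<in> {0..2 * pi}" for \<theta>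
      using L(2)[OF that] G(2)[OF wb[of \<theta>]] Gh[OF wb[of \<theta>]] \<Lambda>(2)[of \<theta>] by (simp add: exp_add w_def)
  qed (use L in auto)
  then have "Im (L (2 * pi) - L 0) = Im (\<Lambda> (2 * pi) - \<Lambda> 0)" by (simp add: w_def)
  moreover have "{a \<in> Z. norm a < \<rho>} = {z. norm z < \<rho> \<and> f z = 0}" using \<open>0 < \<rho>\<close> by (auto simp: Z_def)
  ultimately show ?thesis
    using \<Lambda>(3) entire_zorder(1)[OF hol nz] by (simp add: zero_count_def)
qed


section \<open>Exponential polynomials of bounded order\<close>

text \<open>The factor \<open>ln r\<close> makes room for polynomials, which grow like
  \<open>exp (C * ln r)\<close> already for \<open>s = 0\<close>. From \<open>r = 3\<close> on,
  \<open>ln r\<close> is at least 1.\<close>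

definition exp_growth :: "nat \<Rightarrow> (complex \<Rightarrow> complex) \<Rightarrow> bool" where
  "exp_growth s f \<longleftrightarrow> (\<exists>C\<ge>0. \<forall>r\<ge>3. \<forall>z. norm z \<le> r \<longrightarrow> norm (f z) \<le> exp (C * (r ^ s * ln r)))"

lemma one_le_ln: "(3::real) \<le> r \<Longrightarrow> 1 \<le> ln r"
  using exp_le by (subst ln_ge_iff) auto

lemma one_le_power_ln:
  assumes "(3::real) \<le> r"
  shows "1 \<le> r ^ s * ln r"
proof -
  have "1 * 1 \<le> r ^ s * ln r" using assms one_le_ln[OF assms] by (intro mult_mono one_le_power) auto
  then show ?thesis by simp
qed

lemma exp_growthI:
  assumes "0 \<le> C" "\<And>r z. 3 \<le> r \<Longrightarrow> norm z \<le> r \<Longrightarrow> norm (f z) \<le> exp (C * (r ^ s * ln r))"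
  shows "exp_growth s f"
  using assms unfolding exp_growth_def by blast

lemma exp_growth_const: "exp_growth s (\<lambda>_. c)"
proof (rule exp_growthI[of "norm c"])
  fix r :: real assume "3 \<le> r"
  then have "norm c * 1 \<le> norm c * (r ^ s * ln r)" by (intro mult_left_mono one_le_power_ln) auto
  then show "norm c \<le> exp (norm c * (r ^ s * ln r))"
    using exp_ge_add_one_self[of "norm c * (r ^ s * ln r)"] by linarith
qed simp

lemma exp_growth_id: "exp_growth s (\<lambda>z. z)"
proof (rule exp_growthI[of 1])
  fix r :: real and z :: complex assume r: "3 \<le> r" and z: "norm z \<le> r"
  have "1 * ln r \<le> r ^ s * ln r" using r one_le_ln[OF r] by (intro mult_right_mono one_le_power) auto
  then have "exp (ln r) \<le> exp (r ^ s * ln r)" by simp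
  then show "norm z \<le> exp (1 * (r ^ s * ln r))" using r z by simp
qed simp

lemma exp_growth_mult:
  assumes "exp_growth s f" "exp_growth s g"
  shows "exp_growth s (\<lambda>z. f z * g z)"
proof -
  obtain C D where C: "0 \<le> C" "\<And>r z. 3 \<le> r \<Longrightarrow> norm z \<le> r \<Longrightarrow> norm (f z) \<le> exp (C * (r ^ s * ln r))"
    and D: "0 \<le> D" "\<And>r z. 3 \<le> r \<Longrightarrow> norm z \<le> r \<Longrightarrow> norm (g z) \<le> exp (D * (r ^ s * ln r))"
    using assms unfolding exp_growth_def by blast
  show ?thesis
  proof (rule exp_growthI[of "C + D"])
    fix r :: real and z :: complex assume "3 \<le> r" "norm z \<le> r"
    then have "norm (f z) * norm (g z) \<le> exp (C * (r ^ s * ln r)) * exp (D * (r ^ s * ln r))"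
      using C(2) D(2) by (intro mult_mono) auto
    then show "norm (f z * g z) \<le> exp ((C + D) * (r ^ s * ln r))"
      by (simp add: norm_mult exp_add ring_distribs)
  qed (use C D in auto)
qed

lemma exp_growth_add:
  assumes "exp_growth s f" "exp_growth s g"
  shows "exp_growth s (\<lambda>z. f z + g z)"
proof -
  obtain C D where C: "0 \<le> C" "\<And>r z. 3 \<le> r \<Longrightarrow> norm z \<le> r \<Longrightarrow> norm (f z) \<le> exp (C * (r ^ s * ln r))"
    and D: "0 \<le> D" "\<And>r z. 3 \<le> r \<Longrightarrow> norm z \<le> r \<Longrightarrow> norm (g z) \<le> exp (D * (r ^ s * ln r))"
    using assms unfolding exp_growth_def by blast
  show ?thesis
  proof (rule exp_growthI[of "C + D + 1"])
    fix r :: real and z :: complex assume r: "3 \<le> r" "norm z \<le> r"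
    define u where "u = r ^ s * ln r"
    have u: "1 \<le> u" unfolding u_def using r by (intro one_le_power_ln) auto
    have "norm (f z + g z) \<le> norm (f z) + norm (g z)" by (rule norm_triangle_ineq)
    also have "\<dots> \<le> exp (C * u) + exp (D * u)"
      using C(2)[OF r] D(2)[OF r] by (simp add: u_def)
    also have "\<dots> \<le> exp ((C + D) * u) + exp ((C + D) * u)"
      using C(1) D(1) u by (intro add_mono) (auto simp: ring_distribs)
    also have "\<dots> = 2 * exp ((C + D) * u)" by simp
    \<comment> \<open>The factor 2 from adding two terms is paid for by the extra 1 in the
      constant.\<close>
    also have "\<dots> \<le> exp u * exp ((C + D) * u)"
      using u exp_ge_add_one_self[of u] by (intro mult_right_mono exp_ge_zero) linarith
    also have "\<dots> = exp ((C + D + 1) * u)" by (simp add: exp_add[symmetric] algebra_simps)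
    finally show "norm (f z + g z) \<le> exp ((C + D + 1) * (r ^ s * ln r))" by (simp add: u_def)
  qed (use C D in auto)
qed

lemma exp_growth_sum:
  assumes "finite A" "\<And>j. j \<in> A \<Longrightarrow> exp_growth s (f j)"
  shows "exp_growth s (\<lambda>z. \<Sum>j\<in>A. f j z)"
  using assms by (induction A rule: finite_induct) (simp_all add: exp_growth_const exp_growth_add)

lemma exp_growth_poly: "exp_growth s (poly P)"
proof (induction P)
  case (pCons a P)
  have "exp_growth s (\<lambda>z. a + z * poly P z)"
    by (intro exp_growth_add exp_growth_mult exp_growth_const exp_growth_id pCons.IH)
  then show ?case by (simp add: poly_pCons[abs_def])
qed (simp add: exp_growth_const)

lemma norm_poly_le_power:
  fixes Q :: "complex poly"
  assumes "degree Q \<le> s" "norm z \<le> r" "1 \<le> r"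
  shows "norm (poly Q z) \<le> (\<Sum>i\<le>degree Q. norm (coeff Q i)) * r ^ s"
proof -
  have "norm (poly Q z) \<le> (\<Sum>i\<le>degree Q. norm (coeff Q i) * norm z ^ i)"
    unfolding poly_altdef by (rule order_trans[OF norm_sum]) (simp add: norm_mult norm_power)
  also have "\<dots> \<le> (\<Sum>i\<le>degree Q. norm (coeff Q i) * r ^ s)"
  proof (intro sum_mono mult_left_mono)
    fix i assume "i \<in> {..degree Q}"
    then have "i \<le> s" using assms by simp
    have "norm z ^ i \<le> r ^ i" using assms by (intro power_mono) auto
    also have "\<dots> \<le> r ^ s" using assms \<open>i \<le> s\<close> by (intro power_increasing) auto
    finally show "norm z ^ i \<le> r ^ s" .
  qed auto
  finally show ?thesis by (simp add: sum_distrib_right)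
qed

lemma exp_growth_exp_poly:
  assumes "degree Q \<le> s"
  shows "exp_growth s (\<lambda>z. exp (poly Q z))"
proof (rule exp_growthI[of "\<Sum>i\<le>degree Q. norm (coeff Q i)"])
  fix r :: real and z :: complex assume r: "3 \<le> r" and z: "norm z \<le> r"
  let ?C = "\<Sum>i\<le>degree Q. norm (coeff Q i)"
  have "norm (exp (poly Q z)) \<le> exp (norm (poly Q z))" by (rule norm_exp)
  also have "\<dots> \<le> exp (?C * r ^ s)" using norm_poly_le_power[OF assms z] r by simp
  also have "?C * r ^ s * 1 \<le> ?C * r ^ s * ln r"
    using r one_le_ln[OF r] by (intro mult_left_mono mult_nonneg_nonneg sum_nonneg) auto
  then have "exp (?C * r ^ s) \<le> exp (?C * (r ^ s * ln r))" by (simp add: mult.assoc)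
  finally show "norm (exp (poly Q z)) \<le> exp (?C * (r ^ s * ln r))" .
qed (auto intro: sum_nonneg)

text \<open>What the rest of the proof uses of a coefficient \<open>H j\<close>, besides its being
  nonzero.\<close>

lemma exp_poly_of_order_imp:
  assumes "exp_poly_of_order f k" "k \<le> s"
  shows "f holomorphic_on UNIV" "exp_growth s f"
proof -
  obtain n :: nat and P Q where f: "f = (\<lambda>z. \<Sum>j<n. poly (P j) z * exp (poly (Q j) z))"
    and k: "k = Max (insert 0 ((\<lambda>j. degree (Q j)) ` {..<n}))"
    using assms unfolding exp_poly_of_order_def by blast
  have "degree (Q j) \<le> s" if "j < n" for j
    using that assms(2) k by (auto simp: Max_ge_iff intro: order_trans[OF Max_ge])
  then show "exp_growth s f"
    unfolding f by (intro exp_growth_sum exp_growth_mult exp_growth_poly exp_growth_exp_poly) auto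
  show "f holomorphic_on UNIV" unfolding f by (intro holomorphic_intros)
qed

lemma ln_le_times_ln:
  fixes r :: real
  assumes "c \<le> r" "0 < c" "0 < r"
  shows "ln (c * r) \<le> 2 * ln r"
  using assms ln_le_cancel_iff[of c r] by (simp add: ln_mult)

text \<open>
  The set \<open>X\<close> plays the role of the zeros of \<open>H\<close> in a disc of radius comparable to \<open>r\<close>, and \<open>d\<close> is the
  distance that a circle keeps from their moduli.
\<close>
definition circle_control :: "nat \<Rightarrow> (complex \<Rightarrow> complex) \<Rightarrow> real \<Rightarrow> real \<Rightarrow> complex set \<Rightarrow> bool" where
  "circle_control s H K r X \<longleftrightarrow> finite X \<and> real (card X) \<le> K * (r ^ s * ln r) \<and>
    (\<forall>\<rho> d. 0 < \<rho> \<longrightarrow> \<rho> \<le> 2 * r \<longrightarrow> 0 < d \<longrightarrow> d \<le> 1 \<longrightarrow> (\<forall>a\<in>X. d \<le> \<bar>\<rho> - norm a\<bar>) \<longrightarrow>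
      (\<forall>z. norm z = \<rho> \<longrightarrow> exp (- K * (r ^ s * ln r) * (ln r + ln (1 / d))) \<le> norm (H z)) \<and>
      (\<forall>\<alpha> \<beta> L. \<alpha> \<le> \<beta> \<longrightarrow> \<beta> \<le> \<alpha> + 2 * pi \<longrightarrow> continuous_on {\<alpha>..\<beta>} L \<longrightarrow>
        (\<forall>\<theta>\<in>{\<alpha>..\<beta>}. exp (L \<theta>) = H (of_real \<rho> * cis \<theta>)) \<longrightarrow> \<bar>Im (L \<beta> - L \<alpha>)\<bar> \<le> K * (r ^ s * ln r)))"

lemma circle_controlD:
  assumes "circle_control s H K r X"
  shows "finite X" "real (card X) \<le> K * (r ^ s * ln r)"
    and "\<lbrakk>0 < \<rho>; \<rho> \<le> 2 * r; 0 < d; d \<le> 1; \<forall>a\<in>X. d \<le> \<bar>\<rho> - norm a\<bar>; norm z = \<rho>\<rbrakk>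
      \<Longrightarrow> exp (- K * (r ^ s * ln r) * (ln r + ln (1 / d))) \<le> norm (H z)"
    and "\<lbrakk>0 < \<rho>; \<rho> \<le> 2 * r; 0 < d; d \<le> 1; \<forall>a\<in>X. d \<le> \<bar>\<rho> - norm a\<bar>; \<alpha> \<le> \<beta>; \<beta> \<le> \<alpha> + 2 * pi;
        continuous_on {\<alpha>..\<beta>} L; \<And>\<theta>. \<theta> \<in> {\<alpha>..\<beta>} \<Longrightarrow> exp (L \<theta>) = H (of_real \<rho> * cis \<theta>)\<rbrakk>
      \<Longrightarrow> \<bar>Im (L \<beta> - L \<alpha>)\<bar> \<le> K * (r ^ s * ln r)"
proof -
  note control = assms[unfolded circle_control_def]
  show "finite X" "real (card X) \<le> K * (r ^ s * ln r)" using control by simp_all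
  note bounds = control[THEN conjunct2, THEN conjunct2, rule_format]
  show "\<lbrakk>0 < \<rho>; \<rho> \<le> 2 * r; 0 < d; d \<le> 1; \<forall>a\<in>X. d \<le> \<bar>\<rho> - norm a\<bar>; norm z = \<rho>\<rbrakk>
      \<Longrightarrow> exp (- K * (r ^ s * ln r) * (ln r + ln (1 / d))) \<le> norm (H z)"
    by (rule bounds[THEN conjunct1, rule_format]) auto
  show "\<lbrakk>0 < \<rho>; \<rho> \<le> 2 * r; 0 < d; d \<le> 1; \<forall>a\<in>X. d \<le> \<bar>\<rho> - norm a\<bar>; \<alpha> \<le> \<beta>; \<beta> \<le> \<alpha> + 2 * pi;
        continuous_on {\<alpha>..\<beta>} L; \<And>\<theta>. \<theta> \<in> {\<alpha>..\<beta>} \<Longrightarrow> exp (L \<theta>) = H (of_real \<rho> * cis \<theta>)\<rbrakk>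
      \<Longrightarrow> \<bar>Im (L \<beta> - L \<alpha>)\<bar> \<le> K * (r ^ s * ln r)"
    by (rule bounds[THEN conjunct2, rule_format, of \<rho> d]) auto
qed

text \<open>Everything is compared with a fixed point \<open>z0\<close> at which \<open>H\<close>
  does not vanish. A disc around it of radius comparable to \<open>r\<close> contains the circles in
  question well inside, so the minimum modulus estimate and the bound for the argument both apply
  with \<open>M\<close> of size \<open>r ^ s * ln r\<close>.\<close>

lemma exp_growth_circle_control:
  assumes hol: "H holomorphic_on UNIV" and nz: "H z0 \<noteq> 0" and gr: "exp_growth s H"
  obtains K r0 where "0 < K" "\<And>r. r0 \<le> r \<Longrightarrow> \<exists>X. circle_control s H K r X"
proof -
  obtain C where C: "0 \<le> C" "\<And>r z. 3 \<le> r \<Longrightarrow> norm z \<le> r \<Longrightarrow> norm (H z) \<le> exp (C * (r ^ s * ln r))"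
    using gr unfolding exp_growth_def by blast
  \<comment> \<open>The growth is evaluated at \<open>19 * r\<close>, with
    \<open>ln (19 * r) \<le> 2 * ln r\<close>; the term with \<open>H z0\<close> allows for division
    by \<open>norm (H z0)\<close>.\<close>
  define C1 where "C1 = C * 19 ^ s * 2 + \<bar>ln (norm (H z0))\<bar> + 1"
  have C1: "1 \<le> C1" using C(1) by (simp add: C1_def)
  show ?thesis
  proof (rule that[of "32 * C1" "max 19 (norm z0)"])
    fix r assume "max 19 (norm z0) \<le> r"
    then have r: "19 \<le> r" "norm z0 \<le> r" by auto
    define u where "u = r ^ s * ln r"
    have u: "1 \<le> u" unfolding u_def using r by (intro one_le_power_ln) auto
    have lnr: "1 \<le> ln r" using r by (intro one_le_ln) auto
    define M where "M = C1 * u"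
    have M: "0 < M" using C1 u by (simp add: M_def)
    \<comment> \<open>A sixth of \<open>R\<close> is \<open>2 * r + norm z0\<close>, so all points
      with \<open>norm z \<le> 2 * r\<close> lie where the estimates hold.\<close>
    define R where "R = 6 * (2 * r + norm z0)"
    have R: "0 < R" "1 \<le> R" "R + norm z0 \<le> 19 * r" "R \<le> 18 * r"
      using r norm_ge_zero[of z0] by (simp_all add: R_def del: norm_ge_zero)
    have lnH: "- ln (norm (H z0)) \<le> \<bar>ln (norm (H z0))\<bar> * u"
      using mult_left_mono[OF u, of "\<bar>ln (norm (H z0))\<bar>"] by (simp add: abs_le_iff)
    have Hz0: "exp (- (\<bar>ln (norm (H z0))\<bar> * u)) \<le> norm (H z0)"
      using lnH nz by (simp add: ln_ge_iff[symmetric])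
    have bound: "norm (H z) \<le> exp M * norm (H z0)" if "norm (z - z0) \<le> R" for z
    proof -
      have "norm z \<le> norm (z - z0) + norm z0" using norm_triangle_ineq[of "z - z0" z0] by simp
      then have "norm z \<le> 19 * r" using that R(3) by simp
      then have "norm (H z) \<le> exp (C * ((19 * r) ^ s * ln (19 * r)))" using r by (intro C(2)) auto
      also have "(19 * r) ^ s * ln (19 * r) \<le> (19 * r) ^ s * (2 * ln r)"
        using r by (intro mult_left_mono ln_le_times_ln) auto
      then have "exp (C * ((19 * r) ^ s * ln (19 * r))) \<le> exp (C * ((19 * r) ^ s * (2 * ln r)))"
        using C(1) by (simp add: mult_left_mono)
      also have "C * ((19 * r) ^ s * (2 * ln r)) = C * 19 ^ s * 2 * u"
        by (simp add: u_def power_mult_distrib)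
      also have "C * 19 ^ s * 2 * u \<le> M + - (\<bar>ln (norm (H z0))\<bar> * u)"
        using u by (simp add: M_def C1_def ring_distribs)
      then have "exp (C * 19 ^ s * 2 * u) \<le> exp M * exp (- (\<bar>ln (norm (H z0))\<bar> * u))"
        by (simp only: mult_exp_exp exp_le_cancel_iff)
      also have "\<dots> \<le> exp M * norm (H z0)" using Hz0 by (intro mult_left_mono) auto
      finally show ?thesis .
    qed
    define X where "X = {z \<in> cball z0 (R / 3). H z = 0}"
    define N where "N = (\<Sum>a\<in>X. nat (zorder H a))"
    have finX: "finite X" unfolding X_def by (rule entire_finite_zeros[OF hol nz]) simp
    have N: "real N \<le> 2 * M"
      using landau_factorization[OF hol nz R(1) M bound] unfolding X_def N_def by metis
    have "card X = (\<Sum>a\<in>X. 1)" by simp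
    also have "\<dots> \<le> N" unfolding N_def
      by (intro sum_mono) (use entire_zorder(2)[OF hol nz] in \<open>force simp: X_def\<close>)
    finally have "real (card X) \<le> 2 * M" using N by simp
    then have cardX: "real (card X) \<le> 32 * C1 * u" using M by (simp add: M_def)
    have near: "norm (z - z0) \<le> R / 6" if "norm z \<le> 2 * r" for z
      using that norm_triangle_ineq4[of z z0] by (simp add: R_def)
    have lower: "exp (- (32 * C1) * u * (ln r + ln (1 / d))) \<le> norm (H z)"
      if "norm z \<le> 2 * r" "0 < d" "d \<le> 1" and far: "\<And>a. a \<in> X \<Longrightarrow> d \<le> \<bar>norm z - norm a\<bar>" for z d
    proof -
      have "norm (H z0) * exp (- 2 * M * (1 + ln (R / d))) \<le> norm (H z)"
      proof (rule entire_lower_bound[OF hol nz R(1) M bound near])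
        show "d \<le> norm (z - a)" if "norm (a - z0) \<le> R / 3" "H a = 0" for a
          using far[of a] norm_triangle_ineq3[of z a] that
          by (simp add: X_def dist_norm norm_minus_commute)
      qed (use that R in auto)
      moreover have "exp (- M) \<le> norm (H z0)"
      proof -
        have "\<bar>ln (norm (H z0))\<bar> * u \<le> M"
          unfolding M_def using C(1) u by (intro mult_right_mono) (auto simp: C1_def)
        then show ?thesis using Hz0 by (meson exp_le_cancel_iff neg_le_iff_le order_trans)
      qed
      then have "exp (- M) * exp (- 2 * M * (1 + ln (R / d))) \<le> norm (H z0) * exp (- 2 * M * (1 + ln (R / d)))"
        by (rule mult_right_mono) simp
      moreover have "- (32 * C1) * u * (ln r + ln (1 / d)) \<le> - M + - 2 * M * (1 + ln (R / d))"
      proof -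
        have lnd: "ln d \<le> 0" using that by simp
        have lnq: "ln (R / d) = ln R - ln d" "ln (1 / d) = - ln d" using that R(1) by (simp_all add: ln_div)
        have "ln R \<le> ln (18 * r)" using R r by (subst ln_le_cancel_iff) auto
        also have "\<dots> \<le> 2 * ln r" using r by (intro ln_le_times_ln) auto
        finally have "1 + 2 * (1 + ln (R / d)) \<le> 32 * (ln r + ln (1 / d))"
          unfolding lnq using lnr lnd by (simp add: algebra_simps)
        then have "M * (1 + 2 * (1 + ln (R / d))) \<le> M * (32 * (ln r + ln (1 / d)))"
          using M by (intro mult_left_mono) auto
        then show ?thesis by (simp add: M_def algebra_simps)
      qed
      ultimately show ?thesis
        by (smt (verit) exp_le_cancel_iff mult_exp_exp)
    qed
    have arg: "\<bar>Im (L \<beta> - L \<alpha>)\<bar> \<le> 32 * C1 * u"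
      if "0 < \<rho>" "\<rho> \<le> 2 * r" "0 < d" "\<forall>a\<in>X. d \<le> \<bar>\<rho> - norm a\<bar>" "\<alpha> \<le> \<beta>" "\<beta> \<le> \<alpha> + 2 * pi" 
        "continuous_on {\<alpha>..\<beta>} L" "\<forall>\<theta>\<in>{\<alpha>..\<beta>}. exp (L \<theta>) = H (of_real \<rho> * cis \<theta>)"
      for \<rho> d \<alpha> \<beta> L
    proof -
      have "\<bar>Im (L \<beta> - L \<alpha>)\<bar> \<le> 32 * M"
      proof (rule arg_variation_le[OF hol nz R(1) M bound \<open>0 < \<rho>\<close>])
        show "H z \<noteq> 0" if z: "norm z = \<rho>" "norm (z - z0) \<le> R / 3" for z
        proof
          assume "H z = 0"
          then have "z \<in> X" using z by (simp add: X_def dist_norm norm_minus_commute)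
          then show False using \<open>\<forall>a\<in>X. d \<le> \<bar>\<rho> - norm a\<bar>\<close> \<open>0 < d\<close> z by force
        qed
        show "norm (of_real \<rho> * cis \<theta> - z0) \<le> R / 6" for \<theta>
          using that by (intro near) (simp add: norm_mult)
      qed (use that in auto)
      then show ?thesis by (simp add: M_def)
    qed
    show "\<exists>X. circle_control s H (32 * C1) r X"
      unfolding circle_control_def u_def[symmetric]
    proof (intro exI[of _ X] conjI allI impI)
      show "finite X" by (rule finX)
      show "real (card X) \<le> 32 * C1 * u" by (rule cardX)
    next
      fix \<rho> d :: real and z :: complex assume a: "0 < \<rho>" "\<rho> \<le> 2 * r" "0 < d" "d \<le> 1" "\<forall>a\<in>X. d \<le> \<bar>\<rho> - norm a\<bar>" "norm z = \<rho>"
      show "exp (- (32 * C1) * u * (ln r + ln (1 / d))) \<le> norm (H z)"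
        by (rule lower) (use a in auto)
    next
      fix \<rho> d \<alpha> \<beta> :: real and L :: "real \<Rightarrow> complex"
      assume a: "0 < \<rho>" "\<rho> \<le> 2 * r" "0 < d" "d \<le> 1" "\<forall>a\<in>X. d \<le> \<bar>\<rho> - norm a\<bar>"
        "\<alpha> \<le> \<beta>" "\<beta> \<le> \<alpha> + 2 * pi" "continuous_on {\<alpha>..\<beta>} L"
        "\<forall>\<theta>\<in>{\<alpha>..\<beta>}. exp (L \<theta>) = H (of_real \<rho> * cis \<theta>)"
      show "\<bar>Im (L \<beta> - L \<alpha>)\<bar> \<le> 32 * C1 * u"
        by (rule arg[OF a(1-3,5-9)])
    qed
  qed (use C1 in auto)
qed


section \<open>Angles at which two exponents balance\<close>

text \<open>Mean value theorem: the derivative is at least \<open>cos (pi / 3) = 1 / 2\<close>, as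
  \<open>1 < pi / 3\<close>.\<close>

lemma half_le_sin:
  assumes "0 \<le> x" "x \<le> (1::real)"
  shows "x / 2 \<le> sin x"
proof (cases "x = 0")
  case False
  then have "0 < x" using assms by simp
  obtain t where t: "0 < t" "t < x" "sin x - sin 0 = (x - 0) * cos t"
    using MVT2[of 0 x sin cos] \<open>0 < x\<close> DERIV_sin by blast
  have "cos (pi / 3) \<le> cos t"
    using t assms pi_gt3 by (intro cos_monotone_0_pi_le) auto
  then have "x * (1 / 2) \<le> x * cos t" using \<open>0 < x\<close> by (intro mult_left_mono) (auto simp: cos_60)
  then show ?thesis using t by simp
qed simp

lemma norm_cis_diff_le: "norm (cis a - cis b) \<le> \<bar>a - b\<bar>"
proof -
  have "(norm (cis a - cis b))\<^sup>2 = (2 * sin ((a - b) / 2))\<^sup>2"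
  proof -
    have "(norm (cis a - cis b))\<^sup>2 = ((cos a)\<^sup>2 + (sin a)\<^sup>2) + ((cos b)\<^sup>2 + (sin b)\<^sup>2) - 2 * cos (a - b)"
      unfolding cmod_power2 cos_diff by (simp add: power2_eq_square algebra_simps)
    then show ?thesis
      using cos_double_sin[of "(a - b) / 2"] by (simp add: power2_eq_square diff_divide_distrib)
  qed
  then have "norm (cis a - cis b) = \<bar>2 * sin ((a - b) / 2)\<bar>"
    by (metis abs_norm_cancel real_sqrt_abs)
  also have "\<dots> \<le> \<bar>a - b\<bar>" using abs_sin_x_le_abs_x[of "(a - b) / 2"] by (simp add: abs_mult)
  finally show ?thesis .
qed

lemma norm_power_diff_le:
  fixes z w :: complex
  assumes "norm z \<le> P" "norm w \<le> P" "0 < P"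
  shows "norm (z ^ n - w ^ n) \<le> real n * P ^ n * (norm (z - w) / P)"
proof -
  have "norm ((z / of_real P) ^ n - (w / of_real P) ^ n) \<le> real n * norm (z / of_real P - w / of_real P)"
    using assms by (intro norm_power_diff) (auto simp: norm_divide)
  then have "norm (z ^ n - w ^ n) / P ^ n \<le> real n * (norm (z - w) / P)"
    using assms by (simp add: power_divide norm_divide norm_power flip: diff_divide_distrib)
  then show ?thesis using assms by (simp add: field_simps)
qed

lemma inj_on_cis: "inj_on cis {0..<2 * pi}"
proof (rule inj_onI)
  fix x y assume x: "x \<in> {0..<2 * pi}" and y: "y \<in> {0..<2 * pi}" and "cis x = cis y"
  then have "sin x = sin y \<and> cos x = cos y" by (simp add: complex_eq_iff)
  then obtain n :: int where n: "x = y + 2 * pi * n" unfolding sin_cos_eq_iff by blast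
  have "\<bar>of_int n * (2 * pi)\<bar> < 1 * (2 * pi)" using x y n by (auto simp: algebra_simps)
  then have "\<bar>real_of_int n\<bar> < 1" unfolding abs_mult by simp
  then have "n = 0" by linarith
  then show "x = y" using n by simp
qed

text \<open>The bound does not depend on \<kappa>: each of the levels \<kappa> and
  \<open>- \<kappa>\<close> is attained at most \<open>2 * q\<close> times. It limits the number of
  arcs into which a circle is cut.\<close>

lemma card_Re_cis_level:
  fixes c :: complex
  assumes "c \<noteq> 0" "1 \<le> q"
  shows "finite {\<theta>\<in>{0..<2 * pi}. \<bar>Re (c * cis (real q * \<theta>))\<bar> = \<kappa>}"
    and "card {\<theta>\<in>{0..<2 * pi}. \<bar>Re (c * cis (real q * \<theta>))\<bar> = \<kappa>} \<le> 4 * q"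
proof -
  \<comment> \<open>with \<open>x = cis \<theta>\<close>, the equation \<open>Re (c x\<^sup>q) = t\<close> reads \<open>c x\<^sup>q + cnj c / x\<^sup>q = 2 t\<close>\<close>
  define p where "p = (\<lambda>t::real. monom c (2 * q) + monom (of_real (- 2 * t)) q + [:cnj c:])"
  have coeff: "coeff (p t) (2 * q) = c" for t
    using assms by (simp add: p_def coeff_pCons split: nat.splits)
  have nz: "p t \<noteq> 0" for t using coeff[of t] assms(1) by (metis coeff_0)
  have deg: "degree (p t) \<le> 2 * q" for t
    unfolding p_def by (intro degree_add_le order_trans[OF degree_monom_le]) auto
  have root: "poly (p t) (cis \<theta>) = 0" if "Re (c * cis (real q * \<theta>)) = t" for t \<theta>
  proof -
    have "cis \<theta> ^ (2 * q) = cis (real q * \<theta>) * cis (real q * \<theta>)"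
      by (simp only: mult_2 power_add Complex.DeMoivre)
    moreover have "cis (real q * \<theta>) * cnj (cis (real q * \<theta>)) = 1"
      by (simp add: cis_cnj cis_mult)
    ultimately have "poly (p t) (cis \<theta>) = c * (cis (real q * \<theta>) * cis (real q * \<theta>)) -
        of_real (2 * t) * cis (real q * \<theta>) + cnj c * (cis (real q * \<theta>) * cnj (cis (real q * \<theta>)))"
      by (simp add: p_def poly_monom Complex.DeMoivre)
    also have "\<dots> =
        cis (real q * \<theta>) * (c * cis (real q * \<theta>) + cnj (c * cis (real q * \<theta>)) - of_real (2 * t))"
      by (simp add: algebra_simps)
    also have "\<dots> = 0" by (simp only: complex_add_cnj that) simp
    finally show ?thesis .
  qed
  let ?S = "{\<theta>\<in>{0..<2 * pi}. \<bar>Re (c * cis (real q * \<theta>))\<bar> = \<kappa>}"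
  let ?R = "{x. poly (p \<kappa>) x = 0} \<union> {x. poly (p (- \<kappa>)) x = 0}"
  have sub: "cis ` ?S \<subseteq> ?R"
  proof
    fix x assume "x \<in> cis ` ?S"
    then obtain \<theta> where x: "x = cis \<theta>" and "\<bar>Re (c * cis (real q * \<theta>))\<bar> = \<kappa>" by blast
    then have "Re (c * cis (real q * \<theta>)) = \<kappa> \<or> Re (c * cis (real q * \<theta>)) = - \<kappa>" by linarith
    then show "x \<in> ?R" using root[of \<theta>] x by blast
  qed
  have inj: "inj_on cis ?S" by (rule inj_on_subset[OF inj_on_cis]) auto
  have finR: "finite ?R" using nz poly_roots_finite by blast
  show "finite ?S" using finite_imageD[OF finite_subset[OF sub finR] inj] .
  have "card ?S = card (cis ` ?S)" using inj by (simp add: card_image)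
  also have "\<dots> \<le> card ?R" by (rule card_mono[OF finR sub])
  also have "\<dots> \<le> card {x. poly (p \<kappa>) x = 0} + card {x. poly (p (- \<kappa>)) x = 0}" by (rule card_Un_le)
  also have "\<dots> \<le> 2 * q + 2 * q"
    by (intro add_mono order_trans[OF card_poly_roots_bound deg] nz)
  finally show "card ?S \<le> 4 * q" by simp
qed

text \<open>Two rotations of \<open>c\<close> near the imaginary axis are nearly parallel: the
  product of one with the conjugate of the other has imaginary part
  \<open>(norm c)\<^sup>2 * sin (real q * (y - x))\<close>, which is at most
  \<open>2 * \<kappa> * norm c\<close>. The restriction \<open>real q * (y - x) \<le> 1\<close>
  keeps the angle away from \<open>pi\<close>, where the sine vanishes again.\<close>

lemma Re_cis_small_imp_close:
  fixes c :: complex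
  assumes "gap \<le> norm c" "0 < gap" "x \<le> y" "real q * (y - x) \<le> 1" "1 \<le> q"
    and "\<bar>Re (c * cis (real q * x))\<bar> \<le> \<kappa>" "\<bar>Re (c * cis (real q * y))\<bar> \<le> \<kappa>"
  shows "y - x \<le> 4 * \<kappa> / gap"
proof -
  let ?u = "c * cis (real q * y)" and ?v = "c * cis (real q * x)"
  have "?u * cnj ?v = of_real ((norm c)\<^sup>2) * cis (real q * (y - x))"
  proof -
    have "?u * cnj ?v = (c * cnj c) * (cis (real q * y) * cnj (cis (real q * x)))" by simp
    also have "cis (real q * y) * cnj (cis (real q * x)) = cis (real q * (y - x))"
      by (simp add: cis_cnj cis_mult right_diff_distrib)
    finally show ?thesis by (simp only: complex_norm_square)
  qed
  then have "(norm c)\<^sup>2 * sin (real q * (y - x)) = Im (?u * cnj ?v)" by simp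
  also have "\<dots> = Im ?u * Re ?v - Re ?u * Im ?v" by (simp add: algebra_simps)
  also have "\<dots> \<le> \<bar>Im ?u\<bar> * \<bar>Re ?v\<bar> + \<bar>Re ?u\<bar> * \<bar>Im ?v\<bar>"
    using abs_ge_self[of "Im ?u * Re ?v"] abs_ge_minus_self[of "Re ?u * Im ?v"] unfolding abs_mult by linarith
  also have "\<dots> \<le> norm c * \<kappa> + \<kappa> * norm c"
    using assms(6,7) abs_Im_le_cmod[of ?u] abs_Im_le_cmod[of ?v]
    by (intro add_mono mult_mono) (auto simp: norm_mult)
  finally have "norm c * (norm c * sin (real q * (y - x))) \<le> norm c * (2 * \<kappa>)"
    by (simp add: power2_eq_square mult_ac)
  then have 1: "norm c * sin (real q * (y - x)) \<le> 2 * \<kappa>"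
    using assms(1,2) by (subst (asm) mult_le_cancel_left_pos) auto
  have "gap * ((y - x) / 2) \<le> norm c * (real q * (y - x) / 2)"
    using assms mult_right_mono[of 1 "real q" "y - x"] by (intro mult_mono) auto
  also have "\<dots> \<le> norm c * sin (real q * (y - x))"
    using assms by (intro mult_left_mono half_le_sin) auto
  finally show ?thesis using 1 assms(2) by (simp add: field_simps)
qed

text \<open>Cutting at the points of \<open>T\<close> leaves at most \<open>card T + 1\<close>
  pieces. The induction cuts at any point of \<open>T\<close> inside the interval, after which
  either side contains fewer of them.\<close>

lemma additive_interval_bound:
  fixes \<Phi> :: "real \<Rightarrow> real \<Rightarrow> real"
  assumes "finite T" "a \<le> b"
    and add: "\<And>x y z. a \<le> x \<Longrightarrow> x \<le> y \<Longrightarrow> y \<le> z \<Longrightarrow> z \<le> b \<Longrightarrow> \<Phi> x z = \<Phi> x y + \<Phi> y z"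
    and bound: "\<And>x y. a \<le> x \<Longrightarrow> x \<le> y \<Longrightarrow> y \<le> b \<Longrightarrow> {x<..<y} \<inter> T = {} \<Longrightarrow> \<bar>\<Phi> x y\<bar> \<le> E"
  shows "\<bar>\<Phi> a b\<bar> \<le> real (card T + 1) * E"
proof -
  have E: "0 \<le> E" using bound[of a a] \<open>a \<le> b\<close> by simp
  have "\<bar>\<Phi> x y\<bar> \<le> real (card (T \<inter> {x<..<y}) + 1) * E" if "a \<le> x" "x \<le> y" "y \<le> b" for x y
    using that
  proof (induction "card (T \<inter> {x<..<y})" arbitrary: x y rule: less_induct)
    case less
    show ?case
    proof (cases "T \<inter> {x<..<y} = {}")
      case True
      then show ?thesis using bound[of x y] less.prems by (simp add: Int_commute)
    next
      case False
      then obtain t where t: "t \<in> T" "x < t" "t < y" by auto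
      let ?L = "T \<inter> {x<..<t}" and ?R = "T \<inter> {t<..<y}"
      have eq: "T \<inter> {x<..<y} = insert t (?L \<union> ?R)" using t by auto
      have "card (?L \<union> ?R) = card ?L + card ?R"
        using assms(1) by (intro card_Un_disjoint) auto
      then have card: "card (T \<inter> {x<..<y}) = card ?L + card ?R + 1"
        unfolding eq using assms(1) by (subst card_insert_disjoint) auto
      have "\<bar>\<Phi> x y\<bar> \<le> \<bar>\<Phi> x t\<bar> + \<bar>\<Phi> t y\<bar>" using add[of x t y] less.prems t by simp
      also have "\<dots> \<le> real (card ?L + 1) * E + real (card ?R + 1) * E"
        using less.hyps[of x t] less.hyps[of t y] less.prems t card by (intro add_mono) auto
      also have "\<dots> = real (card (T \<inter> {x<..<y}) + 1) * E" unfolding card by (simp add: algebra_simps)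
      finally show ?thesis .
    qed
  qed
  from this[of a b] have "\<bar>\<Phi> a b\<bar> \<le> real (card (T \<inter> {a<..<b}) + 1) * E" using \<open>a \<le> b\<close> by simp
  also have "\<dots> \<le> real (card T + 1) * E"
    using E assms(1) by (intro mult_right_mono) (auto intro: card_mono)
  finally show ?thesis .
qed


section \<open>Counting zeros on a circle\<close>

lemma connected_less_const:
  fixes g :: "real \<Rightarrow> real"
  assumes "connected S" "continuous_on S g" "\<And>x. x \<in> S \<Longrightarrow> g x \<noteq> c" "u \<in> S" "v \<in> S" "g u < c"
  shows "g v < c"
proof (rule ccontr)
  assume "\<not> g v < c"
  moreover have "connected (g ` S)" using assms(1,2) by (rule connected_continuous_image[rotated])
  ultimately have "c \<in> g ` S"
    using assms(4-6) connectedD_interval[of "g ` S" "g u" "g v" c] by force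
  then show False using assms(3) by blast
qed

lemma continuous_on_Max_image:
  fixes g :: "'i \<Rightarrow> 'a::topological_space \<Rightarrow> real"
  assumes "finite J" "J \<noteq> {}" "\<And>j. j \<in> J \<Longrightarrow> continuous_on S (g j)"
  shows "continuous_on S (\<lambda>x. Max ((\<lambda>j. g j x) ` J))"
  using assms by (induction rule: finite_ne_induct) (auto intro!: continuous_intros)

lemma Re_complex_of_real_mult: "Re (of_real x * z) = x * Re z"
  by simp

text \<open>Data that do not depend on the radius. \<open>gap\<close> separates the exponents and
  \<open>W\<close> bounds them; the constants on a single circle are expressed through these,
  \<open>q\<close> and the number of terms.\<close>

locale exp_sum =
  fixes J :: "nat set" and w :: "nat \<Rightarrow> complex" and H :: "nat \<Rightarrow> complex \<Rightarrow> complex"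
    and q :: nat and gap W :: real
  assumes finJ: "finite J" and neJ: "J \<noteq> {}" and q: "1 \<le> q"
    and hol: "\<And>j. j \<in> J \<Longrightarrow> H j holomorphic_on UNIV"
    and gap: "0 < gap" "\<And>j k. j \<in> J \<Longrightarrow> k \<in> J \<Longrightarrow> j \<noteq> k \<Longrightarrow> gap \<le> norm (w j - w k)"
    and W: "\<And>j. j \<in> J \<Longrightarrow> norm (w j) \<le> W"
begin

definition f :: "complex \<Rightarrow> complex" where
  "f z = (\<Sum>j\<in>J. H j z * exp (w j * z ^ q))"

text \<open>Support function of the convex hull of the conjugated exponents in the direction
  \<open>q * \<theta>\<close>, because \<open>Re (w j * v)\<close> is the inner product of
  \<open>cnj (w j)\<close> with \<open>v\<close>. This is the origin of the conjugates in
  \<open>conj_exponents\<close>.\<close>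

definition supp :: "real \<Rightarrow> real" where
  "supp \<theta> = Max ((\<lambda>j. Re (w j * cis (real q * \<theta>))) ` J)"

definition good :: "real \<Rightarrow> real \<Rightarrow> bool" where
  "good \<kappa> \<theta> \<longleftrightarrow> (\<forall>j\<in>J. \<forall>k\<in>J. j \<noteq> k \<longrightarrow> \<kappa> \<le> \<bar>Re ((w j - w k) * cis (real q * \<theta>))\<bar>)"

text \<open>
  By \<open>Re_cis_small_imp_close\<close>, angles within \<open>1 / q\<close> of each other that are bad for the same pair of
  exponents differ by at most \<open>A \<kappa>\<close>.
\<close>
definition A :: real where "A = 4 / gap"

definition n :: real where "n = real (card J)"

text \<open>\<open>B * \<kappa> * \<rho>\<close> will be the radius of the discs for Landau's
  factorization: points of a short arc have angular distance at most
  \<open>(2 * n\<^sup>2 + 1) * A * \<kappa>\<close> from a good angle, and only a sixth of the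
  radius is usable.\<close>

definition B :: real where "B = 6 * (2 * n\<^sup>2 + 1) * A"

lemma A_pos: "0 < A" using gap by (simp add: A_def)

lemma n_ge_1: "1 \<le> n"
  using finJ neJ by (simp add: n_def Suc_le_eq card_gt_0_iff)

lemma W_nonneg: "0 \<le> W"
  using W neJ norm_ge_zero order_trans by blast

lemma f_holomorphic: "f holomorphic_on UNIV"
  unfolding f_def[abs_def] by (intro holomorphic_intros hol)

lemma good_near:
  assumes "0 < \<kappa>" "real q * (2 * A * \<kappa> * n\<^sup>2) \<le> 1"
  shows "\<exists>\<theta>\<in>{\<alpha>..\<alpha> + 2 * A * \<kappa> * n\<^sup>2}. good \<kappa> \<theta>"
proof (rule ccontr)
  \<comment> \<open>every pair of exponents spoils at most one of \<open>n\<^sup>2 + 1\<close> equidistant angles\<close>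
  define N where "N = card J * card J"
  have N: "real N = n\<^sup>2" by (simp add: N_def n_def power2_eq_square)
  \<comment> \<open>The spacing is twice the distance \<open>A * \<kappa>\<close> within which two
    neighbouring angles can be bad for the same pair.\<close>
  define t where "t = (\<lambda>i. \<alpha> + 2 * A * \<kappa> * real i)"
  have A\<kappa>: "0 < A * \<kappa>" using A_pos assms by simp
  assume no: "\<not> ?thesis"
  have "\<exists>p. p \<in> J \<times> J \<and> fst p \<noteq> snd p \<and> \<bar>Re ((w (fst p) - w (snd p)) * cis (real q * t i))\<bar> < \<kappa>"
    if "i \<le> N" for i
  proof -
    have "A * \<kappa> * real i \<le> A * \<kappa> * n\<^sup>2"
      using that A\<kappa> by (intro mult_left_mono) (auto simp flip: N)
    then have "t i \<in> {\<alpha>..\<alpha> + 2 * A * \<kappa> * n\<^sup>2}"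
      using mult_nonneg_nonneg[OF less_imp_le[OF A\<kappa>], of "real i"] by (simp add: t_def mult_ac)
    then have "\<not> good \<kappa> (t i)" using no by blast
    then obtain j k where "j \<in> J" "k \<in> J" "j \<noteq> k" "\<bar>Re ((w j - w k) * cis (real q * t i))\<bar> < \<kappa>"
      unfolding good_def by (auto simp: not_le)
    then show ?thesis by (intro exI[of _ "(j, k)"]) auto
  qed
  then obtain p where p: "\<And>i. i \<le> N \<Longrightarrow> p i \<in> J \<times> J \<and> fst (p i) \<noteq> snd (p i) \<and>
      \<bar>Re ((w (fst (p i)) - w (snd (p i))) * cis (real q * t i))\<bar> < \<kappa>"
    by metis
  have "card (p ` {..N}) \<le> card (J \<times> J)" using p finJ by (intro card_mono) (blast intro: finite_SigmaI, blast)
  also have "\<dots> < card {..N}" by (simp add: N_def card_cartesian_product)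
  finally have "\<not> inj_on p {..N}" by (rule pigeonhole)
  then obtain i i' where i: "i \<le> N" "i' \<le> N" "i < i'" "p i = p i'"
    unfolding inj_on_def by (metis atMost_iff linorder_neqE_nat)
  have diff: "t i' - t i = 2 * A * \<kappa> * (real i' - real i)" by (simp add: t_def algebra_simps)
  have "t i' - t i \<le> 4 * \<kappa> / gap"
  proof (rule Re_cis_small_imp_close[of gap "w (fst (p i)) - w (snd (p i))" _ _ q])
    show "gap \<le> norm (w (fst (p i)) - w (snd (p i)))" using p[OF i(1)] by (intro gap) auto
    have "2 * A * \<kappa> * (real i' - real i) \<le> 2 * A * \<kappa> * n\<^sup>2"
    proof -
      have "real i' - real i \<le> n\<^sup>2" using i by (simp flip: N)
      from mult_left_mono[OF this, of "2 * (A * \<kappa>)"] show ?thesis using A\<kappa> by (simp add: mult.assoc)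
    qed
    then have "real q * (t i' - t i) \<le> real q * (2 * A * \<kappa> * n\<^sup>2)"
      unfolding diff by (rule mult_left_mono) simp
    then show "real q * (t i' - t i) \<le> 1" using assms(2) by simp
    show "\<bar>Re ((w (fst (p i)) - w (snd (p i))) * cis (real q * t i))\<bar> \<le> \<kappa>" using p[OF i(1)] by simp
    show "\<bar>Re ((w (fst (p i)) - w (snd (p i))) * cis (real q * t i'))\<bar> \<le> \<kappa>" using p[OF i(2)] i(4) by simp
    have "0 < 2 * A * \<kappa>" using A_pos assms(1) by simp
    then show "t i \<le> t i'" using i(3) by (simp add: t_def mult_le_cancel_left_pos)
  qed (use gap q in auto)
  then have "2 * A * \<kappa> * (real i' - real i) \<le> A * \<kappa>" unfolding diff by (simp only: A_def times_divide_eq_left)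
  then have "A * \<kappa> * (2 * (real i' - real i)) \<le> A * \<kappa> * 1" by (simp add: algebra_simps)
  then show False using A\<kappa> i(3) by (subst (asm) mult_le_cancel_left_pos) auto
qed

lemma maximal_index: obtains j where "j \<in> J" "\<And>k. k \<in> J \<Longrightarrow> Re (w k * cis (real q * \<theta>)) \<le> Re (w j * cis (real q * \<theta>))"
proof -
  have "supp \<theta> \<in> (\<lambda>j. Re (w j * cis (real q * \<theta>))) ` J"
    unfolding supp_def using finJ neJ by (intro Max_in) auto
  then obtain j where "j \<in> J" "supp \<theta> = Re (w j * cis (real q * \<theta>))" by blast
  then show ?thesis using that[of j] finJ by (metis Max_ge finite_imageI imageI supp_def)
qed

lemma supp_eq:
  assumes "j \<in> J" "\<And>k. k \<in> J \<Longrightarrow> Re (w k * cis (real q * \<theta>)) \<le> Re (w j * cis (real q * \<theta>))"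
  shows "supp \<theta> = Re (w j * cis (real q * \<theta>))"
  unfolding supp_def using assms finJ by (intro Max_eqI) auto

lemma continuous_supp: "continuous_on S supp"
  unfolding supp_def[abs_def] using finJ neJ by (intro continuous_on_Max_image continuous_intros) auto

lemma abs_supp_le: "\<bar>supp \<theta>\<bar> \<le> W"
proof -
  obtain j where j: "j \<in> J" "\<And>k. k \<in> J \<Longrightarrow> Re (w k * cis (real q * \<theta>)) \<le> Re (w j * cis (real q * \<theta>))"
    using maximal_index by blast
  have "\<bar>Re (w j * cis (real q * \<theta>))\<bar> \<le> norm (w j * cis (real q * \<theta>))" by (rule abs_Re_le_cmod)
  then show ?thesis using supp_eq[OF j] W[OF j(1)] by (simp add: norm_mult)
qed

lemma supp_integrable: "supp integrable_on {\<alpha>..\<beta>}"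
  by (rule integrable_continuous_interval[OF continuous_supp])

text \<open>Without level points inside the interval, each of the continuous functions compared with
  \<kappa> stays on one side of it. If one stays below, \<open>Re_cis_small_imp_close\<close> makes
  the interval short; otherwise every angle is good.\<close>

lemma level_dichotomy:
  assumes "0 < \<kappa>" "real q * (A * \<kappa>) < 1" "x < y"
    and noT: "\<And>j k \<theta>. j \<in> J \<Longrightarrow> k \<in> J \<Longrightarrow> j \<noteq> k \<Longrightarrow> \<theta> \<in> {x<..<y} \<Longrightarrow> \<bar>Re ((w j - w k) * cis (real q * \<theta>))\<bar> \<noteq> \<kappa>"
  shows "(\<forall>\<theta>\<in>{x..y}. good \<kappa> \<theta>) \<or> y - x \<le> A * \<kappa>"
proof (cases "\<exists>j\<in>J. \<exists>k\<in>J. j \<noteq> k \<and> (\<exists>u\<in>{x<..<y}. \<bar>Re ((w j - w k) * cis (real q * u))\<bar> < \<kappa>)")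
  case True
  then obtain j k u where jk: "j \<in> J" "k \<in> J" "j \<noteq> k" "u \<in> {x<..<y}" "\<bar>Re ((w j - w k) * cis (real q * u))\<bar> < \<kappa>"
    by blast
  let ?g = "\<lambda>\<theta>. \<bar>Re ((w j - w k) * cis (real q * \<theta>))\<bar>"
  have cont: "continuous_on S ?g" for S by (intro continuous_intros)
  have "?g v \<le> \<kappa>" if "v \<in> {x<..<y}" for v
    using connected_less_const[OF _ cont, of "{x<..<y}" \<kappa> u v] noT[OF jk(1-3)] jk(4,5) that by auto
  then have le: "?g v \<le> \<kappa>" if "v \<in> {x..y}" for v
    using continuous_ge_on_Ioo[OF continuous_on_minus[OF cont], of x y "- \<kappa>" v] that \<open>x < y\<close> by auto
  \<comment> \<open>Truncation to length \<open>1 / q\<close> meets the hypothesis of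
    \<open>Re_cis_small_imp_close\<close>; the resulting bound is less than \<open>1 / q\<close>, so
    nothing was cut off.\<close>
  define y' where "y' = min y (x + 1 / real q)"
  have y': "x \<le> y'" "y' \<le> y" using \<open>x < y\<close> by (auto simp: y'_def)
  have "y' - x \<le> 4 * \<kappa> / gap"
  proof (rule Re_cis_small_imp_close[of gap "w j - w k" _ _ q])
    have "real q * (y' - x) \<le> real q * (1 / real q)" by (intro mult_left_mono) (auto simp: y'_def)
    then show "real q * (y' - x) \<le> 1" using q by simp
  qed (use gap jk q y' le in auto)
  then have "y' - x \<le> A * \<kappa>" by (simp add: A_def)
  moreover have "A * \<kappa> < 1 / real q" using assms(2) q by (simp add: field_simps)
  ultimately have "y' = y" by (auto simp: y'_def min_def split: if_splits)
  then show ?thesis using \<open>y' - x \<le> A * \<kappa>\<close> by simp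
next
  case False
  have "good \<kappa> \<theta>" if "\<theta> \<in> {x..y}" for \<theta>
    unfolding good_def
  proof (intro ballI impI)
    fix j k assume jk: "j \<in> J" "k \<in> J" "j \<noteq> k"
    have cont: "continuous_on S (\<lambda>\<theta>. \<bar>Re ((w j - w k) * cis (real q * \<theta>))\<bar>)" for S by (intro continuous_intros)
    show "\<kappa> \<le> \<bar>Re ((w j - w k) * cis (real q * \<theta>))\<bar>"
    proof (rule continuous_ge_on_Ioo[OF cont _ \<open>x < y\<close> that])
      fix u assume "u \<in> {x<..<y}"
      then show "\<kappa> \<le> \<bar>Re ((w j - w k) * cis (real q * u))\<bar>" using False jk not_less by blast
    qed
  qed
  then show ?thesis by blast
qed

end

text \<open>One admissible circle. By \<open>dom\<close> the difference \<kappa> in the exponents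
  outweighs the bounds of the coefficients and the number of terms. \<open>upper\<close> reaches to
  \<open>2 * \<rho>\<close> because discs of radius at most \<rho> around points of the circle are
  used; \<open>small\<close> keeps their radius that small and the angles in the range of
  \<open>Re_cis_small_imp_close\<close>.\<close>

locale exp_sum_circle = exp_sum +
  fixes \<rho> \<kappa> U :: real
  assumes pos: "0 < \<rho>" "0 < \<kappa>" "1 \<le> U"
    and upper: "\<And>j z. j \<in> J \<Longrightarrow> norm z \<le> 2 * \<rho> \<Longrightarrow> norm (H j z) \<le> exp U"
    and lower: "\<And>j z. j \<in> J \<Longrightarrow> norm z = \<rho> \<Longrightarrow> exp (- U) \<le> norm (H j z)"
    and argH: "\<And>j \<alpha> \<beta> L. j \<in> J \<Longrightarrow> \<alpha> \<le> \<beta> \<Longrightarrow> \<beta> \<le> \<alpha> + 2 * pi \<Longrightarrow> continuous_on {\<alpha>..\<beta>} L \<Longrightarrow>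
        (\<And>\<theta>. \<theta> \<in> {\<alpha>..\<beta>} \<Longrightarrow> exp (L \<theta>) = H j (of_real \<rho> * cis \<theta>)) \<Longrightarrow> \<bar>Im (L \<beta> - L \<alpha>)\<bar> \<le> U"
    and dom: "2 * U + ln (2 * n) \<le> \<kappa> * \<rho> ^ q"
    and small: "real q * (B * \<kappa>) \<le> 1"
begin

section \<open>Change of the argument around one circle\<close>

lemma U_le: "U \<le> \<kappa> * \<rho> ^ q" "ln (2 * n) \<le> \<kappa> * \<rho> ^ q" "1 \<le> \<kappa> * \<rho> ^ q"
proof -
  have "0 \<le> ln (2 * n)" using n_ge_1 by simp
  then show "U \<le> \<kappa> * \<rho> ^ q" "ln (2 * n) \<le> \<kappa> * \<rho> ^ q" "1 \<le> \<kappa> * \<rho> ^ q" using dom pos by simp_all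
qed

lemma circle_power: "(of_real \<rho> * cis \<theta>) ^ q = of_real (\<rho> ^ q) * cis (real q * \<theta>)"
  by (simp only: power_mult_distrib Complex.DeMoivre of_real_power)

lemma small_consequences: "B * \<kappa> \<le> 1" "real q * (A * \<kappa>) < 1" "real q * (2 * A * \<kappa> * n\<^sup>2) \<le> 1"
proof -
  have A\<kappa>: "0 < A * \<kappa>" using A_pos pos by simp
  have B: "B * \<kappa> = 12 * ((A * \<kappa>) * n\<^sup>2) + 6 * (A * \<kappa>)" by (simp add: B_def algebra_simps)
  have nn: "0 \<le> (A * \<kappa>) * n\<^sup>2" using A\<kappa> by simp
  have q1: "1 \<le> real q" using q by simp
  have AB: "A * \<kappa> < B * \<kappa>" "2 * A * \<kappa> * n\<^sup>2 \<le> B * \<kappa>" "0 \<le> B * \<kappa>" 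
    using B nn A\<kappa> by (simp_all add: mult_ac)
  have "1 * (B * \<kappa>) \<le> real q * (B * \<kappa>)" using q1 AB by (intro mult_right_mono) auto
  then show "B * \<kappa> \<le> 1" using small by simp
  have "real q * (A * \<kappa>) < real q * (B * \<kappa>)" using q1 AB by (intro mult_strict_left_mono) auto
  then show "real q * (A * \<kappa>) < 1" using small by simp
  have "real q * (2 * A * \<kappa> * n\<^sup>2) \<le> real q * (B * \<kappa>)" using q1 AB by (intro mult_left_mono) auto
  then show "real q * (2 * A * \<kappa> * n\<^sup>2) \<le> 1" using small by simp
qed

text \<open>At a good angle the real parts of the exponents differ by at least
  \<open>\<kappa> * \<rho> ^ q\<close>, so by \<open>dom\<close> every other term is at most
  \<open>1 / (2 * n)\<close> of the maximal one, and all of them together at most a half.\<close>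

lemma dominance:
  assumes g: "good \<kappa> \<theta>" and j: "j \<in> J" "\<And>k. k \<in> J \<Longrightarrow> Re (w k * cis (real q * \<theta>)) \<le> Re (w j * cis (real q * \<theta>))"
  defines "z \<equiv> of_real \<rho> * cis \<theta>"
  shows "norm (f z - H j z * exp (w j * z ^ q)) \<le> norm (H j z * exp (w j * z ^ q)) / 2"
proof -
  let ?T = "\<lambda>k. H k z * exp (w k * z ^ q)"
  have nz: "norm z = \<rho>" using pos by (simp add: z_def norm_mult)
  have normT: "norm (?T k) = norm (H k z) * exp (\<rho> ^ q * Re (w k * cis (real q * \<theta>)))" for k
  proof -
    have "Re (w k * z ^ q) = \<rho> ^ q * Re (w k * cis (real q * \<theta>))"
    proof -
      have "w k * z ^ q = of_real (\<rho> ^ q) * (w k * cis (real q * \<theta>))"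
        unfolding z_def circle_power by (simp only: mult_ac)
      then show ?thesis by (simp only: Re_complex_of_real_mult)
    qed
    then show ?thesis by (simp add: norm_mult)
  qed
  have each: "norm (?T k) \<le> norm (?T j) / (2 * n)" if k: "k \<in> J - {j}" for k
  proof -
    have kJ: "k \<in> J" "j \<noteq> k" using k by auto
    have "\<kappa> \<le> \<bar>Re ((w j - w k) * cis (real q * \<theta>))\<bar>"
      using g[unfolded good_def, rule_format, OF j(1) kJ] .
    then have "\<kappa> \<le> Re (w j * cis (real q * \<theta>)) - Re (w k * cis (real q * \<theta>))"
      using j(2)[OF kJ(1)] by (simp only: left_diff_distrib minus_complex.simps)
    then have "\<rho> ^ q * \<kappa> \<le> \<rho> ^ q * (Re (w j * cis (real q * \<theta>)) - Re (w k * cis (real q * \<theta>)))"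
      using pos by (intro mult_left_mono) auto
    then have "U + \<rho> ^ q * Re (w k * cis (real q * \<theta>)) \<le> - U - ln (2 * n) + \<rho> ^ q * Re (w j * cis (real q * \<theta>))"
      using dom by (simp add: algebra_simps)
    then have "exp U * exp (\<rho> ^ q * Re (w k * cis (real q * \<theta>)))
        \<le> exp (- U - ln (2 * n)) * exp (\<rho> ^ q * Re (w j * cis (real q * \<theta>)))"
      by (simp only: mult_exp_exp exp_le_cancel_iff)
    also have "exp (- U - ln (2 * n)) = exp (- U) / (2 * n)" using n_ge_1 by (simp add: exp_diff)
    finally have "exp U * exp (\<rho> ^ q * Re (w k * cis (real q * \<theta>)))
        \<le> exp (- U) / (2 * n) * exp (\<rho> ^ q * Re (w j * cis (real q * \<theta>)))" .
    moreover have "norm (?T k) \<le> exp U * exp (\<rho> ^ q * Re (w k * cis (real q * \<theta>)))"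
      unfolding normT using upper[of k z] k nz pos by (intro mult_right_mono) auto
    moreover have "exp (- U) / (2 * n) * exp (\<rho> ^ q * Re (w j * cis (real q * \<theta>))) \<le> norm (?T j) / (2 * n)"
      unfolding normT using lower[OF j(1) nz] n_ge_1 by (simp add: divide_right_mono mult_right_mono)
    ultimately show ?thesis by linarith
  qed
  have "f z - ?T j = (\<Sum>k\<in>J - {j}. ?T k)"
    unfolding f_def using finJ j(1) by (simp add: sum.remove)
  then have "norm (f z - ?T j) \<le> (\<Sum>k\<in>J - {j}. norm (?T k))" by (simp add: norm_sum)
  also have "\<dots> \<le> (\<Sum>k\<in>J - {j}. norm (?T j) / (2 * n))" by (intro sum_mono each)
  also have "\<dots> \<le> n * (norm (?T j) / (2 * n))"
  proof -
    have "real (card (J - {j})) \<le> n" using finJ by (simp add: n_def card_Diff1_le)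
    then have "real (card (J - {j})) * (norm (?T j) / (2 * n)) \<le> n * (norm (?T j) / (2 * n))"
      using n_ge_1 by (intro mult_right_mono) auto
    then show ?thesis by (simp only: sum_constant)
  qed
  also have "\<dots> = norm (?T j) / 2" using n_ge_1 by simp
  finally show ?thesis .
qed

lemma f_nonzero: "\<exists>z. f z \<noteq> 0"
proof -
  obtain \<theta> where g: "good \<kappa> \<theta>" using good_near[OF pos(2) small_consequences(3), of 0] by blast
  obtain j where j: "j \<in> J" "\<And>k. k \<in> J \<Longrightarrow> Re (w k * cis (real q * \<theta>)) \<le> Re (w j * cis (real q * \<theta>))"
    using maximal_index by blast
  let ?z = "of_real \<rho> * cis \<theta>"
  have "norm ?z = \<rho>" using pos by (simp add: norm_mult)
  then have "H j ?z \<noteq> 0" using lower[OF j(1), of ?z] by (metis exp_gt_zero norm_zero not_less)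
  then have "0 < norm (H j ?z * exp (w j * ?z ^ q))" by simp
  then have "f ?z \<noteq> 0" using dominance[OF g j] by (auto simp: norm_minus_commute)
  then show ?thesis by blast
qed

text \<open>The maximal index cannot change along the arc, as no difference of real parts vanishes
  there. Then \<open>f\<close> is \<open>H j z * exp (w j * z ^ q)\<close> times a factor
  \<open>v\<close> with positive real part: the exponential contributes the integral exactly,
  \<open>H j\<close> at most \<open>U\<close>, and the principal logarithm of \<open>v\<close> at
  most \<open>pi\<close> at each end.\<close>

lemma good_arc:
  assumes "\<alpha> \<le> \<beta>" "\<beta> \<le> \<alpha> + 2 * pi" and g: "\<And>\<theta>. \<theta> \<in> {\<alpha>..\<beta>} \<Longrightarrow> good \<kappa> \<theta>"
    and L: "continuous_on {\<alpha>..\<beta>} L" "\<And>\<theta>. \<theta> \<in> {\<alpha>..\<beta>} \<Longrightarrow> exp (L \<theta>) = f (of_real \<rho> * cis \<theta>)"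
  shows "\<bar>Im (L \<beta> - L \<alpha>) - real q * \<rho> ^ q * integral {\<alpha>..\<beta>} supp\<bar> \<le> U + 2 * pi"
proof -
  obtain j where j: "j \<in> J" "\<And>k. k \<in> J \<Longrightarrow> Re (w k * cis (real q * \<alpha>)) \<le> Re (w j * cis (real q * \<alpha>))"
    using maximal_index by blast
  have jmax: "Re (w k * cis (real q * \<theta>)) \<le> Re (w j * cis (real q * \<theta>))" if "k \<in> J" "\<theta> \<in> {\<alpha>..\<beta>}" for k \<theta>
  proof (cases "k = j")
    case False
    let ?g = "\<lambda>\<theta>. Re ((w k - w j) * cis (real q * \<theta>))"
    have "?g \<theta> < 0"
    proof (rule connected_less_const[of "{\<alpha>..\<beta>}" ?g 0 \<alpha>])
      show ne: "?g x \<noteq> 0" if "x \<in> {\<alpha>..\<beta>}" for x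
        using g[OF that] \<open>k \<in> J\<close> j(1) False pos unfolding good_def by force
      show "?g \<alpha> < 0" using ne[of \<alpha>] j(2)[OF that(1)] \<open>\<alpha> \<le> \<beta>\<close>
        by (simp add: left_diff_distrib)
    qed (use that \<open>\<alpha> \<le> \<beta>\<close> in \<open>auto intro!: continuous_intros\<close>)
    then show ?thesis by (simp add: left_diff_distrib)
  qed simp
  define T where "T = (\<lambda>z. H j z * exp (w j * z ^ q))"
  define z where "z = (\<lambda>\<theta>. of_real \<rho> * cis \<theta>)"
  have nz: "norm (z \<theta>) = \<rho>" for \<theta> using pos by (simp add: z_def norm_mult)
  have Hnz: "H j (z \<theta>) \<noteq> 0" for \<theta> using lower[OF j(1) nz[of \<theta>]] by (metis exp_gt_zero norm_zero not_less)
  have Tnz: "T (z \<theta>) \<noteq> 0" for \<theta> using Hnz by (simp add: T_def)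
  define v where "v = (\<lambda>\<theta>. f (z \<theta>) / T (z \<theta>))"
  have Rev: "0 < Re (v \<theta>)" if "\<theta> \<in> {\<alpha>..\<beta>}" for \<theta>
  proof -
    have "norm (f (z \<theta>) - T (z \<theta>)) \<le> norm (T (z \<theta>)) / 2"
      using dominance[OF g[OF that] j(1) jmax[OF _ that]] by (simp add: T_def z_def)
    moreover have "v \<theta> - 1 = (f (z \<theta>) - T (z \<theta>)) / T (z \<theta>)" using Tnz[of \<theta>] by (simp add: v_def diff_divide_distrib)
    ultimately have "norm (v \<theta> - 1) \<le> 1 / 2" using Tnz[of \<theta>] by (simp add: norm_divide divide_le_eq)
    then have "\<bar>Re (v \<theta>) - 1\<bar> \<le> 1 / 2" using abs_Re_le_cmod[of "v \<theta> - 1"] by simp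
    then show ?thesis by arith
  qed
  have contz: "continuous_on S (\<lambda>\<theta>. h (z \<theta>))" if "h holomorphic_on UNIV" for S h
    unfolding z_def by (rule continuous_on_circle_compose[OF holomorphic_on_imp_continuous_on[OF that]]) auto
  have contv: "continuous_on {\<alpha>..\<beta>} v"
    unfolding v_def T_def using Hnz
    by (intro continuous_intros contz f_holomorphic hol j) (auto simp: z_def intro!: continuous_intros)
  define P where "P = (\<lambda>\<theta>. of_real (\<rho> ^ q) * (w j * cis (real q * \<theta>)))"
  \<comment> \<open>Taking the exponent and the logarithm of \<open>v\<close> out of
    \<open>L\<close> leaves a continuous logarithm of \<open>H j\<close>, to which
    \<open>argH\<close> applies.\<close>
  define L' where "L' = (\<lambda>\<theta>. L \<theta> - P \<theta> - Ln (v \<theta>))"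
  have "\<bar>Im (L' \<beta> - L' \<alpha>)\<bar> \<le> U"
  proof (rule argH[OF j(1) assms(1,2)])
    show "continuous_on {\<alpha>..\<beta>} L'"
      unfolding L'_def P_def by (intro continuous_intros L contv) (use Rev in \<open>force simp: complex_nonpos_Reals_iff\<close>)
    show "exp (L' \<theta>) = H j (of_real \<rho> * cis \<theta>)" if th: "\<theta> \<in> {\<alpha>..\<beta>}" for \<theta>
    proof -
      have vn: "v \<theta> \<noteq> 0" using Rev[OF th] by (metis less_irrefl zero_complex.sel(1))
      have "P \<theta> = w j * z \<theta> ^ q" unfolding P_def z_def circle_power by simp
      then have "exp (L' \<theta>) = f (z \<theta>) / exp (w j * z \<theta> ^ q) / v \<theta>"
        using L(2)[OF th] vn by (simp add: L'_def exp_diff z_def)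
      also have "\<dots> = H j (z \<theta>)" using vn Tnz[of \<theta>] unfolding v_def T_def by (simp add: field_simps)
      finally show ?thesis by (simp add: z_def)
    qed
  qed
  moreover have "\<bar>Im (Ln (v \<theta>))\<bar> \<le> pi" if "\<theta> \<in> {\<alpha>..\<beta>}" for \<theta>
    using Re_Ln_pos_lt_imp Rev[OF that] Im_Ln_le_pi[of "v \<theta>"] mpi_less_Im_Ln[of "v \<theta>"]
    by (metis abs_le_iff less_eq_real_def less_irrefl minus_le_iff zero_complex.sel(1))
  then have "\<bar>Im (Ln (v \<alpha>))\<bar> \<le> pi" "\<bar>Im (Ln (v \<beta>))\<bar> \<le> pi" using \<open>\<alpha> \<le> \<beta>\<close> by auto
  moreover have "Im (P \<beta> - P \<alpha>) = real q * \<rho> ^ q * integral {\<alpha>..\<beta>} supp"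
  proof -
    have "((\<lambda>\<theta>. real q * \<rho> ^ q * Re (w j * cis (real q * \<theta>))) has_integral (Im (P \<beta>) - Im (P \<alpha>))) {\<alpha>..\<beta>}"
    proof (rule fundamental_theorem_of_calculus[OF \<open>\<alpha> \<le> \<beta>\<close>])
      fix x
      show "((\<lambda>\<theta>. Im (P \<theta>)) has_vector_derivative real q * \<rho> ^ q * Re (w j * cis (real q * x))) (at x within {\<alpha>..\<beta>})"
        unfolding P_def has_real_derivative_iff_has_vector_derivative[symmetric]
        by (auto intro!: derivative_eq_intros simp: algebra_simps)
    qed
    then have "((\<lambda>\<theta>. real q * \<rho> ^ q * supp \<theta>) has_integral (Im (P \<beta>) - Im (P \<alpha>))) {\<alpha>..\<beta>}"
      by (rule has_integral_eq[rotated]) (use supp_eq[OF j(1) jmax] in simp)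
    then have "integral {\<alpha>..\<beta>} (\<lambda>\<theta>. real q * \<rho> ^ q * supp \<theta>) = Im (P \<beta>) - Im (P \<alpha>)"
      by (rule integral_unique)
    then show ?thesis by simp
  qed
  ultimately show ?thesis unfolding L'_def by (simp add: abs_le_iff) 
qed

text \<open>No term need dominate on the arc, but one does at a good angle \<open>\<theta>0\<close>
  nearby. After division by its exponential, the function grows from \<open>z0\<close> by at most a
  factor \<open>exp M\<close> in a disc around \<open>z0\<close>, and Landau's bound applies. The
  divided exponential and the integral change by at most a multiple of
  \<open>\<kappa> * \<rho> ^ q\<close> each, since the arc has length at most
  \<open>A * \<kappa>\<close>.\<close>

lemma short_arc:
  assumes "\<alpha> \<le> \<beta>" "\<beta> - \<alpha> \<le> A * \<kappa>"
    and circ: "\<And>z. norm z = \<rho> \<Longrightarrow> f z \<noteq> 0"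
    and L: "continuous_on {\<alpha>..\<beta>} L" "\<And>\<theta>. \<theta> \<in> {\<alpha>..\<beta>} \<Longrightarrow> exp (L \<theta>) = f (of_real \<rho> * cis \<theta>)"
  shows "\<bar>Im (L \<beta> - L \<alpha>) - real q * \<rho> ^ q * integral {\<alpha>..\<beta>} supp\<bar>
    \<le> (32 * (1 + W * real q * 2 ^ q * B) + 2 * W * real q * A) * (\<kappa> * \<rho> ^ q)"
proof -
  obtain \<theta>0 where \<theta>0: "\<theta>0 \<in> {\<alpha>..\<alpha> + 2 * A * \<kappa> * n\<^sup>2}" "good \<kappa> \<theta>0"
    using good_near[OF pos(2) small_consequences(3)] by blast
  obtain j where j: "j \<in> J" "\<And>k. k \<in> J \<Longrightarrow> Re (w k * cis (real q * \<theta>0)) \<le> Re (w j * cis (real q * \<theta>0))"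
    using maximal_index by blast
  define z0 where "z0 = of_real \<rho> * cis \<theta>0"
  have nz0: "norm z0 = \<rho>" using pos by (simp add: z0_def norm_mult)
  define g where "g = (\<lambda>z. f z * exp (- (w j * z ^ q)))"
  have g_hol: "g holomorphic_on UNIV" unfolding g_def by (intro holomorphic_intros f_holomorphic)
  have A\<kappa>: "0 < A * \<kappa>" using A_pos pos by simp
  have B0: "0 < B * \<kappa>" "B * \<kappa> \<le> 1"
  proof -
    have "0 < 6 * (2 * n\<^sup>2 + 1) * (A * \<kappa>)"
      by (rule mult_pos_pos[OF _ A\<kappa>]) (simp add: add_nonneg_pos)
    then show "0 < B * \<kappa>" by (simp add: B_def mult_ac)
  qed (rule small_consequences)
  define R where "R = B * \<kappa> * \<rho>"
  have R: "0 < R" "R \<le> \<rho>"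
    using B0 pos mult_right_mono[OF B0(2), of \<rho>] by (auto simp: R_def)
  \<comment> \<open>Bounds the real part of \<open>(w k - w j) * (z ^ q - z0 ^ q)\<close> in the
    disc of radius \<open>R\<close>.\<close>
  define V where "V = W * real q * 2 ^ q * B * (\<kappa> * \<rho> ^ q)"
  have V: "0 \<le> V"
  proof -
    have "0 \<le> (B * \<kappa>) * \<rho> ^ q" using pos(1) by (intro mult_nonneg_nonneg[OF less_imp_le[OF B0(1)]]) auto
    moreover have "0 \<le> W * (real q * 2 ^ q)" using W_nonneg by simp
    ultimately have "0 \<le> (W * (real q * 2 ^ q)) * ((B * \<kappa>) * \<rho> ^ q)" by (rule mult_nonneg_nonneg[rotated])
    then show ?thesis by (simp only: V_def mult_ac)
  qed
  \<comment> \<open>One \<open>U\<close>, \<open>ln n\<close> and \<open>V\<close> come from the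
    upper bound of the sum; the other \<open>U\<close> and \<open>ln 2\<close> come from
    \<open>exp (- U) / 2 \<le> norm (g z0)\<close>.\<close>
  define M where "M = 2 * U + ln (2 * n) + V"
  have M: "0 < M" using pos n_ge_1 V by (simp add: M_def add_pos_nonneg)
  have lower_g: "exp (- U) / 2 \<le> norm (g z0)"
  proof -
    have "norm (H j z0 * exp (w j * z0 ^ q)) \<le> norm (f z0) + norm (f z0 - H j z0 * exp (w j * z0 ^ q))"
      using norm_triangle_ineq4[of "f z0" "f z0 - H j z0 * exp (w j * z0 ^ q)"] by simp
    then have "norm (H j z0 * exp (w j * z0 ^ q)) / 2 \<le> norm (f z0)"
      using dominance[OF \<theta>0(2) j] unfolding z0_def[symmetric] by linarith
    then have le: "norm (H j z0) * norm (exp (w j * z0 ^ q)) / 2 \<le> norm (f z0)" by (simp only: norm_mult)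
    have "norm (H j z0) * norm (exp (w j * z0 ^ q)) / 2 * norm (exp (- (w j * z0 ^ q)))
        \<le> norm (f z0) * norm (exp (- (w j * z0 ^ q)))"
      by (rule mult_right_mono[OF le]) simp
    also have "norm (H j z0) * norm (exp (w j * z0 ^ q)) / 2 * norm (exp (- (w j * z0 ^ q))) = norm (H j z0) / 2"
    proof -
      have "norm (exp (w j * z0 ^ q)) * norm (exp (- (w j * z0 ^ q))) = 1"
        unfolding norm_mult[symmetric] by (simp add: mult_exp_exp)
      then show ?thesis by simp
    qed
    also have "norm (f z0) * norm (exp (- (w j * z0 ^ q))) = norm (g z0)" by (simp only: g_def norm_mult)
    finally show ?thesis using lower[OF j(1) nz0] by simp
  qed
  then have gz0: "g z0 \<noteq> 0" by (metis exp_gt_zero half_gt_zero norm_zero not_less)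
  have bound: "norm (g z) \<le> exp M * norm (g z0)" if z: "norm (z - z0) \<le> R" for z
  proof -
    have nz: "norm z \<le> 2 * \<rho>" using norm_triangle_ineq[of "z - z0" z0] z nz0 R by simp
    have pw: "norm (z ^ q - z0 ^ q) \<le> real q * (2 * \<rho>) ^ q * (norm (z - z0) / (2 * \<rho>))"
      using nz nz0 pos by (intro norm_power_diff_le) auto
    also have "\<dots> \<le> real q * (2 * \<rho>) ^ q * (R / (2 * \<rho>))"
      using z pos by (intro mult_left_mono divide_right_mono) auto
    also have "\<dots> = real q * 2 ^ q * B * (\<kappa> * \<rho> ^ q) / 2"
      using pos by (simp add: R_def power_mult_distrib field_simps)
    finally have pw: "norm (z ^ q - z0 ^ q) \<le> real q * 2 ^ q * B * (\<kappa> * \<rho> ^ q) / 2" .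
    have summand: "norm (H k z * exp (w k * z ^ q) * exp (- (w j * z ^ q))) \<le> exp (U + V)" if k: "k \<in> J" for k
    proof -
      \<comment> \<open>At \<open>z0\<close> the exponent of index \<open>j\<close> is maximal, so
        only the variation of \<open>z ^ q\<close> can make a term grow.\<close>
      have "Re ((w k - w j) * z0 ^ q) = \<rho> ^ q * (Re (w k * cis (real q * \<theta>0)) - Re (w j * cis (real q * \<theta>0)))"
      proof -
        have "(w k - w j) * z0 ^ q = of_real (\<rho> ^ q) * (w k * cis (real q * \<theta>0) - w j * cis (real q * \<theta>0))"
          unfolding z0_def circle_power by (simp only: left_diff_distrib right_diff_distrib mult_ac)
        then show ?thesis by (simp only: Re_complex_of_real_mult minus_complex.simps)
      qed
      also have "\<dots> \<le> 0" using j(2)[OF k] pos by (intro mult_nonneg_nonpos) auto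
      finally have 1: "Re ((w k - w j) * z0 ^ q) \<le> 0" .
      have "Re ((w k - w j) * (z ^ q - z0 ^ q)) \<le> norm (w k - w j) * norm (z ^ q - z0 ^ q)"
        using complex_Re_le_cmod[of "(w k - w j) * (z ^ q - z0 ^ q)"] unfolding norm_mult .
      also have "\<dots> \<le> (2 * W) * (real q * 2 ^ q * B * (\<kappa> * \<rho> ^ q) / 2)"
        using norm_triangle_ineq4[of "w k" "w j"] W[OF k] W[OF j(1)] pw W_nonneg by (intro mult_mono) auto
      also have "\<dots> = V" by (simp add: V_def)
      finally have "Re ((w k - w j) * z0 ^ q) + Re ((w k - w j) * (z ^ q - z0 ^ q)) \<le> V" using 1 by linarith
      moreover have "w k * z ^ q + - (w j * z ^ q) = (w k - w j) * z0 ^ q + (w k - w j) * (z ^ q - z0 ^ q)"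
        by (simp add: algebra_simps)
      ultimately have "Re (w k * z ^ q + - (w j * z ^ q)) \<le> V" by (simp only: plus_complex.simps)
      then have "norm (exp (w k * z ^ q + - (w j * z ^ q))) \<le> exp V" by (simp only: norm_exp_eq_Re exp_le_cancel_iff)
      then have "norm (H k z) * norm (exp (w k * z ^ q + - (w j * z ^ q))) \<le> exp U * exp V"
        using upper[OF k nz] by (intro mult_mono) auto
      then show ?thesis by (simp only: norm_mult[symmetric] mult_exp_exp mult.assoc)
    qed
    have "norm (g z) \<le> (\<Sum>k\<in>J. norm (H k z * exp (w k * z ^ q) * exp (- (w j * z ^ q))))"
      unfolding g_def f_def sum_distrib_right by (rule norm_sum)
    also have "\<dots> \<le> (\<Sum>k\<in>J. exp (U + V))" by (intro sum_mono summand)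
    also have "\<dots> = n * exp (U + V)" by (simp add: n_def)
    also have "\<dots> = exp (ln n + (U + V))" using n_ge_1 by (simp add: exp_add)
    also have "\<dots> = exp M * (exp (- U) / 2)"
    proof -
      have "ln n + (U + V) = (M + - U) - ln 2" using n_ge_1 by (simp add: M_def ln_mult)
      then show ?thesis by (simp only: exp_diff exp_add) simp
    qed
    also have "\<dots> \<le> exp M * norm (g z0)" using lower_g by (intro mult_left_mono) auto
    finally show ?thesis .
  qed
  define P where "P = (\<lambda>\<theta>. of_real (\<rho> ^ q) * (w j * cis (real q * \<theta>)))"
  have P: "P \<theta> = w j * (of_real \<rho> * cis \<theta>) ^ q" for \<theta> unfolding P_def circle_power by simp
  have qA: "A * \<kappa> \<le> 2 * pi"
  proof -
    have "1 * (A * \<kappa>) \<le> real q * (A * \<kappa>)" using q A\<kappa> by (intro mult_right_mono) auto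
    then show ?thesis using small_consequences(2) pi_gt3 by simp
  qed
  have main: "\<bar>Im ((L \<beta> - P \<beta>) - (L \<alpha> - P \<alpha>))\<bar> \<le> 32 * M"
  proof (rule arg_variation_le[OF g_hol gz0 R(1) M bound pos(1)])
    show "\<beta> \<le> \<alpha> + 2 * pi" using assms(2) qA by linarith
    show "norm (of_real \<rho> * cis \<theta> - z0) \<le> R / 6" if th: "\<theta> \<in> {\<alpha>..\<beta>}" for \<theta>
    proof -
      have An: "0 \<le> A * \<kappa> * n\<^sup>2" using A\<kappa> by simp
      have "norm (of_real \<rho> * cis \<theta> - z0) = \<rho> * norm (cis \<theta> - cis \<theta>0)"
        using pos by (simp add: z0_def norm_mult flip: right_diff_distrib)
      also have "\<dots> \<le> \<rho> * \<bar>\<theta> - \<theta>0\<bar>" using pos by (intro mult_left_mono norm_cis_diff_le) auto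
      also have "\<bar>\<theta> - \<theta>0\<bar> \<le> 2 * (A * \<kappa> * n\<^sup>2) + A * \<kappa>"
        using th \<theta>0(1) assms(2) An A\<kappa> by (auto simp: abs_le_iff mult.assoc)
      then have "\<rho> * \<bar>\<theta> - \<theta>0\<bar> \<le> \<rho> * (2 * (A * \<kappa> * n\<^sup>2) + A * \<kappa>)" using pos by (intro mult_left_mono) auto
      also have "\<dots> = R / 6" by (simp add: R_def B_def algebra_simps)
      finally show ?thesis .
    qed
    show "continuous_on {\<alpha>..\<beta>} (\<lambda>\<theta>. L \<theta> - P \<theta>)" unfolding P_def by (intro continuous_intros L)
    show "exp (L \<theta> - P \<theta>) = g (of_real \<rho> * cis \<theta>)" if "\<theta> \<in> {\<alpha>..\<beta>}" for \<theta>
      unfolding P g_def exp_diff L(2)[OF that] by (simp add: exp_minus divide_inverse)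
    show "g z \<noteq> 0" if "norm z = \<rho>" for z using circ[OF that] by (simp add: g_def)
  qed (use assms in auto)
  have "\<bar>Im (P \<beta> - P \<alpha>)\<bar> \<le> W * real q * A * (\<kappa> * \<rho> ^ q)"
  proof -
    have "P \<beta> - P \<alpha> = of_real (\<rho> ^ q) * (w j * (cis (real q * \<beta>) - cis (real q * \<alpha>)))"
      unfolding P_def by (simp only: right_diff_distrib)
    then have "norm (P \<beta> - P \<alpha>) = \<rho> ^ q * (norm (w j) * norm (cis (real q * \<beta>) - cis (real q * \<alpha>)))"
      using pos by (simp add: norm_mult norm_power)
    also have "\<dots> \<le> \<rho> ^ q * (W * (real q * (A * \<kappa>)))"
    proof (intro mult_left_mono mult_mono W j W_nonneg)
      have "norm (cis (real q * \<beta>) - cis (real q * \<alpha>)) \<le> \<bar>real q * \<beta> - real q * \<alpha>\<bar>" by (rule norm_cis_diff_le)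
      also have "\<dots> = real q * (\<beta> - \<alpha>)" using \<open>\<alpha> \<le> \<beta>\<close> by (simp add: mult_left_mono flip: right_diff_distrib)
      also have "\<dots> \<le> real q * (A * \<kappa>)" using assms(2) by (intro mult_left_mono) auto
      finally show "norm (cis (real q * \<beta>) - cis (real q * \<alpha>)) \<le> real q * (A * \<kappa>)" .
    qed (use pos in auto)
    finally show ?thesis using abs_Im_le_cmod[of "P \<beta> - P \<alpha>"] by (simp add: mult_ac)
  qed
  moreover have "\<bar>real q * \<rho> ^ q * integral {\<alpha>..\<beta>} supp\<bar> \<le> W * real q * A * (\<kappa> * \<rho> ^ q)"
  proof -
    have "norm (integral {\<alpha>..\<beta>} supp) \<le> W * (\<beta> - \<alpha>)"
      using \<open>\<alpha> \<le> \<beta>\<close> abs_supp_le by (intro integral_bound continuous_supp) auto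
    also have "\<dots> \<le> W * (A * \<kappa>)" using assms(2) W_nonneg by (intro mult_left_mono) auto
    finally have "real q * \<rho> ^ q * \<bar>integral {\<alpha>..\<beta>} supp\<bar> \<le> real q * \<rho> ^ q * (W * (A * \<kappa>))"
      using pos by (intro mult_left_mono) auto
    then show ?thesis using pos by (simp add: abs_mult mult_ac)
  qed
  moreover have "32 * M \<le> 32 * (1 + W * real q * 2 ^ q * B) * (\<kappa> * \<rho> ^ q)"
  proof -
    have "M \<le> \<kappa> * \<rho> ^ q + V" using dom by (simp add: M_def)
    then show ?thesis by (simp add: V_def algebra_simps)
  qed
  moreover have "Im (L \<beta> - L \<alpha>) = Im ((L \<beta> - P \<beta>) - (L \<alpha> - P \<alpha>)) + Im (P \<beta> - P \<alpha>)" by simp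
  moreover have "(32 * (1 + W * real q * 2 ^ q * B) + 2 * W * real q * A) * (\<kappa> * \<rho> ^ q)
     = 32 * (1 + W * real q * 2 ^ q * B) * (\<kappa> * \<rho> ^ q) + 2 * (W * real q * A * (\<kappa> * \<rho> ^ q))"
    by (simp only: distrib_right mult.assoc)
  ultimately show ?thesis using main unfolding abs_le_iff by linarith
qed

text \<open>The circle is cut at the angles where some pair of exponents is exactly at level
  \<kappa>. By \<open>level_dichotomy\<close> each piece consists of good angles or is short, and
  there are at most \<open>4 * q * n\<^sup>2 + 1\<close> pieces, whatever \<rho> and \<kappa>
  are.\<close>

lemma zero_count_estimate:
  assumes circ: "\<And>z. norm z = \<rho> \<Longrightarrow> f z \<noteq> 0"
  shows "\<bar>2 * pi * zero_count f \<rho> - real q * \<rho> ^ q * integral {0..2 * pi} supp\<bar>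
    \<le> (4 * real q * n\<^sup>2 + 1) * (8 + 32 * (1 + W * real q * 2 ^ q * B) + 2 * W * real q * A) * (\<kappa> * \<rho> ^ q)"
proof -
  define E where "E = (8 + 32 * (1 + W * real q * 2 ^ q * B) + 2 * W * real q * A) * (\<kappa> * \<rho> ^ q)"
  have contf: "continuous_on {0..2 * pi} (\<lambda>\<theta>. f (of_real \<rho> * cis \<theta>))"
    by (rule continuous_on_circle_compose[OF holomorphic_on_imp_continuous_on[OF f_holomorphic]]) auto
  have fnz: "f (of_real \<rho> * cis \<theta>) \<noteq> 0" for \<theta> using circ pos by (simp add: norm_mult)
  obtain L where L: "continuous_on {0..2 * pi} L" "\<And>\<theta>. \<theta> \<in> {0..2 * pi} \<Longrightarrow> f (of_real \<rho> * cis \<theta>) = exp (L \<theta>)"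
    using continuous_logarithm_on_contractible[OF contf convex_imp_contractible] fnz by auto
  \<comment> \<open>Deviation of the change of the argument from its expected value; it is additive
    over adjacent intervals, and over the full circle it is the quantity to be estimated.\<close>
  define \<Phi> where "\<Phi> = (\<lambda>x y. Im (L y - L x) - real q * \<rho> ^ q * integral {x..y} supp)"
  define level where "level = (\<lambda>p. {\<theta>\<in>{0..<2 * pi}. \<bar>Re ((w (fst p) - w (snd p)) * cis (real q * \<theta>))\<bar> = \<kappa>})"
  define Ps where "Ps = {p \<in> J \<times> J. fst p \<noteq> snd p}"
  define T where "T = (\<Union>p\<in>Ps. level p)"
  have Ps: "finite Ps" "card Ps \<le> card J * card J"
    using finJ card_mono[of "J \<times> J" Ps] by (auto simp: Ps_def card_cartesian_product)
  have level: "finite (level p)" "card (level p) \<le> 4 * q" if "p \<in> Ps" for p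
  proof -
    have "w (fst p) - w (snd p) \<noteq> 0" using gap that by (force simp: Ps_def)
    from card_Re_cis_level[OF this q] show "finite (level p)" "card (level p) \<le> 4 * q"
      unfolding level_def by blast+
  qed
  have finT: "finite T" unfolding T_def using Ps level by blast
  have "card T \<le> (\<Sum>p\<in>Ps. card (level p))" unfolding T_def by (rule card_UN_le[OF Ps(1)])
  also have "\<dots> \<le> (\<Sum>p\<in>Ps. 4 * q)" by (intro sum_mono level)
  also have "\<dots> \<le> card J * card J * (4 * q)" using Ps(2) by simp
  finally have "real (card T) \<le> real (card J * card J * (4 * q))" by (rule of_nat_mono)
  then have cardT: "real (card T + 1) \<le> 4 * real q * n\<^sup>2 + 1" by (simp add: n_def power2_eq_square mult_ac)
  have coef: "0 \<le> W * real q * 2 ^ q * B" "0 \<le> W * real q * A"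
    using W_nonneg A_pos by (auto simp: B_def)
  have \<kappa>\<rho>: "0 \<le> \<kappa> * \<rho> ^ q" using pos by simp
  have E0: "0 \<le> E"
    unfolding E_def by (rule mult_nonneg_nonneg[OF _ \<kappa>\<rho>]) (use coef in \<open>simp add: mult_ac\<close>)
  have "\<bar>\<Phi> 0 (2 * pi)\<bar> \<le> real (card T + 1) * E"
  proof (rule additive_interval_bound[OF finT, of 0 "2 * pi" \<Phi>])
    fix x y z :: real assume xyz: "0 \<le> x" "x \<le> y" "y \<le> z" "z \<le> 2 * pi"
    have "integral {x..z} supp = integral {x..y} supp + integral {y..z} supp"
      using Henstock_Kurzweil_Integration.integral_combine[OF xyz(2,3) supp_integrable] by simp
    then show "\<Phi> x z = \<Phi> x y + \<Phi> y z" by (simp add: \<Phi>_def algebra_simps)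
  next
    fix x y :: real assume xy: "0 \<le> x" "x \<le> y" "y \<le> 2 * pi" "{x<..<y} \<inter> T = {}"
    have Lxy: "continuous_on {x..y} L" "\<And>\<theta>. \<theta> \<in> {x..y} \<Longrightarrow> exp (L \<theta>) = f (of_real \<rho> * cis \<theta>)"
      using xy continuous_on_subset[OF L(1), of "{x..y}"] L(2) by auto
    show "\<bar>\<Phi> x y\<bar> \<le> E"
    proof (cases "x < y")
      case False
      then have "\<Phi> x y = 0" using xy by (simp add: \<Phi>_def)
      then show ?thesis using E0 by simp
    next
      case True
      have "(\<forall>\<theta>\<in>{x..y}. good \<kappa> \<theta>) \<or> y - x \<le> A * \<kappa>"
      proof (rule level_dichotomy[OF pos(2) small_consequences(2) True])
        fix j k \<theta> assume jk: "j \<in> J" "k \<in> J" "j \<noteq> k" "\<theta> \<in> {x<..<y}"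
        show "\<bar>Re ((w j - w k) * cis (real q * \<theta>))\<bar> \<noteq> \<kappa>"
        proof
          assume "\<bar>Re ((w j - w k) * cis (real q * \<theta>))\<bar> = \<kappa>"
          then have "\<theta> \<in> level (j, k)" unfolding level_def using jk(4) xy by simp
          then have "\<theta> \<in> T" using jk unfolding T_def Ps_def by force
          then show False using xy(4) jk(4) by blast
        qed
      qed
      then show ?thesis
      proof
        assume g: "\<forall>\<theta>\<in>{x..y}. good \<kappa> \<theta>"
        have "\<bar>\<Phi> x y\<bar> \<le> U + 2 * pi"
          unfolding \<Phi>_def by (rule good_arc[OF xy(2) _ _ Lxy]) (use xy g in auto)
        \<comment> \<open>Both \<open>U\<close> and 1 are at most
          \<open>\<kappa> * \<rho> ^ q\<close>, and \<open>1 + 2 * 3.2 < 8\<close>.\<close>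
        also have "\<dots> \<le> 8 * (\<kappa> * \<rho> ^ q)"
        proof -
          have "pi < 3.2" using pi_approx by simp
          then show ?thesis using U_le by linarith
        qed
        also have "\<dots> \<le> E" unfolding E_def using coef \<kappa>\<rho> by (intro mult_right_mono) (auto simp: mult_ac)
        finally show ?thesis .
      next
        assume "y - x \<le> A * \<kappa>"
        then have "\<bar>\<Phi> x y\<bar> \<le> (32 * (1 + W * real q * 2 ^ q * B) + 2 * W * real q * A) * (\<kappa> * \<rho> ^ q)"
          unfolding \<Phi>_def by (intro short_arc[OF xy(2) _ circ Lxy])
        also have "\<dots> \<le> E" unfolding E_def using \<kappa>\<rho> by (intro mult_right_mono) auto
        finally show ?thesis .
      qed
    qed
  qed auto
  also have "\<dots> \<le> (4 * real q * n\<^sup>2 + 1) * E"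
    using cardT E0 by (rule mult_right_mono)
  also have "\<Phi> 0 (2 * pi) = 2 * pi * zero_count f \<rho> - real q * \<rho> ^ q * integral {0..2 * pi} supp"
  proof -
    obtain z1 where z1: "f z1 \<noteq> 0" using f_nonzero by blast
    have "Im (L (2 * pi) - L 0) = 2 * pi * zero_count f \<rho>"
      using arg_variation_circle[OF f_holomorphic z1 pos(1) circ L(1)] L(2) by simp
    then show ?thesis by (simp add: \<Phi>_def)
  qed
  finally show ?thesis by (simp add: E_def mult.assoc)
qed

end


section \<open>Cauchy's perimeter formula\<close>

lemma integral_periodic_shift:
  fixes F :: "real \<Rightarrow> real"
  assumes cont: "continuous_on UNIV F" and per: "\<And>x. F (x + p) = F x" and "0 \<le> a" "a \<le> p"
  shows "integral {0..p} (\<lambda>x. F (x + a)) = integral {0..p} F"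
proof -
  have int: "F integrable_on {x..y}" for x y
    by (rule integrable_continuous_interval[OF continuous_on_subset[OF cont]]) simp
  have "integral {0..p} (\<lambda>x. F (x + a)) = integral {a..p + a} F"
    using integral_shift[of 0 a p F] continuous_on_subset[OF cont] by (simp add: o_def)
  also have "\<dots> = integral {a..p} F + integral {p..p + a} F"
    using Henstock_Kurzweil_Integration.integral_combine[OF _ _ int, of a p "p + a"] assms by simp
  also have "integral {p..p + a} F = integral {0..a} (\<lambda>x. F (x + p))"
    using integral_shift[of 0 p a F] continuous_on_subset[OF cont] by (simp add: o_def add.commute)
  also have "\<dots> = integral {0..a} F" by (simp add: per)
  also have "integral {a..p} F + integral {0..a} F = integral {0..p} F"
    using Henstock_Kurzweil_Integration.integral_combine[OF _ _ int, of 0 a p] assms by simp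
  finally show ?thesis .
qed

text \<open>The dilated function runs through \<open>q\<close> periods at \<open>q\<close> times the
  speed. This removes the factor \<open>q\<close> from the argument in \<open>supp\<close>.\<close>

lemma integral_periodic_dilate:
  fixes F :: "real \<Rightarrow> real"
  assumes cont: "continuous_on UNIV F" and per: "\<And>x. F (x + p) = F x" and "0 \<le> p" "1 \<le> q"
  shows "integral {0..p} (\<lambda>x. F (real q * x)) = integral {0..p} F"
proof -
  have int: "F integrable_on {x..y}" for x y
    by (rule integrable_continuous_interval[OF continuous_on_subset[OF cont]]) simp
  have mult: "F (x + real n * p) = F x" for x n
  proof (induction n)
    case (Suc n)
    have "F (x + real (Suc n) * p) = F ((x + real n * p) + p)" by (simp add: algebra_simps)
    then show ?case using per Suc by simp
  qed simp
  have "integral {0..real n * p} F = real n * integral {0..p} F" for n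
  proof (induction n)
    case (Suc n)
    have "integral {0..real (Suc n) * p} F = integral {0..real n * p} F + integral {real n * p..real (Suc n) * p} F"
      by (rule Henstock_Kurzweil_Integration.integral_combine[OF _ _ int, symmetric])
         (use \<open>0 \<le> p\<close> in \<open>auto intro: mult_right_mono\<close>)
    also have "integral {real n * p..real (Suc n) * p} F = integral {0..p} (\<lambda>x. F (x + real n * p))"
      using integral_shift[of 0 "real n * p" p F] continuous_on_subset[OF cont]
      by (simp add: o_def algebra_simps)
    also have "\<dots> = integral {0..p} F" by (simp add: mult)
    finally show ?case using Suc by (simp add: algebra_simps)
  qed simp
  then have "(F has_integral (real q * integral {0..p} F)) {0..real q * p}"
    using int integrable_integral by metis
  from has_integral_stretch_real[OF this, of "real q"] \<open>1 \<le> q\<close>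
  have "((\<lambda>x. F (real q * x)) has_integral integral {0..p} F) ((\<lambda>x. x / real q) ` {0..real q * p})"
    by simp
  also have "(\<lambda>x. x / real q) ` {0..real q * p} = {0..p}"
    using \<open>1 \<le> q\<close> by simp
  finally show ?thesis by (rule integral_unique)
qed

lemma integral_abs_cos: "integral {0..2 * pi} (\<lambda>x. \<bar>cos x\<bar>) = 4"
proof -
  have sin: "((\<lambda>x. cos x) has_integral (sin b - sin a)) {a..b}" if "a \<le> b" for a b :: real
    by (rule fundamental_theorem_of_calculus[OF that])
       (auto intro!: derivative_eq_intros simp flip: has_real_derivative_iff_has_vector_derivative)
  have 1: "((\<lambda>x. \<bar>cos x\<bar>) has_integral 1) {0..pi / 2}"
  proof -
    have "((\<lambda>x. cos x) has_integral 1) {0..pi / 2}" using sin[of 0 "pi / 2"] by simp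
    then show ?thesis by (rule has_integral_eq[rotated]) (auto simp: cos_ge_zero)
  qed
  have s3: "sin (3 * pi / 2) = - 1"
    using sin_3over2_pi by (simp only: times_divide_eq_left)
  have neg: "cos x \<le> 0" if "pi / 2 \<le> x" "x \<le> 3 * pi / 2" for x
    using cos_ge_zero[of "x - pi"] that by simp
  have 2: "((\<lambda>x. \<bar>cos x\<bar>) has_integral 2) {pi / 2..3 * pi / 2}"
  proof -
    have "((\<lambda>x. - cos x) has_integral - (sin (3 * pi / 2) - sin (pi / 2))) {pi / 2..3 * pi / 2}"
      by (intro has_integral_neg sin) simp
    then have "((\<lambda>x. - cos x) has_integral 2) {pi / 2..3 * pi / 2}" by (simp add: s3)
    then show ?thesis by (rule has_integral_eq[rotated]) (use neg in auto)
  qed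
  have 3: "((\<lambda>x. \<bar>cos x\<bar>) has_integral 1) {3 * pi / 2..2 * pi}"
  proof -
    have "((\<lambda>x. cos x) has_integral 1) {3 * pi / 2..2 * pi}"
      using sin[of "3 * pi / 2" "2 * pi"] by (simp add: s3)
    moreover have "0 \<le> cos x" if "3 * pi / 2 \<le> x" "x \<le> 2 * pi" for x
      using cos_ge_zero[of "x - 2 * pi"] that by (simp add: cos_diff)
    ultimately show ?thesis by (rule_tac has_integral_eq[rotated]) auto
  qed
  have "((\<lambda>x. \<bar>cos x\<bar>) has_integral (1 + 2)) {0..3 * pi / 2}"
    using 1 2 by (rule has_integral_combine[rotated 2]) auto
  then have "((\<lambda>x. \<bar>cos x\<bar>) has_integral (1 + 2 + 1)) {0..2 * pi}"
    using 3 by (rule has_integral_combine[rotated 2]) auto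
  then show ?thesis by (simp add: integral_unique)
qed

lemma inner_cis: "c \<bullet> cis \<theta> = Re (cnj c * cis \<theta>)"
  by (simp add: inner_complex_def)

text \<open>In polar form the inner product is \<open>norm c\<close> times a shifted cosine. This is
  the contribution of one edge to Cauchy's formula.\<close>

lemma integral_abs_inner_cis: "integral {0..2 * pi} (\<lambda>\<theta>. \<bar>c \<bullet> cis \<theta>\<bar>) = 4 * norm c"
proof -
  define \<phi> where "\<phi> = Arg2pi (cnj c)"
  have c: "cnj c = of_real (norm c) * cis \<phi>"
    using Arg2pi_eq[of "cnj c"] by (simp add: \<phi>_def cis_conv_exp)
  have "c \<bullet> cis \<theta> = norm c * cos (\<theta> + \<phi>)" for \<theta>
    unfolding inner_cis c mult.assoc cis_mult by (simp add: add.commute)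
  then have "integral {0..2 * pi} (\<lambda>\<theta>. \<bar>c \<bullet> cis \<theta>\<bar>) = norm c * integral {0..2 * pi} (\<lambda>\<theta>. \<bar>cos (\<theta> + \<phi>)\<bar>)"
    by (simp add: abs_mult)
  also have "integral {0..2 * pi} (\<lambda>\<theta>. \<bar>cos (\<theta> + \<phi>)\<bar>) = integral {0..2 * pi} (\<lambda>\<theta>. \<bar>cos \<theta>\<bar>)"
    using Arg2pi[of "cnj c"] by (intro integral_periodic_shift) (auto simp: \<phi>_def intro!: continuous_intros)
  finally show ?thesis by (simp add: integral_abs_cos)
qed

section \<open>Segments, lines and edges of polygons in the plane\<close>

lemma diameter_closed_segment: "diameter (closed_segment a b) = dist a (b::complex)"
proof (rule antisym)
  show "diameter (closed_segment a b) \<le> dist a b"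
  proof (rule diameter_le)
    fix x y assume "x \<in> closed_segment a b" "y \<in> closed_segment a b"
    then show "norm (x - y) \<le> dist a b"
      using segment_furthest_le[of y a b x] dist_in_closed_segment[of x a b] by (auto simp: dist_norm)
  qed simp
  show "dist a b \<le> diameter (closed_segment a b)"
    by (intro diameter_bounded_bound bounded_closed_segment) auto
qed

lemma collinear_hyperplane:
  assumes "u \<noteq> (0::complex)"
  shows "collinear {x. x \<bullet> u = t}"
proof -
  have "\<exists>c. x - y = c *\<^sub>R (\<i> * u)" if "x \<bullet> u = t" "y \<bullet> u = t" for x y
  proof -
    have "(x - y) \<bullet> u = 0" using that by (simp add: inner_diff_left)
    then have perp: "Re (x - y) * Re u + Im (x - y) * Im u = 0" by (simp add: inner_complex_def)
    have n: "(Re u)\<^sup>2 + (Im u)\<^sup>2 \<noteq> 0"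
      using assms by (simp add: complex_eq_iff sum_power2_eq_zero_iff)
    \<comment> \<open>The coordinate of \<open>x - y\<close> along \<open>\<i> * u\<close>, the
      direction orthogonal to \<open>u\<close>.\<close>
    define c where "c = (Im (x - y) * Re u - Re (x - y) * Im u) / ((Re u)\<^sup>2 + (Im u)\<^sup>2)"
    have "Re (x - y) * ((Re u)\<^sup>2 + (Im u)\<^sup>2) = - (Im (x - y) * Re u - Re (x - y) * Im u) * Im u"
      using perp by algebra
    moreover have "Im (x - y) * ((Re u)\<^sup>2 + (Im u)\<^sup>2) = (Im (x - y) * Re u - Re (x - y) * Im u) * Re u"
      using perp by algebra
    ultimately have "x - y = c *\<^sub>R (\<i> * u)"
      using n by (simp add: complex_eq_iff c_def field_simps)
    then show ?thesis by blast
  qed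
  then show ?thesis unfolding collinear_def by (intro exI[of _ "\<i> * u"]) auto
qed


text \<open>The line runs through the interior of \<open>S\<close>, so it cuts out a nondegenerate
  segment whose inner points are interior and whose two end points lie on edges. An end point on two
  edges would be a vertex, which \<open>t\<close> excludes; an edge through both end points would
  contain their midpoint, an interior point.\<close>

lemma line_meets_two_edges:
  fixes S :: "complex set"
  assumes S: "S = convex hull V" "finite V" "aff_dim S = 2" and u: "u \<noteq> 0"
    and v: "v1 \<in> V" "v2 \<in> V" "v1 \<bullet> u < t" "t < v2 \<bullet> u" and t: "t \<notin> (\<lambda>v. v \<bullet> u) ` V"
  shows "card {E. E edge_of S \<and> t \<in> (\<lambda>x. x \<bullet> u) ` E} = 2"
proof -
  define l where "l = {x. x \<bullet> u = t}"
  have l_eq: "l = {x. u \<bullet> x = t}" by (auto simp: l_def inner_commute)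
  have aff_l: "affine l" unfolding l_eq by (rule affine_hyperplane)
  have cl_l: "closed l" unfolding l_eq by (rule closed_hyperplane)
  have convS: "convex S" unfolding S(1) by simp
  have compS: "compact S" unfolding S(1) using S(2) by (intro compact_convex_hull finite_imp_compact)
  have polyS: "polytope S" unfolding S(1) using S(2) by (rule polytope_convex_hull)
  have int: "rel_interior S = interior S" using S(3) by (intro interior_rel_interior) simp
  have VS: "V \<subseteq> S" unfolding S(1) by (rule hull_subset)
  have "rel_interior S \<noteq> {}" using S(3) rel_interior_eq_empty[OF convS] by auto
  then obtain x0 where x0: "x0 \<in> interior S" using int by blast
  \<comment> \<open>If \<open>x0\<close> is not on the line, then \<open>v1\<close> or
    \<open>v2\<close> lies on the other side, and the open segment from \<open>x0\<close> to that
    point stays in the interior.\<close>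
  have cross: "\<exists>x\<in>interior S. x \<in> l" if vv: "x0 \<bullet> u < t \<and> t < vv \<bullet> u \<or> vv \<bullet> u < t \<and> t < x0 \<bullet> u" "vv \<in> V" for vv
  proof -
    define s where "s = (t - x0 \<bullet> u) / (vv \<bullet> u - x0 \<bullet> u)"
    have s: "0 < s" "s < 1" using vv(1) by (auto simp: s_def divide_simps)
    define x where "x = (1 - s) *\<^sub>R x0 + s *\<^sub>R vv"
    have "x0 \<noteq> vv" using vv by auto
    then have "x \<in> open_segment x0 vv" using s unfolding x_def in_segment by auto
    then have "x \<in> interior S"
      using in_interior_closure_convex_segment[OF convS x0, of vv] VS vv(2) closure_subset[of S] by blast
    moreover have "s * (vv \<bullet> u - x0 \<bullet> u) = t - x0 \<bullet> u" using vv(1) by (auto simp: s_def)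
    then have "x \<bullet> u = t" by (simp add: x_def inner_add_left algebra_simps)
    ultimately show ?thesis by (auto simp: l_def)
  qed
  obtain x1 where x1: "x1 \<in> interior S" "x1 \<in> l"
  proof (cases "x0 \<bullet> u = t")
    case True
    then show ?thesis using that x0 by (auto simp: l_def)
  next
    case False
    then show ?thesis using cross[of v1] cross[of v2] v that by (meson linorder_neqE_linordered_idom)
  qed
  have ne: "S \<inter> l \<noteq> {}" using x1 interior_subset[of S] by blast
  have coll: "collinear (S \<inter> l)"
    using collinear_subset[OF collinear_hyperplane[OF u, of t]] by (simp add: l_def)
  obtain p p' where seg: "S \<inter> l = closed_segment p p'"
    by (rule compact_convex_collinear_segment[OF ne compact_Int_closed[OF compS cl_l]
      convex_Int[OF convS affine_imp_convex[OF aff_l]] coll])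
  have int_l: "interior S \<inter> l = rel_interior (closed_segment p p')"
    using convex_affine_rel_interior_Int[OF convS aff_l] x1 int seg by auto
  have pp: "p \<noteq> p'"
  proof
    assume "p = p'"
    then have single: "S \<inter> l = {x1}" using seg x1 interior_subset[of S] by auto
    obtain e where e: "0 < e" "ball x1 e \<subseteq> S" using x1(1) unfolding mem_interior by blast
    \<comment> \<open>A step along the line, short enough to stay in \<open>S\<close>, leads to a
      second common point.\<close>
    define y where "y = x1 + of_real (e / (2 * norm u)) * (\<i> * u)"
    have "dist x1 y = e / 2" using u e by (simp add: y_def dist_norm norm_mult norm_divide)
    then have "y \<in> S" using e by auto
    moreover have "(of_real (e / (2 * norm u)) * (\<i> * u)) \<bullet> u = 0" by (simp add: inner_complex_def)
    then have "y \<in> l" using x1(2) by (simp add: y_def l_def inner_add_left)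
    ultimately have "y = x1" using single by blast
    then show False using \<open>dist x1 y = e / 2\<close> e by simp
  qed
  have bd: "S - interior S = \<Union> {F. F facet_of S}"
    using rel_boundary_of_polyhedron[OF polytope_imp_polyhedron[OF polyS]] int by simp
  have facet_edge: "F facet_of S \<longleftrightarrow> F edge_of S" for F
    using S(3) by (auto simp: facet_of_def edge_of_def)
  have bd_l: "(S - interior S) \<inter> l = {p, p'}"
  proof -
    have "(S - interior S) \<inter> l = closed_segment p p' - open_segment p p'"
      using seg int_l pp by (auto simp: rel_interior_closed_segment)
    then show ?thesis by (auto simp: open_segment_def)
  qed
  have edge_bd: "E \<subseteq> S - interior S" if "E edge_of S" for E using bd that facet_edge by blast
  have not_both: "\<not> (p \<in> E \<and> p' \<in> E)" if E: "E edge_of S" for E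
  proof
    assume "p \<in> E \<and> p' \<in> E"
    moreover have "convex E" using E by (auto simp: edge_of_def face_of_imp_convex)
    ultimately have "midpoint p p' \<in> E"
      using closed_segment_subset[of p E p'] midpoint_in_closed_segment by blast
    moreover have "midpoint p p' \<in> interior S"
      using int_l pp by (auto simp: rel_interior_closed_segment)
    ultimately show False using edge_bd[OF E] by blast
  qed
  have unique: "E1 = E2" if E: "E1 edge_of S" "E2 edge_of S" "x \<in> E1" "x \<in> E2" and xl: "x \<in> l" for E1 E2 x
  proof (rule ccontr)
    assume ne: "E1 \<noteq> E2"
    have f: "E1 face_of S" "E2 face_of S" "aff_dim E1 = 1" "aff_dim E2 = 1" using E by (auto simp: edge_of_def)
    have I: "(E1 \<inter> E2) face_of S" using f by (intro face_of_Int)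
    \<comment> \<open>Either the intersection is a proper face of \<open>E1\<close>, or
      \<open>E1\<close> is a proper face of \<open>E2\<close>; proper faces have smaller
      dimension.\<close>
    have "aff_dim (E1 \<inter> E2) < 1"
    proof (cases "E1 \<inter> E2 = E1")
      case True
      then have "E1 \<subseteq> E2" "E1 \<noteq> E2" using ne by auto
      then have "E1 face_of E2" using face_of_subset[OF f(1)] face_of_imp_subset[OF f(2)] by blast
      then have "aff_dim E1 < aff_dim E2"
        using face_of_aff_dim_lt[OF face_of_imp_convex[OF f(2)]] ne by blast
      then show ?thesis using f by simp
    next
      case False
      have "(E1 \<inter> E2) face_of E1"
        using face_of_subset[OF I] face_of_imp_subset[OF f(1)] by auto
      then show ?thesis using face_of_aff_dim_lt[OF face_of_imp_convex[OF f(1)] _ False] f(3) by simp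
    qed
    moreover have "E1 \<inter> E2 \<noteq> {}" using E by blast
    ultimately have "aff_dim (E1 \<inter> E2) = 0" 
      using aff_dim_geq[of "E1 \<inter> E2"] aff_dim_empty[of "E1 \<inter> E2"] by linarith
    then obtain a where "E1 \<inter> E2 = {a}" using aff_dim_eq_0 by blast
    then have "{x} face_of S" using I E by auto
    then have "x extreme_point_of S" by (simp add: face_of_singleton)
    then have "x \<in> V" unfolding S(1) by (rule extreme_point_of_convex_hull)
    then show False using t xl by (auto simp: l_def)
  qed
  obtain E1 where E1: "E1 edge_of S" "p \<in> E1" using bd_l bd facet_edge by blast
  obtain E2 where E2: "E2 edge_of S" "p' \<in> E2" using bd_l bd facet_edge by blast
  have pl: "p \<in> l" "p' \<in> l" using bd_l by auto
  have "{E. E edge_of S \<and> t \<in> (\<lambda>x. x \<bullet> u) ` E} = {E1, E2}"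
  proof (intro equalityI subsetI)
    fix E assume "E \<in> {E. E edge_of S \<and> t \<in> (\<lambda>x. x \<bullet> u) ` E}"
    then obtain x where x: "E edge_of S" "x \<in> E" "x \<in> l" by (auto simp: l_def)
    then have "x = p \<or> x = p'" using edge_bd bd_l by blast
    then show "E \<in> {E1, E2}" using unique[OF x(1) E1(1) x(2) _ x(3)] unique[OF x(1) E2(1) x(2) _ x(3)] E1 E2 by auto
  next
    fix E assume "E \<in> {E1, E2}"
    then show "E \<in> {E. E edge_of S \<and> t \<in> (\<lambda>x. x \<bullet> u) ` E}" 
      using E1 E2 pl imageI[of p E1 "\<lambda>x. x \<bullet> u"] imageI[of p' E2 "\<lambda>x. x \<bullet> u"] unfolding l_def by auto
  qed
  moreover have "E1 \<noteq> E2" using not_both E1 E2 by blast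
  ultimately show ?thesis by simp
qed

lemma image_inner_closed_segment:
  "(\<lambda>x. x \<bullet> u) ` closed_segment a b = closed_segment (a \<bullet> u) (b \<bullet> u)"
  by (rule closed_segment_linear_image[symmetric]) (simp add: bounded_linear.linear bounded_linear_inner_left)

lemma has_integral_indicator_segment:
  fixes a b :: real
  assumes "closed_segment a b \<subseteq> T"
  shows "((\<lambda>t. if t \<in> closed_segment a b then 1 else 0) has_integral \<bar>a - b\<bar>) T"
proof -
  have "((\<lambda>_. 1 :: real) has_integral \<bar>a - b\<bar>) (closed_segment a b)"
    using has_integral_const_real[of "1 :: real" a b] has_integral_const_real[of "1 :: real" b a]
    by (cases "a \<le> b") (auto simp: closed_segment_eq_real_ivl)
  then show ?thesis using assms by simp
qed

text \<open>The number of edges whose projection contains \<open>t\<close> is integrated in two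
  ways. Each edge contributes the length of its projection; on the other hand the number is 2 for
  all \<open>t\<close> between the extremes except the finitely many projections of points of
  \<open>V\<close>.\<close>

lemma sum_projected_edges:
  fixes S :: "complex set"
  assumes S: "S = convex hull V" "finite V" "aff_dim S = 2" and u: "u \<noteq> 0"
    and ends: "\<And>E. E edge_of S \<Longrightarrow> E = closed_segment (a E) (b E)"
  shows "(\<Sum>E | E edge_of S. \<bar>(a E - b E) \<bullet> u\<bar>) = 2 * (Max ((\<lambda>v. v \<bullet> u) ` V) - Min ((\<lambda>v. v \<bullet> u) ` V))"
proof -
  define M where "M = Max ((\<lambda>v. v \<bullet> u) ` V)"
  define m where "m = Min ((\<lambda>v. v \<bullet> u) ` V)"
  have "V \<noteq> {}" using S(1,3) by auto
  then have "M \<in> (\<lambda>v. v \<bullet> u) ` V" "m \<in> (\<lambda>v. v \<bullet> u) ` V"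
    unfolding M_def m_def using S(2) by (intro Max_in Min_in; simp)+
  then obtain v1 v2 where v: "v1 \<in> V" "v1 \<bullet> u = m" "v2 \<in> V" "v2 \<bullet> u = M" by auto
  have le: "m \<le> v \<bullet> u" "v \<bullet> u \<le> M" if "v \<in> V" for v
    using that S(2) unfolding M_def m_def by auto
  have mM: "m \<le> M" using le[OF v(1)] v by simp
  have range: "m \<le> x \<bullet> u \<and> x \<bullet> u \<le> M" if "x \<in> S" for x
  proof -
    have "S \<subseteq> {x. u \<bullet> x \<le> M} \<inter> {x. u \<bullet> x \<ge> m}"
      unfolding S(1) using le
      by (intro hull_minimal convex_Int convex_halfspace_le convex_halfspace_ge) (auto simp: inner_commute)
    then show ?thesis using that by (auto simp: inner_commute)
  qed
  have fin: "finite {E. E edge_of S}"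
    by (rule rev_finite_subset[OF finite_polytope_faces[of S]])
       (use S(1) polytope_convex_hull[OF S(2)] in \<open>auto simp: edge_of_def\<close>)
  have sub: "(\<lambda>x. x \<bullet> u) ` E \<subseteq> {m..M}" if "E edge_of S" for E
    using range edge_of_imp_subset[OF that] by auto
  have "((\<lambda>t. if t \<in> (\<lambda>x. x \<bullet> u) ` E then 1 else 0) has_integral \<bar>(a E - b E) \<bullet> u\<bar>) {m..M}"
    if E: "E edge_of S" for E
  proof -
    have img: "(\<lambda>x. x \<bullet> u) ` E = closed_segment (a E \<bullet> u) (b E \<bullet> u)"
      by (subst ends[OF E]) (rule image_inner_closed_segment)
    show ?thesis
      using has_integral_indicator_segment[of "a E \<bullet> u" "b E \<bullet> u" "{m..M}"] sub[OF E]
      unfolding img by (simp only: inner_diff_left)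
  qed
  then have "((\<lambda>t. \<Sum>E | E edge_of S. if t \<in> (\<lambda>x. x \<bullet> u) ` E then 1 else 0) has_integral
      (\<Sum>E | E edge_of S. \<bar>(a E - b E) \<bullet> u\<bar>)) {m..M}"
    by (intro has_integral_sum fin) simp
  moreover have "((\<lambda>t. \<Sum>E | E edge_of S. if t \<in> (\<lambda>x. x \<bullet> u) ` E then 1 else 0) has_integral (2 * (M - m))) {m..M}"
  proof (rule has_integral_spike_finite[of "(\<lambda>v. v \<bullet> u) ` V" _ _ "\<lambda>_. 2 :: real"])
    show "finite ((\<lambda>v. v \<bullet> u) ` V)" using S(2) by simp
    show "((\<lambda>_. 2 :: real) has_integral 2 * (M - m)) {m..M}"
      using has_integral_const_real[of "2 :: real" m M] mM by (simp add: algebra_simps)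
    fix t assume t: "t \<in> {m..M} - (\<lambda>v. v \<bullet> u) ` V"
    then have "t \<noteq> m" "t \<noteq> M" using v by auto
    then have "v1 \<bullet> u < t" "t < v2 \<bullet> u" using t v by auto
    then have card: "card {E. E edge_of S \<and> t \<in> (\<lambda>x. x \<bullet> u) ` E} = 2"
      using line_meets_two_edges[OF S u v(1,3)] t by blast
    have "(\<Sum>E | E edge_of S. if t \<in> (\<lambda>x. x \<bullet> u) ` E then 1 else 0 :: real)
        = (\<Sum>E\<in>{E \<in> {E. E edge_of S}. t \<in> (\<lambda>x. x \<bullet> u) ` E}. 1)"
      by (rule sum.inter_filter[OF fin, symmetric])
    also have "\<dots> = 2" using card by simp
    finally show "(\<Sum>E | E edge_of S. if t \<in> (\<lambda>x. x \<bullet> u) ` E then 1 else 0 :: real) = 2" .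
  qed
  ultimately show ?thesis unfolding M_def m_def by (rule has_integral_unique)
qed

text \<open>Cauchy's formula through the width \<open>h \<theta> + h (\<theta> + pi)\<close>, whose
  integral is twice that of \<open>h\<close>. The width is half the sum of the projected edges, and
  the projections of an edge integrate to 4 times its length.\<close>

lemma integral_support_eq_circumference:
  fixes V :: "complex set"
  assumes V: "finite V" "V \<noteq> {}"
  shows "integral {0..2 * pi} (\<lambda>\<theta>. Max ((\<lambda>v. v \<bullet> cis \<theta>) ` V)) = circumference (convex hull V)"
proof -
  define S where "S = convex hull V"
  define h where "h = (\<lambda>\<theta>. Max ((\<lambda>v. v \<bullet> cis \<theta>) ` V))"
  have cont: "continuous_on A h" for A
    unfolding h_def using V by (intro continuous_on_Max_image continuous_intros) auto
  have int: "h integrable_on {x..y}" for x y by (rule integrable_continuous_interval[OF cont])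
  have int': "(\<lambda>\<theta>. h (\<theta> + pi)) integrable_on {x..y}" for x y
    by (intro integrable_continuous_interval continuous_on_compose2[OF cont[of UNIV]] continuous_intros) auto
  have per: "h (\<theta> + 2 * pi) = h \<theta>" for \<theta>
    by (simp add: h_def cis_mult[symmetric])
  have opp: "h (\<theta> + pi) = - Min ((\<lambda>v. v \<bullet> cis \<theta>) ` V)" for \<theta>
  proof -
    have "cis (\<theta> + pi) = - cis \<theta>" by (simp add: cis_mult[symmetric])
    then have "h (\<theta> + pi) = Max (uminus ` ((\<lambda>v. v \<bullet> cis \<theta>) ` V))" by (simp add: h_def image_image)
    also have "\<dots> = - Min ((\<lambda>v. v \<bullet> cis \<theta>) ` V)" using V by (simp add: minus_Min_eq_Max)
    finally show ?thesis .
  qed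
  have two_h: "2 * integral {0..2 * pi} h = integral {0..2 * pi} (\<lambda>\<theta>. h \<theta> + h (\<theta> + pi))"
  proof -
    have "integral {0..2 * pi} (\<lambda>\<theta>. h (\<theta> + pi)) = integral {0..2 * pi} h"
      by (rule integral_periodic_shift[OF cont per]) auto
    then show ?thesis using integral_add[OF int int'] by simp
  qed
  have abs_int: "(\<lambda>\<theta>. \<bar>c \<bullet> cis \<theta>\<bar>) integrable_on {0..2 * pi}" for c
    by (intro integrable_continuous_interval continuous_intros)
  have compS: "compact S" "convex S" "S \<noteq> {}"
    unfolding S_def using V by (simp_all add: compact_convex_hull finite_imp_compact)
  show ?thesis
  proof (cases "aff_dim S = 2")
    case True
    have fin: "finite {E. E edge_of S}"
      by (rule rev_finite_subset[OF finite_polytope_faces[of S]])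
         (use polytope_convex_hull[OF V(1)] in \<open>auto simp: edge_of_def S_def\<close>)
    have "\<exists>a b. E = closed_segment a b" if E: "E edge_of S" for E
    proof -
      have f: "E face_of S" "aff_dim E = 1" using E by (auto simp: edge_of_def)
      then have "E \<noteq> {}" by auto
      moreover have "compact E" "convex E" "collinear E"
        using f compS face_of_imp_compact face_of_imp_convex by (auto simp: collinear_aff_dim)
      ultimately show ?thesis using compact_convex_collinear_segment by metis
    qed
    then obtain a b where ends: "\<And>E. E edge_of S \<Longrightarrow> E = closed_segment (a E) (b E)" by metis
    have "h \<theta> + h (\<theta> + pi) = (\<Sum>E | E edge_of S. \<bar>(a E - b E) \<bullet> cis \<theta>\<bar> / 2)" for \<theta>
      using sum_projected_edges[OF S_def V(1) True _ ends, of "cis \<theta>"]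
      unfolding opp sum_divide_distrib[symmetric] by (simp add: h_def)
    then have "2 * integral {0..2 * pi} h = (\<Sum>E | E edge_of S. integral {0..2 * pi} (\<lambda>\<theta>. \<bar>(a E - b E) \<bullet> cis \<theta>\<bar> / 2))"
      unfolding two_h using fin abs_int by (simp add: integral_sum integrable_on_divide)
    also have "\<dots> = (\<Sum>E | E edge_of S. 2 * diameter E)"
    proof (rule sum.cong)
      fix E assume "E \<in> {E. E edge_of S}"
      then have "diameter E = norm (a E - b E)"
        using ends[of E] diameter_closed_segment[of "a E" "b E"] by (simp add: dist_norm)
      then show "integral {0..2 * pi} (\<lambda>\<theta>. \<bar>(a E - b E) \<bullet> cis \<theta>\<bar> / 2) = 2 * diameter E"
        using integral_abs_inner_cis[of "a E - b E"] by simp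
    qed simp
    also have "\<dots> = 2 * circumference S" using True by (simp add: circumference_def sum_distrib_left)
    finally show ?thesis by (simp add: h_def S_def)
  next
    case False
    then have "aff_dim S \<le> 1" using aff_dim_le_DIM[of S] by simp
    then obtain a b where ab: "S = closed_segment a b"
      using compact_convex_collinear_segment[of S] compS collinear_aff_dim by metis
    \<comment> \<open>The width of a segment is its whole projection, not half of it; hence twice
      the length.\<close>
    have "h \<theta> + h (\<theta> + pi) = \<bar>(a - b) \<bullet> cis \<theta>\<bar>" for \<theta>
    proof -
      have VS: "V \<subseteq> S" unfolding S_def by (rule hull_subset)
      have half: "x \<bullet> cis \<phi> \<le> h \<phi>" if "x \<in> S" for x \<phi>
      proof -
        have "S \<subseteq> {x. cis \<phi> \<bullet> x \<le> h \<phi>}"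
          unfolding S_def using V by (intro hull_minimal convex_halfspace_le) (auto simp: h_def inner_commute)
        then show ?thesis using that by (auto simp: inner_commute)
      qed
      have h_eq: "h \<phi> = max (a \<bullet> cis \<phi>) (b \<bullet> cis \<phi>)" for \<phi>
      proof (rule antisym)
        have "h \<phi> \<in> (\<lambda>v. v \<bullet> cis \<phi>) ` V" unfolding h_def using V by (intro Max_in) auto
        then obtain x where x: "x \<in> S" "h \<phi> = x \<bullet> cis \<phi>" using VS by blast
        then have "h \<phi> \<in> closed_segment (a \<bullet> cis \<phi>) (b \<bullet> cis \<phi>)"
          unfolding image_inner_closed_segment[symmetric] ab by blast
        then show "h \<phi> \<le> max (a \<bullet> cis \<phi>) (b \<bullet> cis \<phi>)"
          by (auto simp: closed_segment_eq_real_ivl max_def split: if_splits)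
        show "max (a \<bullet> cis \<phi>) (b \<bullet> cis \<phi>) \<le> h \<phi>" using half ab by simp
      qed
      have "cis (\<theta> + pi) = - cis \<theta>" by (simp add: cis_mult[symmetric])
      then show ?thesis unfolding h_eq by (simp add: inner_diff_left max_def)
    qed
    then have "2 * integral {0..2 * pi} h = 4 * norm (a - b)"
      unfolding two_h by (simp add: integral_abs_inner_cis)
    then show ?thesis
      using False ab diameter_closed_segment[of a b]
      by (simp add: circumference_def h_def S_def dist_norm)
  qed
qed


section \<open>Choice of the radii and the asymptotics\<close>

text \<open>The intervals of radius \<open>d\<close> around the points of \<open>X\<close> have
  total length less than \<eta>, and \<open>Y\<close> is a null set, so together they cannot cover
  the interval.\<close>

lemma avoid_small_intervals:
  fixes X Y :: "real set"
  assumes "finite X" "finite Y" "0 < d" "2 * d * real (card X) < \<eta>"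
  shows "\<exists>\<rho>\<in>{x..x + \<eta>}. \<rho> \<notin> Y \<and> (\<forall>a\<in>X. d \<le> \<bar>\<rho> - a\<bar>)"
proof (rule ccontr)
  assume no: "\<not> ?thesis"
  have \<eta>: "0 \<le> \<eta>" using assms(3,4) by (smt (verit) mult_nonneg_nonneg of_nat_0_le_iff)
  have cover: "{x..x + \<eta>} \<subseteq> (\<Union>a\<in>X. {a - d..a + d}) \<union> Y"
  proof
    fix \<rho> assume "\<rho> \<in> {x..x + \<eta>}"
    then have "\<rho> \<in> Y \<or> (\<exists>a\<in>X. \<bar>\<rho> - a\<bar> < d)" using no by (meson not_le)
    then show "\<rho> \<in> (\<Union>a\<in>X. {a - d..a + d}) \<union> Y" by (auto simp: abs_less_iff) (smt (verit))
  qed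
  have meas: "(\<Union>a\<in>X. {a - d..a + d}) \<in> sets lborel" "Y \<in> sets lborel"
    using assms(1,2) by (auto intro: sets.finite_UN borel_closed finite_imp_closed)
  have "emeasure lborel {x..x + \<eta>} \<le> emeasure lborel ((\<Union>a\<in>X. {a - d..a + d}) \<union> Y)"
    using meas by (intro emeasure_mono cover) auto
  also have "\<dots> \<le> emeasure lborel (\<Union>a\<in>X. {a - d..a + d}) + emeasure lborel Y"
    using meas by (intro emeasure_subadditive) auto
  also have "emeasure lborel Y = 0" using assms(2) by (intro emeasure_lborel_countable countable_finite)
  also have "emeasure lborel (\<Union>a\<in>X. {a - d..a + d}) \<le> (\<Sum>a\<in>X. emeasure lborel {a - d..a + d})"
    using assms(1) by (intro emeasure_subadditive_finite) auto
  also have "(\<Sum>a\<in>X. emeasure lborel {a - d..a + d}) = (\<Sum>a\<in>X. ennreal (2 * d))"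
    using assms(3) by (intro sum.cong) auto
  also have "\<dots> = ennreal (2 * d * real (card X))"
    using assms(3) by (subst sum_ennreal) (auto simp: mult.commute)
  finally have "ennreal \<eta> \<le> ennreal (2 * d * real (card X))" using \<eta> by simp
  then show False using assms(3,4) by (simp add: ennreal_le_iff)
qed

lemma zero_count_mono:
  assumes "f holomorphic_on UNIV" "f z0 \<noteq> (0::complex)" "r \<le> t"
  shows "zero_count f r \<le> zero_count f t"
  unfolding zero_count_def
proof (rule sum_mono2)
  have "finite {z\<in>ball 0 t. f z = 0}" by (rule entire_finite_zeros[OF assms(1,2)]) simp
  then show "finite {z. norm z < t \<and> f z = 0}" by (simp add: ball_def dist_norm)
qed (use assms(3) entire_zorder(1)[OF assms(1,2)] in auto)

context exp_sum
begin

text \<open>A radius at distance at least \<open>1 / r ^ k\<close> from the moduli of the zeros of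
  the coefficients meets all requirements; the logarithm of \<open>r ^ k\<close> costs only another
  factor \<open>ln r\<close>. \<open>Y\<close> allows the zeros of \<open>f\<close> to be avoided as
  well.\<close>

lemma circle_exists:
  assumes nz: "\<And>j. j \<in> J \<Longrightarrow> \<exists>z. H j z \<noteq> 0" and gr: "\<And>j. j \<in> J \<Longrightarrow> exp_growth (q - p) (H j)"
    and p: "1 \<le> p" "p \<le> q"
  obtains U0 \<kappa>0 r0 where "0 < \<kappa>0" "\<And>r x Y. r0 \<le> r \<Longrightarrow> r / 2 \<le> x \<Longrightarrow> x \<le> r \<Longrightarrow> finite Y \<Longrightarrow>
    \<exists>\<rho>\<in>{x..x + r / r ^ p}. \<rho> \<notin> Y \<and>
      exp_sum_circle J w H q gap W \<rho> (\<kappa>0 * (r ^ (q - p) * (ln r)\<^sup>2) / r ^ q) (U0 * (r ^ (q - p) * (ln r)\<^sup>2))"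
proof -
  define s where "s = q - p"
  have "\<exists>K r0. 0 < K \<and> (\<forall>r\<ge>r0. \<exists>X. circle_control s (H j) K r X)" if j: "j \<in> J" for j
  proof -
    obtain z0 where z0: "H j z0 \<noteq> 0" using nz[OF j] by blast
    obtain K r0 where "0 < K" "\<And>r. r0 \<le> r \<Longrightarrow> \<exists>X. circle_control s (H j) K r X"
      using exp_growth_circle_control[OF hol[OF j] z0 gr[OF j]] unfolding s_def by blast
    then show ?thesis by blast
  qed
  then obtain Kj rj where Q: "\<And>j. j \<in> J \<Longrightarrow> 0 < Kj j \<and> (\<forall>r\<ge>rj j. \<exists>X. circle_control s (H j) (Kj j) r X)"
    by metis
  have "\<exists>C\<ge>0. \<forall>r\<ge>3. \<forall>z. norm z \<le> r \<longrightarrow> norm (H j z) \<le> exp (C * (r ^ s * ln r))" if "j \<in> J" for j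
    using gr[OF that] unfolding exp_growth_def s_def .
  then obtain Cj where Cj: "\<And>j. j \<in> J \<Longrightarrow> 0 \<le> Cj j"
    "\<And>j r z. j \<in> J \<Longrightarrow> 3 \<le> r \<Longrightarrow> norm z \<le> r \<Longrightarrow> norm (H j z) \<le> exp (Cj j * (r ^ s * ln r))"
    by metis
  define K where "K = (\<Sum>j\<in>J. Kj j)"
  define C where "C = (\<Sum>j\<in>J. Cj j)"
  define R0 where "R0 = Max (rj ` J)"
  have Kpos: "0 < Kj j" if "j \<in> J" for j using Q[OF that] by blast
  have K: "Kj j \<le> K" "Cj j \<le> C" "rj j \<le> R0" if "j \<in> J" for j
  proof -
    show "Kj j \<le> K" unfolding K_def
      by (rule member_le_sum[OF that _ finJ]) (use Kpos less_imp_le in auto)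
    show "Cj j \<le> C" unfolding C_def by (rule member_le_sum[OF that _ finJ]) (use Cj in auto)
    show "rj j \<le> R0" unfolding R0_def using that finJ by simp
  qed
  have K0: "0 < K" "0 \<le> C" using K(1) Kpos neJ Cj(1) K(2) by (meson all_not_in_conv less_le_trans order_trans)+
  \<comment> \<open>At most a multiple of \<open>r ^ Suc s\<close> moduli are to be avoided, so with
    \<open>d = 1 / r ^ k\<close> the excluded length is smaller than the window
    \<open>r / r ^ p\<close> by a factor of order \<open>1 / r\<^sup>2\<close>.\<close>
  define k where "k = p + s + 2"
  \<comment> \<open>In this order the summands serve the lower bound, where
    \<open>ln r + ln (1 / d) = (1 + k) * ln r\<close>, the growth up to
    \<open>2 * \<rho> \<le> 4 * r\<close>, and \<open>1 \<le> U\<close>.\<close>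
  define U0 where "U0 = K * (1 + real k) + 2 * C * 4 ^ s + 1"
  \<comment> \<open>The factor \<open>2 ^ q\<close> compensates for \<rho> being possibly as small
    as \<open>r / 2\<close>.\<close>
  define \<kappa>0 where "\<kappa>0 = 2 ^ q * (2 * U0 + ln (2 * n))"
  have U0: "1 \<le> U0" "K * (1 + real k) \<le> U0" "K \<le> U0" "2 * C * 4 ^ s \<le> U0"
    using K0 by (auto simp: U0_def distrib_left add_increasing)
  have \<kappa>0: "0 < \<kappa>0" using U0 n_ge_1 by (auto simp: \<kappa>0_def intro!: add_pos_nonneg mult_pos_pos)
  have Bq: "0 < real q * B"
    using q A_pos by (auto simp: B_def intro!: mult_pos_pos add_nonneg_pos)
  \<comment> \<open>As \<open>1 \<le> p\<close>, \<kappa> is at most a multiple of this quotient;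
    its decay yields \<open>small\<close>.\<close>
  have "((\<lambda>r::real. (ln r)\<^sup>2 / r) \<longlongrightarrow> 0) at_top" by real_asymp
  moreover have "0 < 1 / (real q * B * \<kappa>0)" using Bq \<kappa>0 by simp
  ultimately have "\<forall>\<^sub>F r in at_top. (ln r)\<^sup>2 / r < 1 / (real q * B * \<kappa>0)" by (rule order_tendstoD)
  then obtain r1 where r1: "\<And>r. r1 \<le> r \<Longrightarrow> (ln r)\<^sup>2 / r < 1 / (real q * B * \<kappa>0)"
    unfolding eventually_at_top_linorder by blast
  show ?thesis
  proof (rule that[OF \<kappa>0, of "max (max 4 R0) (max r1 (2 * n * K + 2))" U0], fold s_def)
    fix r x :: real and Y :: "real set"
    assume r: "max (max 4 R0) (max r1 (2 * n * K + 2)) \<le> r" and x: "r / 2 \<le> x" "x \<le> r" and Y: "finite Y"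
    have r': "4 \<le> r" "R0 \<le> r" "r1 \<le> r" "2 * n * K + 2 \<le> r" using r by auto
    define \<Lambda> where "\<Lambda> = r ^ s * (ln r)\<^sup>2"
    have ln1: "1 \<le> ln r" using r' by (intro one_le_ln) auto
    have u: "1 \<le> r ^ s * ln r" using r' by (intro one_le_power_ln) auto
    have u\<Lambda>: "r ^ s * ln r \<le> \<Lambda>"
      using mult_left_mono[OF ln1, of "r ^ s * ln r"] u by (simp add: \<Lambda>_def power2_eq_square mult.assoc)
    have \<Lambda>: "1 \<le> \<Lambda>" using u u\<Lambda> by simp
    define \<kappa> where "\<kappa> = \<kappa>0 * \<Lambda> / r ^ q"
    have "\<forall>j\<in>J. \<exists>X. circle_control s (H j) (Kj j) r X"
      using Q K(3) r'(2) order_trans by blast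
    then obtain X where X: "\<And>j. j \<in> J \<Longrightarrow> circle_control s (H j) (Kj j) r (X j)"
      using bchoice[of J "\<lambda>j. circle_control s (H j) (Kj j) r"] by blast
    define Z where "Z = (\<Union>j\<in>J. norm ` X j)"
    have finZ: "finite Z" unfolding Z_def using finJ circle_controlD(1)[OF X] by blast
    define d where "d = 1 / r ^ k"
    have d: "0 < d" "d \<le> 1" using r' by (auto simp: d_def)
    have cardZ: "real (card Z) \<le> n * K * r ^ Suc s"
    proof -
      have "card Z \<le> (\<Sum>j\<in>J. card (norm ` X j))" unfolding Z_def using finJ by (rule card_UN_le)
      also have "\<dots> \<le> (\<Sum>j\<in>J. card (X j))" using circle_controlD(1)[OF X] by (intro sum_mono card_image_le)
      finally have "real (card Z) \<le> (\<Sum>j\<in>J. real (card (X j)))" by (simp flip: of_nat_sum)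
      also have "\<dots> \<le> (\<Sum>j\<in>J. K * (r ^ s * ln r))"
      proof (rule sum_mono)
        fix j assume j: "j \<in> J"
        have "real (card (X j)) \<le> Kj j * (r ^ s * ln r)" by (rule circle_controlD(2)[OF X[OF j]])
        also have "\<dots> \<le> K * (r ^ s * ln r)" using K(1)[OF j] u by (intro mult_right_mono) auto
        finally show "real (card (X j)) \<le> K * (r ^ s * ln r)" .
      qed
      also have "\<dots> = n * K * (r ^ s * ln r)" by (simp add: n_def)
      also have "\<dots> \<le> n * K * (r ^ s * r)"
        using K0 n_ge_1 r' ln_le_minus_one[of r] by (intro mult_left_mono) auto
      finally show ?thesis by (simp add: mult.commute)
    qed
    have "2 * d * real (card Z) < r / r ^ p"
    proof -
      have rk: "r ^ k = r ^ p * r ^ Suc s * r" by (simp add: k_def power_add)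
      have "2 * d * real (card Z) \<le> 2 * d * (n * K * r ^ Suc s)" using cardZ d by (intro mult_left_mono) auto
      also have "\<dots> = (2 * n * K) / r / r ^ p" using r' unfolding d_def rk by (simp add: field_simps)
      also have "\<dots> < r / r ^ p"
      proof (rule divide_strict_right_mono)
        have "2 * n * K < 1 * r" using r'(4) by simp
        also have "1 * r \<le> r * r" using r' by (intro mult_right_mono) auto
        finally show "2 * n * K / r < r" using r' by (simp add: divide_less_eq)
      qed (use r' in auto)
      finally show ?thesis .
    qed
    from avoid_small_intervals[OF finZ Y d(1) this, of x]
    obtain \<rho> where \<rho>: "\<rho> \<in> {x..x + r / r ^ p}" "\<rho> \<notin> Y" "\<And>a. a \<in> Z \<Longrightarrow> d \<le> \<bar>\<rho> - a\<bar>" by blast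
    have rp: "r / r ^ p \<le> 1" using r' p by (simp add: divide_le_eq self_le_power)
    have "x \<le> \<rho>" "\<rho> \<le> x + r / r ^ p" using \<rho>(1) by auto
    then have "r / 2 \<le> \<rho> \<and> \<rho> \<le> 2 * r \<and> 0 < \<rho>" using rp x r'(1) by linarith
    then have \<rho>r: "r / 2 \<le> \<rho>" "\<rho> \<le> 2 * r" "0 < \<rho>" by auto
    have far: "\<forall>a\<in>X j. d \<le> \<bar>\<rho> - norm a\<bar>" if "j \<in> J" for j using \<rho>(3) that by (auto simp: Z_def)
    have lnd: "ln (1 / d) = real k * ln r" using r' by (simp add: d_def ln_realpow)
    have "exp_sum_circle J w H q gap W \<rho> \<kappa> (U0 * \<Lambda>)"
    proof unfold_locales
      show "0 < \<rho>" by (rule \<rho>r)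
      show "0 < \<kappa>" unfolding \<kappa>_def using \<kappa>0 \<Lambda> r' by simp
      show "1 \<le> U0 * \<Lambda>" using mult_mono[OF U0(1) \<Lambda>] U0(1) by simp
    next
      fix j and z :: complex assume j: "j \<in> J" and z: "norm z \<le> 2 * \<rho>"
      have "norm (H j z) \<le> exp (Cj j * ((4 * r) ^ s * ln (4 * r)))"
        using z \<rho>r r' by (intro Cj(2)[OF j]) auto
      also have "\<dots> \<le> exp (C * ((4 * r) ^ s * (2 * ln r)))"
        unfolding exp_le_cancel_iff using K(2)[OF j] K0 r' by (intro mult_mono ln_le_times_ln) auto
      also have "C * ((4 * r) ^ s * (2 * ln r)) = 2 * C * 4 ^ s * (r ^ s * ln r)" by (simp add: power_mult_distrib)
      also have "exp \<dots> \<le> exp (U0 * \<Lambda>)"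
        unfolding exp_le_cancel_iff using U0 u u\<Lambda> K0 by (intro mult_mono) auto
      finally show "norm (H j z) \<le> exp (U0 * \<Lambda>)" .
    next
      fix j and z :: complex assume j: "j \<in> J" and z: "norm z = \<rho>"
      have "Kj j * (r ^ s * ln r) * (ln r + ln (1 / d)) = Kj j * (1 + real k) * \<Lambda>"
        unfolding lnd \<Lambda>_def by (simp add: algebra_simps power2_eq_square)
      also have "\<dots> \<le> U0 * \<Lambda>"
      proof (rule mult_right_mono)
        have "Kj j * (1 + real k) \<le> K * (1 + real k)" by (rule mult_right_mono[OF K(1)[OF j]]) simp
        then show "Kj j * (1 + real k) \<le> U0" using U0(2) by (rule order_trans)
      qed (use \<Lambda> in simp)
      finally have "exp (- (U0 * \<Lambda>)) \<le> exp (- Kj j * (r ^ s * ln r) * (ln r + ln (1 / d)))"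
        by simp
      also have "\<dots> \<le> norm (H j z)" by (rule circle_controlD(3)[OF X[OF j] \<rho>r(3,2) d far[OF j] z])
      finally show "exp (- (U0 * \<Lambda>)) \<le> norm (H j z)" .
    next
      fix j and \<alpha> \<beta> :: real and L :: "real \<Rightarrow> complex"
      assume j: "j \<in> J" and a: "\<alpha> \<le> \<beta>" "\<beta> \<le> \<alpha> + 2 * pi" "continuous_on {\<alpha>..\<beta>} L"
        "\<And>\<theta>. \<theta> \<in> {\<alpha>..\<beta>} \<Longrightarrow> exp (L \<theta>) = H j (of_real \<rho> * cis \<theta>)"
      have "\<bar>Im (L \<beta> - L \<alpha>)\<bar> \<le> Kj j * (r ^ s * ln r)"
        by (rule circle_controlD(4)[OF X[OF j] \<rho>r(3,2) d far[OF j] a])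
      also have "\<dots> \<le> U0 * \<Lambda>" using K(1)[OF j] U0 u u\<Lambda> by (intro mult_mono) auto
      finally show "\<bar>Im (L \<beta> - L \<alpha>)\<bar> \<le> U0 * \<Lambda>" .
    next
      have ln2n: "0 \<le> ln (2 * n)" using n_ge_1 by simp
      have "2 * (U0 * \<Lambda>) + ln (2 * n) \<le> (2 * U0 + ln (2 * n)) * \<Lambda>"
        using mult_left_mono[OF \<Lambda> ln2n] by (simp add: distrib_right)
      also have "\<dots> = \<kappa> * (r / 2) ^ q" using r' by (simp add: \<kappa>_def \<kappa>0_def power_divide)
      also have "\<dots> \<le> \<kappa> * \<rho> ^ q"
        using \<kappa>0 \<Lambda> r' \<rho>r by (intro mult_left_mono power_mono) (auto simp: \<kappa>_def)
      finally show "2 * (U0 * \<Lambda>) + ln (2 * n) \<le> \<kappa> * \<rho> ^ q" .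
    next
      have "r ^ q = r ^ s * r ^ p" using p by (simp add: s_def flip: power_add)
      then have "\<kappa> = \<kappa>0 * (ln r)\<^sup>2 / r ^ p" using r' by (simp add: \<kappa>_def \<Lambda>_def)
      also have "\<dots> \<le> \<kappa>0 * (ln r)\<^sup>2 / r"
        using \<kappa>0 r' p by (intro divide_left_mono self_le_power mult_pos_pos) auto
      finally have "real q * B * \<kappa> \<le> real q * B * (\<kappa>0 * (ln r)\<^sup>2 / r)" using Bq by (intro mult_left_mono) auto
      also have "\<dots> = real q * B * \<kappa>0 * ((ln r)\<^sup>2 / r)" by simp
      also have "\<dots> \<le> real q * B * \<kappa>0 * (1 / (real q * B * \<kappa>0))"
        using r1[OF r'(3)] Bq \<kappa>0 by (intro mult_left_mono) auto
      also have "\<dots> = 1" using mult_pos_pos[OF Bq \<kappa>0] by (metis less_irrefl nonzero_mult_div_cancel_left times_divide_eq_right mult.right_neutral)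
      finally show "real q * (B * \<kappa>) \<le> 1" by (simp add: mult.assoc)
    qed
    then show "\<exists>\<rho>\<in>{x..x + r / r ^ p}. \<rho> \<notin> Y \<and>
      exp_sum_circle J w H q gap W \<rho> (\<kappa>0 * (r ^ s * (ln r)\<^sup>2) / r ^ q) (U0 * (r ^ s * (ln r)\<^sup>2))"
      using \<rho> unfolding \<kappa>_def \<Lambda>_def by blast
  qed
qed

text \<open>Admissible radii exist within \<open>r / r ^ p\<close> on either side of
  \<open>r\<close>, and \<open>zero_count\<close> is monotone. Replacing \<rho> by \<open>r\<close>
  in the main term costs at most a multiple of \<open>r ^ q / r ^ p = r ^ (q - p)\<close>, which
  dictates the length of the window.\<close>

lemma zero_count_asymptotics:
  assumes nz: "\<And>j. j \<in> J \<Longrightarrow> \<exists>z. H j z \<noteq> 0" and gr: "\<And>j. j \<in> J \<Longrightarrow> exp_growth (q - p) (H j)"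
    and p: "1 \<le> p" "p \<le> q"
  obtains D r0 where "\<And>r. r0 \<le> r \<Longrightarrow>
    \<bar>zero_count f r - real q * integral {0..2 * pi} supp * (r ^ q / (2 * pi))\<bar> \<le> D * (r ^ (q - p) * (ln r)\<^sup>2)"
proof -
  define s where "s = q - p"
  define I where "I = integral {0..2 * pi} supp"
  obtain U0 \<kappa>0 r1 where \<kappa>0: "0 < \<kappa>0" and circ: "\<And>r x Y. r1 \<le> r \<Longrightarrow> r / 2 \<le> x \<Longrightarrow> x \<le> r \<Longrightarrow> finite Y \<Longrightarrow>
    \<exists>\<rho>\<in>{x..x + r / r ^ p}. \<rho> \<notin> Y \<and>
      exp_sum_circle J w H q gap W \<rho> (\<kappa>0 * (r ^ s * (ln r)\<^sup>2) / r ^ q) (U0 * (r ^ s * (ln r)\<^sup>2))"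
    using circle_exists[OF nz gr p] unfolding s_def by metis
  define r2 where "r2 = max 4 r1"
  obtain z1 where z1: "f z1 \<noteq> 0"
  proof -
    have "r1 \<le> r2" "r2 / 2 \<le> r2" by (auto simp: r2_def)
    then obtain \<rho> where "exp_sum_circle J w H q gap W \<rho> (\<kappa>0 * (r2 ^ s * (ln r2)\<^sup>2) / r2 ^ q) (U0 * (r2 ^ s * (ln r2)\<^sup>2))"
      using circ[of r2 r2 "{}"] by auto
    then show ?thesis using exp_sum_circle.f_nonzero that by blast
  qed
  define E where "E = (4 * real q * n\<^sup>2 + 1) * (8 + 32 * (1 + W * real q * 2 ^ q * B) + 2 * W * real q * A)"
  have E: "0 \<le> E"
    unfolding E_def using W_nonneg A_pos by (intro mult_nonneg_nonneg add_nonneg_nonneg) (auto simp: B_def)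
  have I: "\<bar>I\<bar> \<le> W * (2 * pi)"
    using integral_bound[of 0 "2 * pi" supp W] continuous_supp abs_supp_le by (simp add: I_def)
  show ?thesis
  proof (rule that[of r2 "E * \<kappa>0 * 2 ^ q + real q * (real q * 2 ^ q) * (W * (2 * pi))"], fold s_def I_def)
    fix r assume "r2 \<le> r"
    then have r: "4 \<le> r" "r1 \<le> r" by (auto simp: r2_def)
    define \<Lambda> where "\<Lambda> = r ^ s * (ln r)\<^sup>2"
    have ln1: "1 \<le> ln r" using r by (intro one_le_ln) auto
    have rs: "r ^ s \<le> \<Lambda>"
      unfolding \<Lambda>_def using r one_le_power[OF ln1, of 2] mult_left_mono[of 1 "(ln r)\<^sup>2" "r ^ s"] by simp
    have rp: "0 \<le> r / r ^ p" "r / r ^ p \<le> 1" using r p by (auto simp: divide_le_eq self_le_power)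
    have zeros: "finite (norm ` {z \<in> cball 0 (2 * r). f z = 0})"
      by (intro finite_imageI entire_finite_zeros[OF f_holomorphic z1]) simp
    \<comment> \<open>Used with \<open>x = r\<close> for a radius above \<open>r\<close> and with
      \<open>x = r - r / r ^ p\<close> for one below.\<close>
    have near: "\<exists>\<rho>\<in>{x..x + r / r ^ p}.
        \<bar>2 * pi * zero_count f \<rho> - real q * I * r ^ q\<bar> \<le> (E * \<kappa>0 * 2 ^ q + real q * (real q * 2 ^ q) * (W * (2 * pi))) * \<Lambda>"
      if x: "r / 2 \<le> x" "x \<le> r" "r - r / r ^ p \<le> x" for x
    proof -
      from circ[OF r(2) x(1,2) zeros] obtain \<rho> where \<rho>: "\<rho> \<in> {x..x + r / r ^ p}"
        "\<rho> \<notin> norm ` {z \<in> cball 0 (2 * r). f z = 0}"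
        "exp_sum_circle J w H q gap W \<rho> (\<kappa>0 * \<Lambda> / r ^ q) (U0 * \<Lambda>)"
        unfolding \<Lambda>_def by blast
      interpret C: exp_sum_circle J w H q gap W \<rho> "\<kappa>0 * \<Lambda> / r ^ q" "U0 * \<Lambda>" by (rule \<rho>(3))
      have "x \<le> \<rho>" "\<rho> \<le> x + r / r ^ p" using \<rho>(1) by auto
      then have \<rho>r: "0 < \<rho>" "\<rho> \<le> 2 * r" "\<bar>\<rho> - r\<bar> \<le> r / r ^ p" using x rp r by linarith+
      have "f z \<noteq> 0" if "norm z = \<rho>" for z using \<rho>(2) \<rho>r(2) that by auto
      then have "\<bar>2 * pi * zero_count f \<rho> - real q * \<rho> ^ q * I\<bar> \<le> E * (\<kappa>0 * \<Lambda> / r ^ q * \<rho> ^ q)"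
        using C.zero_count_estimate unfolding E_def I_def by blast
      also have "\<kappa>0 * \<Lambda> / r ^ q * \<rho> ^ q \<le> \<kappa>0 * \<Lambda> / r ^ q * (2 * r) ^ q"
        using \<rho>r \<kappa>0 r by (intro mult_left_mono power_mono) (auto simp: \<Lambda>_def)
      also have "\<dots> = \<kappa>0 * 2 ^ q * \<Lambda>" using r by (simp add: power_mult_distrib)
      finally have 1: "\<bar>2 * pi * zero_count f \<rho> - real q * \<rho> ^ q * I\<bar> \<le> E * \<kappa>0 * 2 ^ q * \<Lambda>"
        using E by (simp add: mult_left_mono mult.assoc)
      have "\<bar>\<rho> ^ q - r ^ q\<bar> \<le> real q * (2 * r) ^ q * (\<bar>\<rho> - r\<bar> / (2 * r))"
        using norm_power_diff_le[of "of_real \<rho>" "2 * r" "of_real r" q] \<rho>r r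
        by (simp flip: of_real_power of_real_diff)
      also have "\<dots> \<le> real q * (2 * r) ^ q * (r / r ^ p / r)"
        using \<rho>r r rp by (intro mult_left_mono frac_le) auto
      also have "\<dots> = real q * 2 ^ q * r ^ s"
        using r p by (simp add: power_mult_distrib s_def power_diff)
      also have "\<dots> \<le> real q * 2 ^ q * \<Lambda>" using rs by (intro mult_left_mono) auto
      finally have "real q * \<bar>\<rho> ^ q - r ^ q\<bar> * \<bar>I\<bar> \<le> real q * (real q * 2 ^ q * \<Lambda>) * (W * (2 * pi))"
        using I by (intro mult_mono) auto
      then have 2: "\<bar>real q * \<rho> ^ q * I - real q * I * r ^ q\<bar> \<le> real q * (real q * 2 ^ q) * (W * (2 * pi)) * \<Lambda>"
      proof -
        have "real q * \<rho> ^ q * I - real q * I * r ^ q = real q * (\<rho> ^ q - r ^ q) * I" by (simp add: algebra_simps)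
        then have "\<bar>real q * \<rho> ^ q * I - real q * I * r ^ q\<bar> = real q * \<bar>\<rho> ^ q - r ^ q\<bar> * \<bar>I\<bar>"
          by (simp add: abs_mult)
        also have "\<dots> \<le> real q * (real q * 2 ^ q * \<Lambda>) * (W * (2 * pi))" by fact
        finally show ?thesis by (simp only: mult_ac)
      qed
      have "\<bar>2 * pi * zero_count f \<rho> - real q * I * r ^ q\<bar>
          \<le> E * \<kappa>0 * 2 ^ q * \<Lambda> + real q * (real q * 2 ^ q) * (W * (2 * pi)) * \<Lambda>"
        using 1 2 by linarith
      then show ?thesis using \<rho>(1) by (intro bexI[of _ \<rho>]) (simp_all only: distrib_right)
    qed
    define D where "D = (E * \<kappa>0 * 2 ^ q + real q * (real q * 2 ^ q) * (W * (2 * pi))) * \<Lambda>"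
    obtain \<rho>1 where \<rho>1: "r \<le> \<rho>1" "\<bar>2 * pi * zero_count f \<rho>1 - real q * I * r ^ q\<bar> \<le> D"
      using near[of r] r rp unfolding D_def by auto
    have "r / 2 \<le> r - r / r ^ p" "r - r / r ^ p \<le> r" using r rp by linarith+
    then obtain \<rho>2 where \<rho>2: "\<rho>2 \<le> r" "\<bar>2 * pi * zero_count f \<rho>2 - real q * I * r ^ q\<bar> \<le> D"
      using near[of "r - r / r ^ p"] unfolding D_def by auto
    have "2 * pi * zero_count f r \<le> 2 * pi * zero_count f \<rho>1" "2 * pi * zero_count f \<rho>2 \<le> 2 * pi * zero_count f r"
      using zero_count_mono[OF f_holomorphic z1] \<rho>1(1) \<rho>2(1) by (auto intro!: mult_left_mono)
    then have le: "\<bar>2 * pi * zero_count f r - real q * I * r ^ q\<bar> \<le> D" using \<rho>1(2) \<rho>2(2) by linarith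
    have "zero_count f r - real q * I * (r ^ q / (2 * pi)) = (2 * pi * zero_count f r - real q * I * r ^ q) / (2 * pi)"
      by (simp add: field_simps)
    then have "\<bar>zero_count f r - real q * I * (r ^ q / (2 * pi))\<bar> = \<bar>2 * pi * zero_count f r - real q * I * r ^ q\<bar> / (2 * pi)"
      by simp
    also have "\<dots> \<le> \<bar>2 * pi * zero_count f r - real q * I * r ^ q\<bar> / 1"
      using pi_gt3 by (intro divide_left_mono) auto
    also have "\<dots> \<le> D" using le by simp
    finally show "\<bar>zero_count f r - real q * I * (r ^ q / (2 * pi))\<bar>
      \<le> (E * \<kappa>0 * 2 ^ q + real q * (real q * 2 ^ q) * (W * (2 * pi))) * (r ^ s * (ln r)\<^sup>2)"
      by (simp add: D_def \<Lambda>_def)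
  qed
qed

lemma integral_supp: "integral {0..2 * pi} supp = circumference (convex hull ((\<lambda>j. cnj (w j)) ` J))"
proof -
  define F where "F = (\<lambda>\<theta>. Max ((\<lambda>v. v \<bullet> cis \<theta>) ` (\<lambda>j. cnj (w j)) ` J))"
  have "continuous_on UNIV F"
    unfolding F_def using finJ neJ by (intro continuous_on_Max_image continuous_intros) auto
  moreover have "F (\<theta> + 2 * pi) = F \<theta>" for \<theta> by (simp add: F_def cis_mult[symmetric])
  ultimately have "integral {0..2 * pi} (\<lambda>\<theta>. F (real q * \<theta>)) = integral {0..2 * pi} F"
    using q by (intro integral_periodic_dilate) auto
  moreover have "supp \<theta> = F (real q * \<theta>)" for \<theta>
    by (simp only: supp_def F_def image_image inner_cis complex_cnj_cnj)
  then have "supp = (\<lambda>\<theta>. F (real q * \<theta>))" by (rule ext)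
  ultimately show ?thesis
    using integral_support_eq_circumference[of "(\<lambda>j. cnj (w j)) ` J"] finJ neJ by (simp add: F_def)
qed

end

lemma power2_ln_le_powr:
  fixes r :: real
  assumes "3 \<le> r" "0 < \<epsilon>"
  shows "(ln r)\<^sup>2 \<le> ln r powr (3 + \<epsilon>)"
proof -
  have "(ln r)\<^sup>2 = ln r powr 2" using one_le_ln[OF assms(1)] by simp
  also have "\<dots> \<le> ln r powr (3 + \<epsilon>)" using one_le_ln[OF assms(1)] assms(2) by (intro powr_mono) auto
  finally show ?thesis .
qed

text \<open>Covers the case that all coefficients vanish. For positive \<open>r\<close> the index
  set is an infinite ball, and a sum over an infinite set is 0 by convention.\<close>

lemma zero_count_zero: "zero_count (\<lambda>_. 0) r = 0"
proof (cases "0 < r")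
  case True
  have "infinite (ball (0 :: complex) r)" using uncountable_ball[OF True] uncountable_infinite by blast
  moreover have "ball (0 :: complex) r = {z. norm z < r \<and> (0 :: complex) = 0}" by auto
  ultimately show ?thesis unfolding zero_count_def by (metis (no_types, lifting) sum.infinite)
next
  case False
  then have "{z :: complex. norm z < r \<and> (0 :: complex) = 0} = {}"
    by (auto simp: not_less intro: order_trans[OF _ norm_ge_zero])
  then show ?thesis unfolding zero_count_def by (metis (no_types, lifting) sum.empty)
qed

theorem mainTheorem4:
  fixes q p m :: nat
    and f :: "complex \<Rightarrow> complex"
    and H :: "nat \<Rightarrow> complex \<Rightarrow> complex"
    and w :: "nat \<Rightarrow> complex"
    and \<epsilon> :: real
  assumes "1 \<le> q" and "1 \<le> p" and "p \<le> q"
    and "exp_poly_of_order f q"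
    and "f = (\<lambda>z. \<Sum>j\<le>m. H j z * exp (w j * z ^ q))"
    and "w 0 = 0"
    and "inj_on w {..m}"
    and "\<And>j. j \<in> {1..m} \<Longrightarrow> H j \<noteq> (\<lambda>_. 0)"
    and "\<And>j. j \<le> m \<Longrightarrow> \<exists>k\<le>q - p. exp_poly_of_order (H j) k"
    and "\<epsilon> > 0"
  shows "(\<lambda>r. zero_count f r
            - real q * circumference (convex hull (conj_exponents m H w)) * (r ^ q / (2 * pi)))
         \<in> O[at_top](\<lambda>r. r ^ (q - p) * ln r powr (3 + \<epsilon>))"
proof -
  define J where "J = {j. j \<le> m \<and> H j \<noteq> (\<lambda>_. 0)}"
  have finJ: "finite J" by (simp add: J_def)
  have f_J: "f = (\<lambda>z. \<Sum>j\<in>J. H j z * exp (w j * z ^ q))"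
    unfolding assms(5) by (intro ext sum.mono_neutral_right) (auto simp: J_def)
  have conj: "conj_exponents m H w = (\<lambda>j. cnj (w j)) ` J"
  proof -
    \<comment> \<open>Only \<open>H 0\<close> may vanish among the coefficients, and
      \<open>w 0 = 0\<close> yields the point 0.\<close>
    have "J = (if H 0 = (\<lambda>_. 0) then {} else {0}) \<union> {1..m}"
      using assms(8) by (auto simp: J_def not_less_eq_eq intro!: Suc_leI)
    then show ?thesis using assms(6) by (auto simp: conj_exponents_def)
  qed
  show ?thesis
  proof (cases "J = {}")
    case True
    then have "f = (\<lambda>_. 0)" by (simp add: f_J)
    moreover have "circumference {} = 0" by (simp add: circumference_def)
    ultimately show ?thesis using True by (simp add: conj zero_count_zero)
  next
    case False
    \<comment> \<open>The inserted 1 keeps the minimum well defined when \<open>J\<close> has only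
      one element.\<close>
    define gap where "gap = Min (insert 1 ((\<lambda>(j, k). norm (w j - w k)) ` {(j, k) \<in> J \<times> J. j \<noteq> k}))"
    have fin: "finite {(j, k) \<in> J \<times> J. j \<noteq> k}" using finJ by (intro finite_subset[OF _ finite_cartesian_product[OF finJ finJ]]) auto
    have inj: "w j \<noteq> w k" if "j \<in> J" "k \<in> J" "j \<noteq> k" for j k
      using that assms(7) by (auto simp: J_def inj_on_def)
    have growth: "H j holomorphic_on UNIV" "exp_growth (q - p) (H j)" if "j \<in> J" for j
      using assms(9)[of j] that exp_poly_of_order_imp by (auto simp: J_def)
    interpret F: exp_sum J w H q gap "Max ((\<lambda>j. norm (w j)) ` J)"
    proof
      show "0 < gap" unfolding gap_def using fin inj by (subst Min_gr_iff) auto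
      show "gap \<le> norm (w j - w k)" if "j \<in> J" "k \<in> J" "j \<noteq> k" for j k
        unfolding gap_def using that fin by (intro Min_le) auto
      show "norm (w j) \<le> Max ((\<lambda>j. norm (w j)) ` J)" if "j \<in> J" for j
        using that finJ by simp
    qed (use finJ False assms growth in auto)
    have ff: "F.f = f" unfolding f_J F.f_def[abs_def] ..
    have nz: "\<exists>z. H j z \<noteq> 0" if "j \<in> J" for j using that by (auto simp: J_def fun_eq_iff)
    obtain D r0 where D: "\<And>r. r0 \<le> r \<Longrightarrow>
      \<bar>zero_count f r - real q * circumference (convex hull (conj_exponents m H w)) * (r ^ q / (2 * pi))\<bar>
        \<le> D * (r ^ (q - p) * (ln r)\<^sup>2)"
      using F.zero_count_asymptotics[OF nz growth(2) assms(2,3)] unfolding ff F.integral_supp conj by metis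
    show ?thesis
    proof (rule bigoI[of _ "\<bar>D\<bar>"])
      show "\<forall>\<^sub>F r in at_top. norm (zero_count f r - real q * circumference (convex hull (conj_exponents m H w)) *
          (r ^ q / (2 * pi))) \<le> \<bar>D\<bar> * norm (r ^ (q - p) * ln r powr (3 + \<epsilon>))"
        using eventually_ge_at_top[of "max 3 r0"]
      proof eventually_elim
        case (elim r)
        have r: "3 \<le> r" "r0 \<le> r" using elim by auto
        have "D * (r ^ (q - p) * (ln r)\<^sup>2) \<le> \<bar>D\<bar> * (r ^ (q - p) * ln r powr (3 + \<epsilon>))"
          using r power2_ln_le_powr[OF r(1) assms(10)] by (intro mult_mono) auto
        also have "\<dots> = \<bar>D\<bar> * norm (r ^ (q - p) * ln r powr (3 + \<epsilon>))" using r by (simp add: abs_mult)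
        finally show ?case using D[OF r(2)] by simp
      qed
    qed
  qed
qed

end
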